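(* Let $\mathfrak L$ be a weakly Grandis 2-exact 2-category, with respect to a weakly closed 2-ideal $\mathcal N$. Then the class $\mathcal E$ of all $\mathcal N$-2-cokernels and the class $\mathcal M$ of all $\mathcal N$-2-kernels form a relatively orthogonal cokernel-kernel factorization system on $\mathfrak L$ such that there exists a biequivalence over $\mathfrak L$, given by normal pseudofunctors $K\colon\mathfrak E\to\mathfrak M$ and $C\colon\mathfrak M\to\mathfrak E$, between the 2-functors $\operatorname{dom}\colon\mathfrak E\to\mathfrak L$ and $\operatorname{cod}\colon\mathfrak M\to\mathfrak L$ associated to $(\mathcal E,\mathcal M)$. The analogous statement holds for $\mathfrak L$ weakly Puppe 2-exact (with $\mathcal N=(0)$).
   Context: Conventions. 2-categories are strict. Whiskering is written by juxtaposition; a chain $x\Rightarrow y\Rightarrow z$ of 2-cells denotes the vertical composite. 2-ideals. A 2-ideal $\mathcal N=(N,\nu)$ in $\mathfrak L$ is a normal pseudofunctor $N\colon\mathfrak L^{op}\times\mathfrak L\to\mathbf{Cat}$ with a pseudonatural transformation $\nu\colon N\Rightarrow\mathrm{Hom}(-,-)$ whose components $N(A,B)\to\mathrm{Hom}_{\mathfrak L}(A,B)$ are injective on objects and faithful. View $N(A,B)$ as a subcategory of $\mathrm{Hom}(A,B)$: its objects are the null morphisms, its morphisms the null 2-cells; an invertible null 2-cell is an isomorphism of $N(A,B)$. For $n\colon A\to B$ null, $a\colon A'\to A$, $b\colon B\to B'$, put $\widetilde{bna}:=N(a,b)(n)$ and let $\nu=\nu_{a,b,n}\colon bna\Rightarrow\widetilde{bna}$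 be the invertible 2-cell given by pseudonaturality (identities among $a,b$ are omitted from the notation). 2-kernels. An $\mathcal N$-2-kernel of $f\colon A\to B$ is $k\colon K\to A$ with a null $n\colon K\to B$ and an invertible 2-cell $\alpha\colon fk\Rightarrow n$ (structure 2-cell) such that: (1) for every $z\colon Z\to A$, null $p\colon Z\to B$ and invertible $\beta\colon fz\Rightarrow p$ there are $u\colon Z\to K$ and an invertible $\gamma\colon z\Rightarrow ku$ such that $p\xrightarrow{\beta^{-1}}fz\xrightarrow{f\gamma}fku\xrightarrow{\alpha u}nu\xrightarrow{\nu}\widetilde{nu}$ is an invertible null 2-cell; (2) for all $u,v\colon Z\to K$ and $\lambda\colon ku\Rightarrow kv$ such that $\widetilde{nu}\xrightarrow{\nu^{-1}}nu\xrightarrow{\alpha^{-1}u}fku\xrightarrow{f\lambda}fkv\xrightarrow{\alpha v}nv\xrightarrow{\nu}\widetilde{nv}$ is a null 2-cell, there is a unique $\mu\colon u\Rightarrow v$ with $k\mu=\lambda$. $\mathcal N$-2-cokernels are defined dually (reversing morphisms), with structure 2-cell $\beta\colon eg\Rightarrow n$ for $e$ a 2-cokernel of $g$. Weakly closed 2-ideals. An $\mathcal N$-2-kernel $k\colon K\to A$ of $f\colon A\to B$ with structure 2-cell $\alpha\colon fk\Rightarrow n_0$ weakly reflects null morphisms if for all $s\colon D\to K$, null $n\colon D\to A$ and invertible $\delta\colon ks\Rightarrow n$ such that $\widetilde{fn}\xrightarrow{\nu^{-1}}fn\xrightarrow{f\delta^{-1}}fks\xrightarrow{\alpha s}n_0s\xrightarrow{\nu}\widetilde{n_0s}$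 is an invertible null 2-cell, there are a null $\hat\psi\colon D\to K$ and an invertible $\psi\colon s\Rightarrow\hat\psi$ such that $n\xrightarrow{\delta^{-1}}ks\xrightarrow{k\psi}k\hat\psi\xrightarrow{\nu}\widetilde{k\hat\psi}$ is an invertible null 2-cell. $k$ reflects null 2-cells if for every 2-cell $\mu\colon s\Rightarrow s'\colon D\to K$ between null morphisms, if $\widetilde{ks}\xrightarrow{\nu^{-1}}ks\xrightarrow{k\mu}ks'\xrightarrow{\nu}\widetilde{ks'}$ is null then $\mu$ is null. "(Weakly) coreflects" is dual. If $\mathfrak L$ has all $\mathcal N$-2-kernels and $\mathcal N$-2-cokernels, $\mathcal N$ is weakly closed if all $\mathcal N$-2-kernels weakly reflect null morphisms and reflect null 2-cells and all $\mathcal N$-2-cokernels weakly coreflect null morphisms and coreflect null 2-cells. Weak exactness. A weakly Grandis 2-exact 2-category is a 2-category $\mathfrak L$ with a 2-ideal $\mathcal N$ such that: $\mathfrak L$ has all $\mathcal N$-2-kernels and $\mathcal N$-2-cokernels; $\mathcal N$ is weakly closed; every $\mathcal N$-2-kernel $m$ is an $\mathcal N$-2-kernel of its $\mathcal N$-2-cokernel $c_m$, with structure 2-cell given up to an invertible null 2-cell by that of the $\mathcal N$-2-cokernel $c_m$ of $m$, and dually for $\mathcal N$-2-cokernels; every morphism is isomorphic to an $\mathcal N$-2-cokernel followed by an $\mathcal N$-2-kernel. A weakly Puppe 2-exact 2-category is a 2-category with a chosen bizero object $0$ (all $\mathfrak L(A,0)$, $\mathfrak L(0,A)$ equivalent to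 the terminal category) satisfying these conditions for the 2-ideal $(0)$: null morphisms are those factoring as $A\xrightarrow{t}0\xrightarrow{i}B$; null 2-cells $it\Rightarrow i't'$ are the pastings of the unique 2-cells $t\Rightarrow t'$, $i\Rightarrow i'$; $\widetilde{bna}=bna$ and $\nu=\mathrm{id}$. Relatively orthogonal cokernel-kernel factorization system (with respect to $\mathcal N$): a pair $(\mathcal E,\mathcal M)$ of classes of morphisms such that (i) every morphism in $\mathcal E$ is an $\mathcal N$-2-cokernel and every morphism in $\mathcal M$ is an $\mathcal N$-2-kernel; (ii) every morphism is isomorphic to a morphism in $\mathcal E$ followed by one in $\mathcal M$; (iii) if $m\in\mathcal M$ and $i$ is an equivalence then $m\circ i\in\mathcal M$, and dually for $\mathcal E$; (iv) if $m\in\mathcal M$ and $m\Rightarrow f$ is an invertible 2-cell then $f\in\mathcal M$, and dually for $\mathcal E$; (v) given $e\colon D\to R$ in $\mathcal E$, $m\colon Q\to A$ in $\mathcal M$, $s\colon D\to Q$, $t\colon R\to A$ and invertible $\phi\colon ms\Rightarrow te$, where $m$ is the $\mathcal N$-2-kernel of $f\colon A\to B$ with structure 2-cell $\alpha\colon fm\Rightarrow n_m$ and $e$ is the $\mathcal N$-2-cokernel of $g\colon C\to D$ with structure 2-cell $\beta\colon eg\Rightarrow n_e$, such that $\widetilde{n_msg}\xrightarrow{\nu^{-1}}n_msg\xrightarrow{\alpha^{-1}sg}fmsg\xrightarrow{f\phi g}fteg\xrightarrow{ft\beta}ftn_e\xrightarrow{\nu}\widetilde{ftn_e}$ is an invertible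 null 2-cell, there are $d\colon R\to Q$ and invertible $\sigma\colon s\Rightarrow de$, $\rho\colon md\Rightarrow t$ with $\phi=(\rho e)\circ(m\sigma)$; moreover, given squares $(s,t,\phi)$, $(s',t',\phi')$ from $e$ to $m$ filled in this sense by $(d,\sigma,\rho)$, $(d',\sigma',\rho')$ and 2-cells $\lambda\colon s\Rightarrow s'$, $\mu\colon t\Rightarrow t'$ with $\phi'\circ(m\lambda)=(\mu e)\circ\phi$, there is a unique $\iota\colon d\Rightarrow d'$ with $\rho'\circ(m\iota)=\mu\circ\rho$ and $(\iota e)\circ\sigma=\sigma'\circ\lambda$. The 2-functors dom and cod. The pseudo arrow 2-category of $\mathfrak L$ has as objects the morphisms of $\mathfrak L$, as morphisms the squares filled with an invertible 2-cell, as 2-cells the pairs of 2-cells of $\mathfrak L$ (between the two horizontal sides) compatible with the filling 2-cells. $\mathfrak E$ and $\mathfrak M$ are its full sub-2-categories on morphisms in $\mathcal E$ and in $\mathcal M$, with domain and codomain 2-functors $\operatorname{dom}\colon\mathfrak E\to\mathfrak L$, $\operatorname{cod}\colon\mathfrak M\to\mathfrak L$. A biequivalence over $\mathfrak L$ between them consists of pseudofunctors $K,C$ with $\operatorname{cod}\circ K=\operatorname{dom}$, $\operatorname{dom}\circ C=\operatorname{cod}$ and pseudonatural equivalences $\mathrm{Id}\Rightarrow K C$, $CK\Rightarrow\mathrm{Id}$ lying over $\mathfrak L$ (components and structure 2-cells are sent to identities in $\mathfrak L$). A pseudofunctor is normal if it strictly preserves identities. *)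

theory Defs
  imports Main "HOL-Library.FuncSet"
begin

section \<open>Strict 2-categories\<close>

text \<open>Composition of 1-cells and both compositions of 2-cells are written in applicative order:
  \<open>g \<odot> f\<close> and \<open>y \<bullet> x\<close> mean \<open>f\<close>, resp. \<open>x\<close>, first.\<close>

record ('o, 'm, 'c) two_cat =
  Obj :: "'o set"
  Mor :: "'m set"
  Cell :: "'c set"
  Dom :: "'m \<Rightarrow> 'o"
  Cod :: "'m \<Rightarrow> 'o"
  Src :: "'c \<Rightarrow> 'm"
  Trg :: "'c \<Rightarrow> 'm"
  Id1 :: "'o \<Rightarrow> 'm"
  Comp :: "'m \<Rightarrow> 'm \<Rightarrow> 'm"  (infixr "\<odot>\<index>" 80)
  Id2 :: "'m \<Rightarrow> 'c"
  VComp :: "'c \<Rightarrow> 'c \<Rightarrow> 'c"  (infixr "\<bullet>\<index>" 70)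
  HComp :: "'c \<Rightarrow> 'c \<Rightarrow> 'c"  (infixr "\<star>\<index>" 75)

abbreviation whisker_left :: "('o, 'm, 'c) two_cat \<Rightarrow> 'm \<Rightarrow> 'c \<Rightarrow> 'c"  (infixr "\<rhd>\<index>" 75)
  where "f \<rhd>\<^bsub>L\<^esub> x \<equiv> HComp L (Id2 L f) x"

abbreviation whisker_right :: "('o, 'm, 'c) two_cat \<Rightarrow> 'c \<Rightarrow> 'm \<Rightarrow> 'c"  (infixl "\<lhd>\<index>" 76)
  where "x \<lhd>\<^bsub>L\<^esub> f \<equiv> HComp L x (Id2 L f)"

definition hom :: "('o, 'm, 'c) two_cat \<Rightarrow> 'o \<Rightarrow> 'o \<Rightarrow> 'm set" where
  "hom L A B = {f \<in> Mor L. Dom L f = A \<and> Cod L f = B}"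

definition cells :: "('o, 'm, 'c) two_cat \<Rightarrow> 'm \<Rightarrow> 'm \<Rightarrow> 'c set" where
  "cells L f g = {x \<in> Cell L. Src L x = f \<and> Trg L x = g}"

definition inverse_cells :: "('o, 'm, 'c) two_cat \<Rightarrow> 'c \<Rightarrow> 'c \<Rightarrow> bool" where
  "inverse_cells L x y \<longleftrightarrow>
     x \<in> Cell L \<and> y \<in> cells L (Trg L x) (Src L x) \<and>
     y \<bullet>\<^bsub>L\<^esub> x = Id2 L (Src L x) \<and> x \<bullet>\<^bsub>L\<^esub> y = Id2 L (Trg L x)"

definition iso_cells :: "('o, 'm, 'c) two_cat \<Rightarrow> 'm \<Rightarrow> 'm \<Rightarrow> 'c set" where
  "iso_cells L f g = {x \<in> cells L f g. \<exists>y. inverse_cells L x y}"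

definition cinv :: "('o, 'm, 'c) two_cat \<Rightarrow> 'c \<Rightarrow> 'c" where
  "cinv L x = (THE y. inverse_cells L x y)"

locale two_category =
  fixes L :: "('o, 'm, 'c) two_cat" (structure)
  assumes Dom_Obj: "f \<in> Mor L \<Longrightarrow> Dom L f \<in> Obj L"
    and Cod_Obj: "f \<in> Mor L \<Longrightarrow> Cod L f \<in> Obj L"
    and Id1_hom: "A \<in> Obj L \<Longrightarrow> Id1 L A \<in> hom L A A"
    and Comp_hom: "\<lbrakk>f \<in> hom L A B; g \<in> hom L B C\<rbrakk> \<Longrightarrow> g \<odot> f \<in> hom L A C"
    and Comp_assoc: "\<lbrakk>f \<in> hom L A B; g \<in> hom L B C; h \<in> hom L C D\<rbrakk>
          \<Longrightarrow> (h \<odot> g) \<odot> f = h \<odot> (g \<odot> f)"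
    and Comp_Id1_right: "f \<in> hom L A B \<Longrightarrow> f \<odot> Id1 L A = f"
    and Comp_Id1_left: "f \<in> hom L A B \<Longrightarrow> Id1 L B \<odot> f = f"
    and Src_Mor: "x \<in> Cell L \<Longrightarrow> Src L x \<in> Mor L"
    and Trg_Mor: "x \<in> Cell L \<Longrightarrow> Trg L x \<in> Mor L"
    and Dom_Trg: "x \<in> Cell L \<Longrightarrow> Dom L (Trg L x) = Dom L (Src L x)"
    and Cod_Trg: "x \<in> Cell L \<Longrightarrow> Cod L (Trg L x) = Cod L (Src L x)"
    and Id2_cells: "f \<in> Mor L \<Longrightarrow> Id2 L f \<in> cells L f f"
    and VComp_cells: "\<lbrakk>x \<in> cells L f g; y \<in> cells L g h\<rbrakk> \<Longrightarrow> y \<bullet> x \<in> cells L f h"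
    and VComp_assoc: "\<lbrakk>x \<in> cells L f g; y \<in> cells L g h; z \<in> cells L h k\<rbrakk>
          \<Longrightarrow> (z \<bullet> y) \<bullet> x = z \<bullet> (y \<bullet> x)"
    and VComp_Id2_right: "x \<in> cells L f g \<Longrightarrow> x \<bullet> Id2 L f = x"
    and VComp_Id2_left: "x \<in> cells L f g \<Longrightarrow> Id2 L g \<bullet> x = x"
    and HComp_cells: "\<lbrakk>x \<in> cells L f f'; y \<in> cells L g g'; f \<in> hom L A B; g \<in> hom L B C\<rbrakk>
          \<Longrightarrow> y \<star> x \<in> cells L (g \<odot> f) (g' \<odot> f')"
    and HComp_assoc: "\<lbrakk>x \<in> Cell L; y \<in> Cell L; z \<in> Cell L;
            Src L x \<in> hom L A B; Src L y \<in> hom L B C; Src L z \<in> hom L C D\<rbrakk>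
          \<Longrightarrow> (z \<star> y) \<star> x = z \<star> (y \<star> x)"
    and HComp_Id1_right: "\<lbrakk>x \<in> Cell L; Src L x \<in> hom L A B\<rbrakk> \<Longrightarrow> x \<star> Id2 L (Id1 L A) = x"
    and HComp_Id1_left: "\<lbrakk>x \<in> Cell L; Src L x \<in> hom L A B\<rbrakk> \<Longrightarrow> Id2 L (Id1 L B) \<star> x = x"
    and HComp_Id2: "\<lbrakk>f \<in> hom L A B; g \<in> hom L B C\<rbrakk> \<Longrightarrow> Id2 L g \<star> Id2 L f = Id2 L (g \<odot> f)"
    and interchange: "\<lbrakk>x \<in> cells L f f'; x' \<in> cells L f' f''; y \<in> cells L g g'; y' \<in> cells L g' g'';
            f \<in> hom L A B; g \<in> hom L B C\<rbrakk>
          \<Longrightarrow> (y' \<bullet> y) \<star> (x' \<bullet> x) = (y' \<star> x') \<bullet> (y \<star> x)"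

definition equivalence :: "('o, 'm, 'c) two_cat \<Rightarrow> 'm \<Rightarrow> bool" where
  "equivalence L f \<longleftrightarrow> f \<in> Mor L \<and>
     (\<exists>g \<in> hom L (Cod L f) (Dom L f).
        iso_cells L (Id1 L (Dom L f)) (g \<odot>\<^bsub>L\<^esub> f) \<noteq> {} \<and>
        iso_cells L (f \<odot>\<^bsub>L\<^esub> g) (Id1 L (Cod L f)) \<noteq> {})"

text \<open>The dual reverses 1-cells only.\<close>

definition op2 :: "('o, 'm, 'c) two_cat \<Rightarrow> ('o, 'm, 'c) two_cat" where
  "op2 L = \<lparr>Obj = Obj L, Mor = Mor L, Cell = Cell L, Dom = Cod L, Cod = Dom L,
     Src = Src L, Trg = Trg L, Id1 = Id1 L, Comp = (\<lambda>g f. f \<odot>\<^bsub>L\<^esub> g),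
     Id2 = Id2 L, VComp = VComp L, HComp = (\<lambda>y x. x \<star>\<^bsub>L\<^esub> y)\<rparr>"

definition prod2 :: "('o, 'm, 'c) two_cat \<Rightarrow> ('p, 'n, 'd) two_cat
    \<Rightarrow> ('o \<times> 'p, 'm \<times> 'n, 'c \<times> 'd) two_cat" where
  "prod2 L M = \<lparr>Obj = Obj L \<times> Obj M, Mor = Mor L \<times> Mor M, Cell = Cell L \<times> Cell M,
     Dom = map_prod (Dom L) (Dom M), Cod = map_prod (Cod L) (Cod M),
     Src = map_prod (Src L) (Src M), Trg = map_prod (Trg L) (Trg M),
     Id1 = map_prod (Id1 L) (Id1 M),
     Comp = (\<lambda>(g, g') (f, f'). (g \<odot>\<^bsub>L\<^esub> f, g' \<odot>\<^bsub>M\<^esub> f')),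
     Id2 = map_prod (Id2 L) (Id2 M),
     VComp = (\<lambda>(y, y') (x, x'). (y \<bullet>\<^bsub>L\<^esub> x, y' \<bullet>\<^bsub>M\<^esub> x')),
     HComp = (\<lambda>(y, y') (x, x'). (y \<star>\<^bsub>L\<^esub> x, y' \<star>\<^bsub>M\<^esub> x'))\<rparr>"

definition full_sub :: "('o, 'm, 'c) two_cat \<Rightarrow> 'o set \<Rightarrow> ('o, 'm, 'c) two_cat" where
  "full_sub L S = L\<lparr>Obj := Obj L \<inter> S,
     Mor := {f \<in> Mor L. Dom L f \<in> S \<and> Cod L f \<in> S},
     Cell := {x \<in> Cell L. Dom L (Src L x) \<in> S \<and> Cod L (Src L x) \<in> S}\<rparr>"


section \<open>Pseudofunctors and pseudonatural transformations\<close>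

text \<open>The constraint 2-cells of \<open>F\<close> are \<open>PComp F g f : F g \<odot> F f \<Rightarrow> F (g \<odot> f)\<close> and
  \<open>PUnit F A : Id1 (F A) \<Rightarrow> F (Id1 A)\<close>.\<close>

record ('o, 'm, 'c, 'p, 'n, 'd) pfun =
  PObj :: "'o \<Rightarrow> 'p"
  PMor :: "'m \<Rightarrow> 'n"
  PCell :: "'c \<Rightarrow> 'd"
  PComp :: "'m \<Rightarrow> 'm \<Rightarrow> 'd"
  PUnit :: "'o \<Rightarrow> 'd"

locale pseudofunctor = L: two_category L + M: two_category M
  for L :: "('o, 'm, 'c) two_cat" and M :: "('p, 'n, 'd) two_cat" +
  fixes F :: "('o, 'm, 'c, 'p, 'n, 'd) pfun"
  assumes PObj_Obj: "A \<in> Obj L \<Longrightarrow> PObj F A \<in> Obj M"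
    and PMor_hom: "f \<in> hom L A B \<Longrightarrow> PMor F f \<in> hom M (PObj F A) (PObj F B)"
    and PCell_cells: "x \<in> cells L f g \<Longrightarrow> PCell F x \<in> cells M (PMor F f) (PMor F g)"
    and PCell_Id2: "f \<in> Mor L \<Longrightarrow> PCell F (Id2 L f) = Id2 M (PMor F f)"
    and PCell_VComp: "\<lbrakk>x \<in> cells L f g; y \<in> cells L g h\<rbrakk>
          \<Longrightarrow> PCell F (y \<bullet>\<^bsub>L\<^esub> x) = PCell F y \<bullet>\<^bsub>M\<^esub> PCell F x"
    and PComp_iso: "\<lbrakk>f \<in> hom L A B; g \<in> hom L B C\<rbrakk>
          \<Longrightarrow> PComp F g f \<in> iso_cells M (PMor F g \<odot>\<^bsub>M\<^esub> PMor F f) (PMor F (g \<odot>\<^bsub>L\<^esub> f))"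
    and PComp_natural: "\<lbrakk>x \<in> cells L f f'; y \<in> cells L g g'; f \<in> hom L A B; g \<in> hom L B C\<rbrakk>
          \<Longrightarrow> PComp F g' f' \<bullet>\<^bsub>M\<^esub> (PCell F y \<star>\<^bsub>M\<^esub> PCell F x)
            = PCell F (y \<star>\<^bsub>L\<^esub> x) \<bullet>\<^bsub>M\<^esub> PComp F g f"
    and PComp_assoc: "\<lbrakk>f \<in> hom L A B; g \<in> hom L B C; h \<in> hom L C D\<rbrakk>
          \<Longrightarrow> PComp F h (g \<odot>\<^bsub>L\<^esub> f) \<bullet>\<^bsub>M\<^esub> (PMor F h \<rhd>\<^bsub>M\<^esub> PComp F g f)
            = PComp F (h \<odot>\<^bsub>L\<^esub> g) f \<bullet>\<^bsub>M\<^esub> (PComp F h g \<lhd>\<^bsub>M\<^esub> PMor F f)"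
    and PUnit_iso: "A \<in> Obj L \<Longrightarrow> PUnit F A \<in> iso_cells M (Id1 M (PObj F A)) (PMor F (Id1 L A))"
    and PComp_unit_right: "f \<in> hom L A B
          \<Longrightarrow> PComp F f (Id1 L A) \<bullet>\<^bsub>M\<^esub> (PMor F f \<rhd>\<^bsub>M\<^esub> PUnit F A) = Id2 M (PMor F f)"
    and PComp_unit_left: "f \<in> hom L A B
          \<Longrightarrow> PComp F (Id1 L B) f \<bullet>\<^bsub>M\<^esub> (PUnit F B \<lhd>\<^bsub>M\<^esub> PMor F f) = Id2 M (PMor F f)"

definition normal :: "('o, 'm, 'c) two_cat \<Rightarrow> ('p, 'n, 'd) two_cat
    \<Rightarrow> ('o, 'm, 'c, 'p, 'n, 'd) pfun \<Rightarrow> bool" where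
  "normal L M F \<longleftrightarrow> (\<forall>A \<in> Obj L. PMor F (Id1 L A) = Id1 M (PObj F A) \<and>
     PUnit F A = Id2 M (Id1 M (PObj F A)))"

definition strict_pfun :: "('o, 'm, 'c) two_cat \<Rightarrow> ('p, 'n, 'd) two_cat
    \<Rightarrow> ('o \<Rightarrow> 'p) \<Rightarrow> ('m \<Rightarrow> 'n) \<Rightarrow> ('c \<Rightarrow> 'd) \<Rightarrow> ('o, 'm, 'c, 'p, 'n, 'd) pfun" where
  "strict_pfun L M po pm pc = \<lparr>PObj = po, PMor = pm, PCell = pc,
     PComp = (\<lambda>g f. Id2 M (pm (g \<odot>\<^bsub>L\<^esub> f))), PUnit = (\<lambda>A. Id2 M (Id1 M (po A)))\<rparr>"

definition id_pfun :: "('o, 'm, 'c) two_cat \<Rightarrow> ('o, 'm, 'c, 'o, 'm, 'c) pfun" where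
  "id_pfun L = strict_pfun L L (\<lambda>A. A) (\<lambda>f. f) (\<lambda>x. x)"

text \<open>\<open>comp_pfun P G F\<close> is \<open>G\<close> after \<open>F\<close>, where \<open>P\<close> is the target of \<open>G\<close>.\<close>

definition comp_pfun :: "('r, 'l, 'e) two_cat \<Rightarrow> ('p, 'n, 'd, 'r, 'l, 'e) pfun
    \<Rightarrow> ('o, 'm, 'c, 'p, 'n, 'd) pfun \<Rightarrow> ('o, 'm, 'c, 'r, 'l, 'e) pfun" where
  "comp_pfun P G F = \<lparr>PObj = (\<lambda>A. PObj G (PObj F A)), PMor = (\<lambda>f. PMor G (PMor F f)),
     PCell = (\<lambda>x. PCell G (PCell F x)),
     PComp = (\<lambda>g f. PCell G (PComp F g f) \<bullet>\<^bsub>P\<^esub> PComp G (PMor F g) (PMor F f)),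
     PUnit = (\<lambda>A. PCell G (PUnit F A) \<bullet>\<^bsub>P\<^esub> PUnit G (PObj F A))\<rparr>"

text \<open>Equality of pseudofunctors, i.e. agreement on the carriers of the source.\<close>

definition pfun_eq :: "('o, 'm, 'c) two_cat \<Rightarrow> ('o, 'm, 'c, 'p, 'n, 'd) pfun
    \<Rightarrow> ('o, 'm, 'c, 'p, 'n, 'd) pfun \<Rightarrow> bool" where
  "pfun_eq L F G \<longleftrightarrow>
     (\<forall>A \<in> Obj L. PObj F A = PObj G A \<and> PUnit F A = PUnit G A) \<and>
     (\<forall>f \<in> Mor L. PMor F f = PMor G f) \<and>
     (\<forall>x \<in> Cell L. PCell F x = PCell G x) \<and>
     (\<forall>f \<in> Mor L. \<forall>g \<in> Mor L. Dom L g = Cod L f \<longrightarrow> PComp F g f = PComp G g f)"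

text \<open>The structure 2-cell of \<open>T : F \<Rightarrow> G\<close> at \<open>f : A \<rightarrow> B\<close> is
  \<open>TCell T f : G f \<odot> T A \<Rightarrow> T B \<odot> F f\<close>.\<close>

record ('o, 'm, 'n, 'd) ptrans =
  TComp :: "'o \<Rightarrow> 'n"
  TCell :: "'m \<Rightarrow> 'd"

locale pseudonatural = F: pseudofunctor L M F + G: pseudofunctor L M G
  for L :: "('o, 'm, 'c) two_cat" and M :: "('p, 'n, 'd) two_cat"
    and F :: "('o, 'm, 'c, 'p, 'n, 'd) pfun" and G :: "('o, 'm, 'c, 'p, 'n, 'd) pfun" +
  fixes T :: "('o, 'm, 'n, 'd) ptrans"
  assumes TComp_hom: "A \<in> Obj L \<Longrightarrow> TComp T A \<in> hom M (PObj F A) (PObj G A)"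
    and TCell_iso: "f \<in> hom L A B
          \<Longrightarrow> TCell T f \<in> iso_cells M (PMor G f \<odot>\<^bsub>M\<^esub> TComp T A) (TComp T B \<odot>\<^bsub>M\<^esub> PMor F f)"
    and TCell_natural: "\<lbrakk>x \<in> cells L f g; f \<in> hom L A B\<rbrakk>
          \<Longrightarrow> TCell T g \<bullet>\<^bsub>M\<^esub> (PCell G x \<lhd>\<^bsub>M\<^esub> TComp T A)
            = (TComp T B \<rhd>\<^bsub>M\<^esub> PCell F x) \<bullet>\<^bsub>M\<^esub> TCell T f"
    and TCell_Comp: "\<lbrakk>f \<in> hom L A B; g \<in> hom L B C\<rbrakk>
          \<Longrightarrow> TCell T (g \<odot>\<^bsub>L\<^esub> f) \<bullet>\<^bsub>M\<^esub> (PComp G g f \<lhd>\<^bsub>M\<^esub> TComp T A)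
            = (TComp T C \<rhd>\<^bsub>M\<^esub> PComp F g f) \<bullet>\<^bsub>M\<^esub> (TCell T g \<lhd>\<^bsub>M\<^esub> PMor F f)
                \<bullet>\<^bsub>M\<^esub> (PMor G g \<rhd>\<^bsub>M\<^esub> TCell T f)"
    and TCell_Id1: "A \<in> Obj L
          \<Longrightarrow> TCell T (Id1 L A) \<bullet>\<^bsub>M\<^esub> (PUnit G A \<lhd>\<^bsub>M\<^esub> TComp T A)
            = TComp T A \<rhd>\<^bsub>M\<^esub> PUnit F A"

definition pseudonatural_equivalence :: "('o, 'm, 'c) two_cat \<Rightarrow> ('p, 'n, 'd) two_cat
    \<Rightarrow> ('o, 'm, 'c, 'p, 'n, 'd) pfun \<Rightarrow> ('o, 'm, 'c, 'p, 'n, 'd) pfun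
    \<Rightarrow> ('o, 'm, 'n, 'd) ptrans \<Rightarrow> bool" where
  "pseudonatural_equivalence L M F G T \<longleftrightarrow>
     pseudonatural L M F G T \<and> (\<forall>A \<in> Obj L. equivalence M (TComp T A))"

definition lies_over :: "('o, 'm, 'c) two_cat \<Rightarrow> ('p, 'n, 'd) two_cat
    \<Rightarrow> ('o, 'm, 'c, 'p, 'n, 'd) pfun \<Rightarrow> ('o, 'm, 'm, 'c) ptrans \<Rightarrow> bool" where
  "lies_over X L P T \<longleftrightarrow>
     (\<forall>A \<in> Obj X. PMor P (TComp T A) = Id1 L (PObj P A)) \<and>
     (\<forall>f \<in> Mor X. PCell P (TCell T f) = Id2 L (PMor P f))"

definition biequivalence_over :: "('o, 'm, 'c) two_cat
    \<Rightarrow> ('p, 'n, 'd) two_cat \<Rightarrow> ('p, 'n, 'd, 'o, 'm, 'c) pfun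
    \<Rightarrow> ('q, 'l, 'e) two_cat \<Rightarrow> ('q, 'l, 'e, 'o, 'm, 'c) pfun
    \<Rightarrow> ('p, 'n, 'd, 'q, 'l, 'e) pfun \<Rightarrow> ('q, 'l, 'e, 'p, 'n, 'd) pfun \<Rightarrow> bool" where
  "biequivalence_over L X P Y Q K C \<longleftrightarrow>
     pseudofunctor X L P \<and> pseudofunctor Y L Q \<and>
     pseudofunctor X Y K \<and> pseudofunctor Y X C \<and>
     pfun_eq X (comp_pfun L Q K) P \<and> pfun_eq Y (comp_pfun L P C) Q \<and>
     (\<exists>\<eta>. pseudonatural_equivalence Y Y (id_pfun Y) (comp_pfun Y K C) \<eta> \<and> lies_over Y L Q \<eta>) \<and>
     (\<exists>\<epsilon>. pseudonatural_equivalence X X (comp_pfun X C K) (id_pfun X) \<epsilon> \<and> lies_over X L P \<epsilon>)"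


section \<open>The 2-category of categories\<close>

record ('x, 'y) cat1 =
  CObj :: "'x set"
  CArr :: "'y set"
  CDom :: "'y \<Rightarrow> 'x"
  CCod :: "'y \<Rightarrow> 'x"
  CId :: "'x \<Rightarrow> 'y"
  CComp :: "'y \<Rightarrow> 'y \<Rightarrow> 'y"

locale category =
  fixes X :: "('x, 'y) cat1"
  assumes CDom_CObj: "u \<in> CArr X \<Longrightarrow> CDom X u \<in> CObj X"
    and CCod_CObj: "u \<in> CArr X \<Longrightarrow> CCod X u \<in> CObj X"
    and CId_CArr: "a \<in> CObj X \<Longrightarrow> CId X a \<in> CArr X \<and> CDom X (CId X a) = a \<and> CCod X (CId X a) = a"
    and CComp_CArr: "\<lbrakk>u \<in> CArr X; v \<in> CArr X; CDom X v = CCod X u\<rbrakk>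
          \<Longrightarrow> CComp X v u \<in> CArr X \<and> CDom X (CComp X v u) = CDom X u \<and> CCod X (CComp X v u) = CCod X v"
    and CComp_assoc: "\<lbrakk>u \<in> CArr X; v \<in> CArr X; w \<in> CArr X; CDom X v = CCod X u; CDom X w = CCod X v\<rbrakk>
          \<Longrightarrow> CComp X (CComp X w v) u = CComp X w (CComp X v u)"
    and CComp_CId_right: "u \<in> CArr X \<Longrightarrow> CComp X u (CId X (CDom X u)) = u"
    and CComp_CId_left: "u \<in> CArr X \<Longrightarrow> CComp X (CId X (CCod X u)) u = u"

text \<open>Functors and natural transformations carry their source and target, and their underlying
  functions are \<open>extensional\<close>, so that equality is the intended one.\<close>

record ('x, 'y) fun1 =
  FDom :: "('x, 'y) cat1"
  FCod :: "('x, 'y) cat1"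
  FObj :: "'x \<Rightarrow> 'x"
  FArr :: "'y \<Rightarrow> 'y"

definition is_functor :: "('x, 'y) fun1 \<Rightarrow> bool" where
  "is_functor F \<longleftrightarrow> category (FDom F) \<and> category (FCod F) \<and>
     FObj F \<in> CObj (FDom F) \<rightarrow>\<^sub>E CObj (FCod F) \<and>
     FArr F \<in> CArr (FDom F) \<rightarrow>\<^sub>E CArr (FCod F) \<and>
     (\<forall>u \<in> CArr (FDom F). CDom (FCod F) (FArr F u) = FObj F (CDom (FDom F) u) \<and>
                           CCod (FCod F) (FArr F u) = FObj F (CCod (FDom F) u)) \<and>
     (\<forall>a \<in> CObj (FDom F). FArr F (CId (FDom F) a) = CId (FCod F) (FObj F a)) \<and>
     (\<forall>u \<in> CArr (FDom F). \<forall>v \<in> CArr (FDom F). CDom (FDom F) v = CCod (FDom F) u \<longrightarrow>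
        FArr F (CComp (FDom F) v u) = CComp (FCod F) (FArr F v) (FArr F u))"

definition faithful :: "('x, 'y) fun1 \<Rightarrow> bool" where
  "faithful F \<longleftrightarrow> (\<forall>u \<in> CArr (FDom F). \<forall>v \<in> CArr (FDom F).
     CDom (FDom F) u = CDom (FDom F) v \<and> CCod (FDom F) u = CCod (FDom F) v \<and>
     FArr F u = FArr F v \<longrightarrow> u = v)"

record ('x, 'y) nat1 =
  NSrc :: "('x, 'y) fun1"
  NTrg :: "('x, 'y) fun1"
  NComp :: "'x \<Rightarrow> 'y"

definition is_nat :: "('x, 'y) nat1 \<Rightarrow> bool" where
  "is_nat T \<longleftrightarrow> (let F = NSrc T; G = NTrg T; X = FDom F; Y = FCod F in
     is_functor F \<and> is_functor G \<and> FDom G = X \<and> FCod G = Y \<and>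
     NComp T \<in> CObj X \<rightarrow>\<^sub>E CArr Y \<and>
     (\<forall>a \<in> CObj X. CDom Y (NComp T a) = FObj F a \<and> CCod Y (NComp T a) = FObj G a) \<and>
     (\<forall>u \<in> CArr X. CComp Y (NComp T (CCod X u)) (FArr F u) = CComp Y (FArr G u) (NComp T (CDom X u))))"

definition Cat :: "(('x, 'y) cat1, ('x, 'y) fun1, ('x, 'y) nat1) two_cat" where
  "Cat = \<lparr>Obj = {X. category X}, Mor = {F. is_functor F}, Cell = {T. is_nat T},
     Dom = FDom, Cod = FCod, Src = NSrc, Trg = NTrg,
     Id1 = (\<lambda>X. \<lparr>FDom = X, FCod = X, FObj = restrict (\<lambda>a. a) (CObj X), FArr = restrict (\<lambda>u. u) (CArr X)\<rparr>),
     Comp = (\<lambda>G F. \<lparr>FDom = FDom F, FCod = FCod G,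
        FObj = restrict (\<lambda>a. FObj G (FObj F a)) (CObj (FDom F)),
        FArr = restrict (\<lambda>u. FArr G (FArr F u)) (CArr (FDom F))\<rparr>),
     Id2 = (\<lambda>F. \<lparr>NSrc = F, NTrg = F,
        NComp = restrict (\<lambda>a. CId (FCod F) (FObj F a)) (CObj (FDom F))\<rparr>),
     VComp = (\<lambda>T S. \<lparr>NSrc = NSrc S, NTrg = NTrg T,
        NComp = restrict (\<lambda>a. CComp (FCod (NSrc S)) (NComp T a) (NComp S a)) (CObj (FDom (NSrc S)))\<rparr>),
     HComp = (\<lambda>T S.
        \<lparr>NSrc = \<lparr>FDom = FDom (NSrc S), FCod = FCod (NSrc T),
                 FObj = restrict (\<lambda>a. FObj (NSrc T) (FObj (NSrc S) a)) (CObj (FDom (NSrc S))),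
                 FArr = restrict (\<lambda>u. FArr (NSrc T) (FArr (NSrc S) u)) (CArr (FDom (NSrc S)))\<rparr>,
         NTrg = \<lparr>FDom = FDom (NTrg S), FCod = FCod (NTrg T),
                 FObj = restrict (\<lambda>a. FObj (NTrg T) (FObj (NTrg S) a)) (CObj (FDom (NTrg S))),
                 FArr = restrict (\<lambda>u. FArr (NTrg T) (FArr (NTrg S) u)) (CArr (FDom (NTrg S)))\<rparr>,
         NComp = restrict (\<lambda>a. CComp (FCod (NSrc T)) (NComp T (FObj (NTrg S) a))
                                   (FArr (NSrc T) (NComp S a))) (CObj (FDom (NSrc S)))\<rparr>)\<rparr>"

definition terminal_category :: "('x, 'y) cat1 \<Rightarrow> bool" where
  "terminal_category X \<longleftrightarrow> category X \<and> (\<exists>a. CObj X = {a}) \<and> (\<exists>u. CArr X = {u})"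

definition equivalent_to_terminal :: "('x, 'y) cat1 \<Rightarrow> bool" where
  "equivalent_to_terminal X \<longleftrightarrow>
     (\<exists>Y F. terminal_category Y \<and> F \<in> hom Cat X Y \<and> equivalence Cat F)"


section \<open>The 2-functor Hom\<close>

definition hom_cat :: "('o, 'm, 'c) two_cat \<Rightarrow> 'o \<Rightarrow> 'o \<Rightarrow> ('m, 'c) cat1" where
  "hom_cat L A B = \<lparr>CObj = hom L A B, CArr = {x \<in> Cell L. Src L x \<in> hom L A B},
     CDom = Src L, CCod = Trg L, CId = Id2 L, CComp = VComp L\<rparr>"

text \<open>The functor \<open>f \<mapsto> b f a\<close> and the natural transformation \<open>f \<mapsto> \<beta> f \<alpha>\<close>, between
  prescribed subcategories \<open>X\<close>, \<open>Y\<close> of hom-categories of \<open>L\<close>.\<close>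

definition sandwich_fun :: "('o, 'm, 'c) two_cat \<Rightarrow> ('m, 'c) cat1 \<Rightarrow> ('m, 'c) cat1
    \<Rightarrow> 'm \<Rightarrow> 'm \<Rightarrow> ('m, 'c) fun1" where
  "sandwich_fun L X Y a b = \<lparr>FDom = X, FCod = Y,
     FObj = restrict (\<lambda>f. b \<odot>\<^bsub>L\<^esub> f \<odot>\<^bsub>L\<^esub> a) (CObj X),
     FArr = restrict (\<lambda>x. b \<rhd>\<^bsub>L\<^esub> (x \<lhd>\<^bsub>L\<^esub> a)) (CArr X)\<rparr>"

definition sandwich_nat :: "('o, 'm, 'c) two_cat \<Rightarrow> ('m, 'c) cat1 \<Rightarrow> ('m, 'c) cat1
    \<Rightarrow> 'c \<Rightarrow> 'c \<Rightarrow> ('m, 'c) nat1" where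
  "sandwich_nat L X Y \<alpha> \<beta> = \<lparr>NSrc = sandwich_fun L X Y (Src L \<alpha>) (Src L \<beta>),
     NTrg = sandwich_fun L X Y (Trg L \<alpha>) (Trg L \<beta>),
     NComp = restrict (\<lambda>f. \<beta> \<star>\<^bsub>L\<^esub> (Id2 L f \<star>\<^bsub>L\<^esub> \<alpha>)) (CObj X)\<rparr>"

text \<open>The 2-functor \<open>L\<^sup>o\<^sup>p \<times> L \<rightarrow> Cat\<close> acting by composition on a family \<open>H\<close> of subcategories of
  the hom-categories; for \<open>H = hom_cat L\<close> it is \<open>Hom\<close>.  Here \<open>a : A' \<rightarrow> A\<close> and
  \<open>b : B \<rightarrow> B'\<close> give \<open>H A B \<rightarrow> H A' B'\<close>.\<close>

definition sandwich_pfun :: "('o, 'm, 'c) two_cat \<Rightarrow> ('o \<Rightarrow> 'o \<Rightarrow> ('m, 'c) cat1)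
    \<Rightarrow> ('o \<times> 'o, 'm \<times> 'm, 'c \<times> 'c, ('m, 'c) cat1, ('m, 'c) fun1, ('m, 'c) nat1) pfun" where
  "sandwich_pfun L H = strict_pfun (prod2 (op2 L) L) Cat
     (\<lambda>(A, B). H A B)
     (\<lambda>(a, b). sandwich_fun L (H (Cod L a) (Dom L b)) (H (Dom L a) (Cod L b)) a b)
     (\<lambda>(\<alpha>, \<beta>). sandwich_nat L (H (Cod L (Src L \<alpha>)) (Dom L (Src L \<beta>)))
                             (H (Dom L (Src L \<alpha>)) (Cod L (Src L \<beta>))) \<alpha> \<beta>)"

definition hom_pfun :: "('o, 'm, 'c) two_cat
    \<Rightarrow> ('o \<times> 'o, 'm \<times> 'm, 'c \<times> 'c, ('m, 'c) cat1, ('m, 'c) fun1, ('m, 'c) nat1) pfun" where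
  "hom_pfun L = sandwich_pfun L (hom_cat L)"


section \<open>2-ideals\<close>

text \<open>A component \<open>N(A,B) \<rightarrow> Hom(A,B)\<close> that is injective on objects and faithful is injective on
  arrows, so taking the categories \<open>N(A,B)\<close> over the types of 1- and 2-cells is no restriction.\<close>

record ('o, 'm, 'c) ideal =
  IFun :: "('o \<times> 'o, 'm \<times> 'm, 'c \<times> 'c, ('m, 'c) cat1, ('m, 'c) fun1, ('m, 'c) nat1) pfun"
  INat :: "('o \<times> 'o, 'm \<times> 'm, ('m, 'c) fun1, ('m, 'c) nat1) ptrans"

definition two_ideal :: "('o, 'm, 'c) two_cat \<Rightarrow> ('o, 'm, 'c) ideal \<Rightarrow> bool" where
  "two_ideal L N \<longleftrightarrow>
     pseudofunctor (prod2 (op2 L) L) Cat (IFun N) \<and> normal (prod2 (op2 L) L) Cat (IFun N) \<and>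
     pseudonatural (prod2 (op2 L) L) Cat (IFun N) (hom_pfun L) (INat N) \<and>
     (\<forall>A \<in> Obj L. \<forall>B \<in> Obj L.
        inj_on (FObj (TComp (INat N) (A, B))) (CObj (PObj (IFun N) (A, B))) \<and>
        faithful (TComp (INat N) (A, B)))"

text \<open>The 2-ideal of the dual 2-category with \<open>N\<^sup>o\<^sup>p(A,B) = N(B,A)\<close>.\<close>

definition op_ideal :: "('o, 'm, 'c) ideal \<Rightarrow> ('o, 'm, 'c) ideal" where
  "op_ideal N = \<lparr>
     IFun = \<lparr>PObj = (\<lambda>(A, B). PObj (IFun N) (B, A)), PMor = (\<lambda>(a, b). PMor (IFun N) (b, a)),
             PCell = (\<lambda>(\<alpha>, \<beta>). PCell (IFun N) (\<beta>, \<alpha>)),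
             PComp = (\<lambda>(a', b') (a, b). PComp (IFun N) (b', a') (b, a)),
             PUnit = (\<lambda>(A, B). PUnit (IFun N) (B, A))\<rparr>,
     INat = \<lparr>TComp = (\<lambda>(A, B). TComp (INat N) (B, A)), TCell = (\<lambda>(a, b). TCell (INat N) (b, a))\<rparr>\<rparr>"

text \<open>\<open>N(A,B)\<close> is regarded as a subcategory of \<open>Hom(A,B)\<close> by taking its image under \<open>\<nu>\<close>;
  \<open>null_name\<close> is the object of \<open>N(A,B)\<close> that a null 1-cell is the image of.\<close>

definition null :: "('o, 'm, 'c) two_cat \<Rightarrow> ('o, 'm, 'c) ideal \<Rightarrow> 'm \<Rightarrow> bool" where
  "null L N f \<longleftrightarrow> f \<in> Mor L \<and>
     f \<in> FObj (TComp (INat N) (Dom L f, Cod L f)) ` CObj (PObj (IFun N) (Dom L f, Cod L f))"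

definition null_cell :: "('o, 'm, 'c) two_cat \<Rightarrow> ('o, 'm, 'c) ideal \<Rightarrow> 'c \<Rightarrow> bool" where
  "null_cell L N x \<longleftrightarrow> x \<in> Cell L \<and>
     x \<in> FArr (TComp (INat N) (Dom L (Src L x), Cod L (Src L x)))
           ` CArr (PObj (IFun N) (Dom L (Src L x), Cod L (Src L x)))"

definition null_iso :: "('o, 'm, 'c) two_cat \<Rightarrow> ('o, 'm, 'c) ideal \<Rightarrow> 'c \<Rightarrow> bool" where
  "null_iso L N x \<longleftrightarrow> null_cell L N x \<and> (\<exists>y. null_cell L N y \<and> inverse_cells L x y)"

definition null_name :: "('o, 'm, 'c) two_cat \<Rightarrow> ('o, 'm, 'c) ideal \<Rightarrow> 'm \<Rightarrow> 'm" where
  "null_name L N n = the_inv_into (CObj (PObj (IFun N) (Dom L n, Cod L n)))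
     (FObj (TComp (INat N) (Dom L n, Cod L n))) n"

text \<open>\<open>tilde L N b n a\<close> is the null 1-cell written \<open>bna\<close> with a tilde, and
  \<open>nu L N b n a : b \<odot> n \<odot> a \<Rightarrow> tilde L N b n a\<close>.\<close>

definition tilde :: "('o, 'm, 'c) two_cat \<Rightarrow> ('o, 'm, 'c) ideal \<Rightarrow> 'm \<Rightarrow> 'm \<Rightarrow> 'm \<Rightarrow> 'm" where
  "tilde L N b n a =
     FObj (TComp (INat N) (Dom L a, Cod L b)) (FObj (PMor (IFun N) (a, b)) (null_name L N n))"

definition nu :: "('o, 'm, 'c) two_cat \<Rightarrow> ('o, 'm, 'c) ideal \<Rightarrow> 'm \<Rightarrow> 'm \<Rightarrow> 'm \<Rightarrow> 'c" where
  "nu L N b n a = NComp (TCell (INat N) (a, b)) (null_name L N n)"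

abbreviation nu_left :: "('o, 'm, 'c) two_cat \<Rightarrow> ('o, 'm, 'c) ideal \<Rightarrow> 'm \<Rightarrow> 'm \<Rightarrow> 'c" where
  "nu_left L N b n \<equiv> nu L N b n (Id1 L (Dom L n))"

abbreviation nu_right :: "('o, 'm, 'c) two_cat \<Rightarrow> ('o, 'm, 'c) ideal \<Rightarrow> 'm \<Rightarrow> 'm \<Rightarrow> 'c" where
  "nu_right L N n a \<equiv> nu L N (Id1 L (Cod L n)) n a"


section \<open>2-kernels and 2-cokernels\<close>

definition is_kernel :: "('o, 'm, 'c) two_cat \<Rightarrow> ('o, 'm, 'c) ideal
    \<Rightarrow> 'm \<Rightarrow> 'm \<Rightarrow> 'm \<Rightarrow> 'c \<Rightarrow> bool" where
  "is_kernel L N f k n \<alpha> \<longleftrightarrow>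
     f \<in> Mor L \<and> k \<in> Mor L \<and> Cod L k = Dom L f \<and>
     null L N n \<and> \<alpha> \<in> iso_cells L (f \<odot>\<^bsub>L\<^esub> k) n \<and>
     (\<forall>z p \<beta>. z \<in> Mor L \<and> Cod L z = Dom L f \<and> null L N p \<and> \<beta> \<in> iso_cells L (f \<odot>\<^bsub>L\<^esub> z) p \<longrightarrow>
        (\<exists>u \<gamma>. u \<in> hom L (Dom L z) (Dom L k) \<and> \<gamma> \<in> iso_cells L z (k \<odot>\<^bsub>L\<^esub> u) \<and>
           null_iso L N (nu_right L N n u \<bullet>\<^bsub>L\<^esub> (\<alpha> \<lhd>\<^bsub>L\<^esub> u) \<bullet>\<^bsub>L\<^esub> (f \<rhd>\<^bsub>L\<^esub> \<gamma>) \<bullet>\<^bsub>L\<^esub> cinv L \<beta>))) \<and>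
     (\<forall>Z u v \<xi>. u \<in> hom L Z (Dom L k) \<and> v \<in> hom L Z (Dom L k) \<and>
        \<xi> \<in> cells L (k \<odot>\<^bsub>L\<^esub> u) (k \<odot>\<^bsub>L\<^esub> v) \<and>
        null_cell L N (nu_right L N n v \<bullet>\<^bsub>L\<^esub> (\<alpha> \<lhd>\<^bsub>L\<^esub> v) \<bullet>\<^bsub>L\<^esub> (f \<rhd>\<^bsub>L\<^esub> \<xi>)
          \<bullet>\<^bsub>L\<^esub> (cinv L \<alpha> \<lhd>\<^bsub>L\<^esub> u) \<bullet>\<^bsub>L\<^esub> cinv L (nu_right L N n u)) \<longrightarrow>
        (\<exists>!\<mu>. \<mu> \<in> cells L u v \<and> k \<rhd>\<^bsub>L\<^esub> \<mu> = \<xi>))"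

text \<open>Unfolded, the structure 2-cell of a cokernel is \<open>\<beta> : e \<odot> g \<Rightarrow> n\<close> in \<open>L\<close>.\<close>

definition is_cokernel :: "('o, 'm, 'c) two_cat \<Rightarrow> ('o, 'm, 'c) ideal
    \<Rightarrow> 'm \<Rightarrow> 'm \<Rightarrow> 'm \<Rightarrow> 'c \<Rightarrow> bool" where
  "is_cokernel L N g e n \<beta> \<longleftrightarrow> is_kernel (op2 L) (op_ideal N) g e n \<beta>"

definition kernels :: "('o, 'm, 'c) two_cat \<Rightarrow> ('o, 'm, 'c) ideal \<Rightarrow> 'm set" where
  "kernels L N = {k. \<exists>f n \<alpha>. is_kernel L N f k n \<alpha>}"

definition cokernels :: "('o, 'm, 'c) two_cat \<Rightarrow> ('o, 'm, 'c) ideal \<Rightarrow> 'm set" where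
  "cokernels L N = {e. \<exists>g n \<beta>. is_cokernel L N g e n \<beta>}"

definition has_kernels :: "('o, 'm, 'c) two_cat \<Rightarrow> ('o, 'm, 'c) ideal \<Rightarrow> bool" where
  "has_kernels L N \<longleftrightarrow> (\<forall>f \<in> Mor L. \<exists>k n \<alpha>. is_kernel L N f k n \<alpha>)"

definition has_cokernels :: "('o, 'm, 'c) two_cat \<Rightarrow> ('o, 'm, 'c) ideal \<Rightarrow> bool" where
  "has_cokernels L N \<longleftrightarrow> (\<forall>g \<in> Mor L. \<exists>e n \<beta>. is_cokernel L N g e n \<beta>)"


section \<open>Weakly closed 2-ideals\<close>

definition weakly_reflects_null :: "('o, 'm, 'c) two_cat \<Rightarrow> ('o, 'm, 'c) ideal
    \<Rightarrow> 'm \<Rightarrow> 'm \<Rightarrow> 'm \<Rightarrow> 'c \<Rightarrow> bool" where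
  "weakly_reflects_null L N f k n\<^sub>0 \<alpha> \<longleftrightarrow>
     (\<forall>D s n \<delta>. s \<in> hom L D (Dom L k) \<and> null L N n \<and> n \<in> hom L D (Cod L k) \<and>
        \<delta> \<in> iso_cells L (k \<odot>\<^bsub>L\<^esub> s) n \<and>
        null_iso L N (nu_right L N n\<^sub>0 s \<bullet>\<^bsub>L\<^esub> (\<alpha> \<lhd>\<^bsub>L\<^esub> s) \<bullet>\<^bsub>L\<^esub> (f \<rhd>\<^bsub>L\<^esub> cinv L \<delta>)
          \<bullet>\<^bsub>L\<^esub> cinv L (nu_left L N f n)) \<longrightarrow>
        (\<exists>s' \<psi>. null L N s' \<and> s' \<in> hom L D (Dom L k) \<and> \<psi> \<in> iso_cells L s s' \<and>
           null_iso L N (nu_left L N k s' \<bullet>\<^bsub>L\<^esub> (k \<rhd>\<^bsub>L\<^esub> \<psi>) \<bullet>\<^bsub>L\<^esub> cinv L \<delta>)))"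

definition reflects_null_cells :: "('o, 'm, 'c) two_cat \<Rightarrow> ('o, 'm, 'c) ideal \<Rightarrow> 'm \<Rightarrow> bool" where
  "reflects_null_cells L N k \<longleftrightarrow>
     (\<forall>D s s' \<mu>. null L N s \<and> s \<in> hom L D (Dom L k) \<and> null L N s' \<and> s' \<in> hom L D (Dom L k) \<and>
        \<mu> \<in> cells L s s' \<and>
        null_cell L N (nu_left L N k s' \<bullet>\<^bsub>L\<^esub> (k \<rhd>\<^bsub>L\<^esub> \<mu>) \<bullet>\<^bsub>L\<^esub> cinv L (nu_left L N k s)) \<longrightarrow>
        null_cell L N \<mu>)"

definition kernels_reflect :: "('o, 'm, 'c) two_cat \<Rightarrow> ('o, 'm, 'c) ideal \<Rightarrow> bool" where
  "kernels_reflect L N \<longleftrightarrow> (\<forall>f k n \<alpha>. is_kernel L N f k n \<alpha> \<longrightarrow>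
     weakly_reflects_null L N f k n \<alpha> \<and> reflects_null_cells L N k)"

definition weakly_closed :: "('o, 'm, 'c) two_cat \<Rightarrow> ('o, 'm, 'c) ideal \<Rightarrow> bool" where
  "weakly_closed L N \<longleftrightarrow> kernels_reflect L N \<and> kernels_reflect (op2 L) (op_ideal N)"


section \<open>Weak exactness\<close>

definition kernels_normal :: "('o, 'm, 'c) two_cat \<Rightarrow> ('o, 'm, 'c) ideal \<Rightarrow> bool" where
  "kernels_normal L N \<longleftrightarrow> (\<forall>m \<in> kernels L N. \<forall>c n \<beta>. is_cokernel L N m c n \<beta> \<longrightarrow>
     (\<exists>n' \<theta>. null_iso L N \<theta> \<and> \<theta> \<in> cells L n n' \<and> is_kernel L N c m n' (\<theta> \<bullet>\<^bsub>L\<^esub> \<beta>)))"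

definition weakly_Grandis_2_exact :: "('o, 'm, 'c) two_cat \<Rightarrow> ('o, 'm, 'c) ideal \<Rightarrow> bool" where
  "weakly_Grandis_2_exact L N \<longleftrightarrow>
     two_category L \<and> two_ideal L N \<and>
     has_kernels L N \<and> has_cokernels L N \<and> weakly_closed L N \<and>
     kernels_normal L N \<and> kernels_normal (op2 L) (op_ideal N) \<and>
     (\<forall>f \<in> Mor L. \<exists>e m. e \<in> cokernels L N \<and> m \<in> kernels L N \<and> Dom L m = Cod L e \<and>
        iso_cells L f (m \<odot>\<^bsub>L\<^esub> e) \<noteq> {})"

definition bizero :: "('o, 'm, 'c) two_cat \<Rightarrow> 'o \<Rightarrow> bool" where
  "bizero L Z \<longleftrightarrow> Z \<in> Obj L \<and>
     (\<forall>A \<in> Obj L. equivalent_to_terminal (hom_cat L A Z) \<and> equivalent_to_terminal (hom_cat L Z A))"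

text \<open>The 2-ideal (0).  For a bizero object \<open>Z\<close>, 2-cells \<open>\<tau> : t \<Rightarrow> t'\<close> and \<open>\<kappa> : i \<Rightarrow> i'\<close> below
  are unique, and their pasting \<open>it \<Rightarrow> i't'\<close> is the horizontal composite.\<close>

definition zero_cat :: "('o, 'm, 'c) two_cat \<Rightarrow> 'o \<Rightarrow> 'o \<Rightarrow> 'o \<Rightarrow> ('m, 'c) cat1" where
  "zero_cat L Z A B = (hom_cat L A B)
     \<lparr>CObj := {i \<odot>\<^bsub>L\<^esub> t | i t. t \<in> hom L A Z \<and> i \<in> hom L Z B},
      CArr := {\<kappa> \<star>\<^bsub>L\<^esub> \<tau> | \<kappa> \<tau> i i' t t'. t \<in> hom L A Z \<and> t' \<in> hom L A Z \<and> i \<in> hom L Z B \<and>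
                 i' \<in> hom L Z B \<and> \<tau> \<in> cells L t t' \<and> \<kappa> \<in> cells L i i'}\<rparr>"

definition zero_inclusion :: "('o, 'm, 'c) two_cat \<Rightarrow> 'o \<Rightarrow> 'o \<Rightarrow> 'o \<Rightarrow> ('m, 'c) fun1" where
  "zero_inclusion L Z A B = \<lparr>FDom = zero_cat L Z A B, FCod = hom_cat L A B,
     FObj = restrict (\<lambda>f. f) (CObj (zero_cat L Z A B)),
     FArr = restrict (\<lambda>x. x) (CArr (zero_cat L Z A B))\<rparr>"

definition zero_ideal :: "('o, 'm, 'c) two_cat \<Rightarrow> 'o \<Rightarrow> ('o, 'm, 'c) ideal" where
  "zero_ideal L Z = \<lparr>IFun = sandwich_pfun L (zero_cat L Z),
     INat = \<lparr>TComp = (\<lambda>(A, B). zero_inclusion L Z A B),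
             TCell = (\<lambda>(a, b). Id2 Cat (PMor (hom_pfun L) (a, b)
                                        \<odot>\<^bsub>Cat\<^esub> zero_inclusion L Z (Cod L a) (Dom L b)))\<rparr>\<rparr>"

text \<open>That (0) is a 2-ideal, i.e. that pastings are closed under vertical composition, is one of the
  conditions in \<open>weakly_Grandis_2_exact\<close>: when a null 1-cell factors through \<open>Z\<close> in several
  ways, bizero alone does not imply it.\<close>

definition weakly_Puppe_2_exact :: "('o, 'm, 'c) two_cat \<Rightarrow> 'o \<Rightarrow> bool" where
  "weakly_Puppe_2_exact L Z \<longleftrightarrow> bizero L Z \<and> weakly_Grandis_2_exact L (zero_ideal L Z)"


section \<open>Relatively orthogonal cokernel-kernel factorization systems\<close>

text \<open>\<open>fills L e m s t \<phi> d \<sigma> \<rho>\<close>: the square \<open>\<phi> : m s \<Rightarrow> t e\<close> is filled by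
  \<open>d\<close>, \<open>\<sigma> : s \<Rightarrow> d e\<close>, \<open>\<rho> : m d \<Rightarrow> t\<close>.\<close>

definition is_square :: "('o, 'm, 'c) two_cat \<Rightarrow> 'm \<Rightarrow> 'm \<Rightarrow> 'm \<Rightarrow> 'm \<Rightarrow> 'c \<Rightarrow> bool" where
  "is_square L e m s t \<phi> \<longleftrightarrow> e \<in> Mor L \<and> m \<in> Mor L \<and>
     s \<in> hom L (Dom L e) (Dom L m) \<and> t \<in> hom L (Cod L e) (Cod L m) \<and>
     \<phi> \<in> iso_cells L (m \<odot>\<^bsub>L\<^esub> s) (t \<odot>\<^bsub>L\<^esub> e)"

definition fills :: "('o, 'm, 'c) two_cat \<Rightarrow> 'm \<Rightarrow> 'm \<Rightarrow> 'm \<Rightarrow> 'm \<Rightarrow> 'c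
    \<Rightarrow> 'm \<Rightarrow> 'c \<Rightarrow> 'c \<Rightarrow> bool" where
  "fills L e m s t \<phi> d \<sigma> \<rho> \<longleftrightarrow> d \<in> hom L (Cod L e) (Dom L m) \<and>
     \<sigma> \<in> iso_cells L s (d \<odot>\<^bsub>L\<^esub> e) \<and> \<rho> \<in> iso_cells L (m \<odot>\<^bsub>L\<^esub> d) t \<and>
     \<phi> = (\<rho> \<lhd>\<^bsub>L\<^esub> e) \<bullet>\<^bsub>L\<^esub> (m \<rhd>\<^bsub>L\<^esub> \<sigma>)"

definition rel_orthogonal_ck_fs :: "('o, 'm, 'c) two_cat \<Rightarrow> ('o, 'm, 'c) ideal
    \<Rightarrow> 'm set \<Rightarrow> 'm set \<Rightarrow> bool" where
  "rel_orthogonal_ck_fs L N \<E> \<M> \<longleftrightarrow>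
     \<E> \<subseteq> cokernels L N \<and> \<M> \<subseteq> kernels L N \<and>
     (\<forall>f \<in> Mor L. \<exists>e \<in> \<E>. \<exists>m \<in> \<M>. Dom L m = Cod L e \<and> iso_cells L f (m \<odot>\<^bsub>L\<^esub> e) \<noteq> {}) \<and>
     (\<forall>m \<in> \<M>. \<forall>i. equivalence L i \<and> Cod L i = Dom L m \<longrightarrow> m \<odot>\<^bsub>L\<^esub> i \<in> \<M>) \<and>
     (\<forall>e \<in> \<E>. \<forall>i. equivalence L i \<and> Dom L i = Cod L e \<longrightarrow> i \<odot>\<^bsub>L\<^esub> e \<in> \<E>) \<and>
     (\<forall>m \<in> \<M>. \<forall>f. iso_cells L m f \<noteq> {} \<longrightarrow> f \<in> \<M>) \<and>
     (\<forall>e \<in> \<E>. \<forall>f. iso_cells L e f \<noteq> {} \<longrightarrow> f \<in> \<E>) \<and>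
     (\<forall>e \<in> \<E>. \<forall>m \<in> \<M>. \<forall>s t \<phi> f n\<^sub>m \<alpha> g n\<^sub>e \<beta>.
        is_square L e m s t \<phi> \<and> is_kernel L N f m n\<^sub>m \<alpha> \<and> is_cokernel L N g e n\<^sub>e \<beta> \<and>
        null_iso L N (nu_left L N (f \<odot>\<^bsub>L\<^esub> t) n\<^sub>e
          \<bullet>\<^bsub>L\<^esub> ((f \<odot>\<^bsub>L\<^esub> t) \<rhd>\<^bsub>L\<^esub> \<beta>)
          \<bullet>\<^bsub>L\<^esub> (f \<rhd>\<^bsub>L\<^esub> (\<phi> \<lhd>\<^bsub>L\<^esub> g))
          \<bullet>\<^bsub>L\<^esub> (cinv L \<alpha> \<lhd>\<^bsub>L\<^esub> (s \<odot>\<^bsub>L\<^esub> g))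
          \<bullet>\<^bsub>L\<^esub> cinv L (nu_right L N n\<^sub>m (s \<odot>\<^bsub>L\<^esub> g))) \<longrightarrow>
        (\<exists>d \<sigma> \<rho>. fills L e m s t \<phi> d \<sigma> \<rho>)) \<and>
     (\<forall>e \<in> \<E>. \<forall>m \<in> \<M>. \<forall>s t \<phi> d \<sigma> \<rho> s' t' \<phi>' d' \<sigma>' \<rho>' \<xi> \<mu>.
        is_square L e m s t \<phi> \<and> fills L e m s t \<phi> d \<sigma> \<rho> \<and>
        is_square L e m s' t' \<phi>' \<and> fills L e m s' t' \<phi>' d' \<sigma>' \<rho>' \<and>
        \<xi> \<in> cells L s s' \<and> \<mu> \<in> cells L t t' \<and>
        \<phi>' \<bullet>\<^bsub>L\<^esub> (m \<rhd>\<^bsub>L\<^esub> \<xi>) = (\<mu> \<lhd>\<^bsub>L\<^esub> e) \<bullet>\<^bsub>L\<^esub> \<phi> \<longrightarrow>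
        (\<exists>!\<iota>. \<iota> \<in> cells L d d' \<and>
           \<rho>' \<bullet>\<^bsub>L\<^esub> (m \<rhd>\<^bsub>L\<^esub> \<iota>) = \<mu> \<bullet>\<^bsub>L\<^esub> \<rho> \<and>
           (\<iota> \<lhd>\<^bsub>L\<^esub> e) \<bullet>\<^bsub>L\<^esub> \<sigma> = \<sigma>' \<bullet>\<^bsub>L\<^esub> \<xi>))"


section \<open>The pseudo arrow 2-category\<close>

text \<open>A square from \<open>f\<close> to \<open>g\<close> has a side \<open>u\<close> between the domains, a side \<open>v\<close> between the
  codomains, and an invertible filling \<open>g u \<Rightarrow> v f\<close>.\<close>

datatype ('m, 'c) square =
  Square (sq_dom: 'm) (sq_cod: 'm) (sq_top: 'm) (sq_bot: 'm) (sq_fill: 'c)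

datatype ('m, 'c) square_cell =
  SquareCell (sc_src: "('m, 'c) square") (sc_trg: "('m, 'c) square") (sc_top: 'c) (sc_bot: 'c)

definition square_comp :: "('o, 'm, 'c) two_cat \<Rightarrow> ('m, 'c) square \<Rightarrow> ('m, 'c) square
    \<Rightarrow> ('m, 'c) square" where
  "square_comp L q p = Square (sq_dom p) (sq_cod q)
     (sq_top q \<odot>\<^bsub>L\<^esub> sq_top p) (sq_bot q \<odot>\<^bsub>L\<^esub> sq_bot p)
     ((sq_bot q \<rhd>\<^bsub>L\<^esub> sq_fill p) \<bullet>\<^bsub>L\<^esub> (sq_fill q \<lhd>\<^bsub>L\<^esub> sq_top p))"

definition pseudo_arrow :: "('o, 'm, 'c) two_cat
    \<Rightarrow> ('m, ('m, 'c) square, ('m, 'c) square_cell) two_cat" where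
  "pseudo_arrow L =
     (let Sq = {q. is_square L (sq_dom q) (sq_cod q) (sq_top q) (sq_bot q) (sq_fill q)} in
     \<lparr>Obj = Mor L, Mor = Sq,
      Cell = {x. sc_src x \<in> Sq \<and> sc_trg x \<in> Sq \<and>
         sq_dom (sc_trg x) = sq_dom (sc_src x) \<and> sq_cod (sc_trg x) = sq_cod (sc_src x) \<and>
         sc_top x \<in> cells L (sq_top (sc_src x)) (sq_top (sc_trg x)) \<and>
         sc_bot x \<in> cells L (sq_bot (sc_src x)) (sq_bot (sc_trg x)) \<and>
         sq_fill (sc_trg x) \<bullet>\<^bsub>L\<^esub> (sq_cod (sc_src x) \<rhd>\<^bsub>L\<^esub> sc_top x)
           = (sc_bot x \<lhd>\<^bsub>L\<^esub> sq_dom (sc_src x)) \<bullet>\<^bsub>L\<^esub> sq_fill (sc_src x)},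
      Dom = sq_dom, Cod = sq_cod, Src = sc_src, Trg = sc_trg,
      Id1 = (\<lambda>f. Square f f (Id1 L (Dom L f)) (Id1 L (Cod L f)) (Id2 L f)),
      Comp = square_comp L,
      Id2 = (\<lambda>q. SquareCell q q (Id2 L (sq_top q)) (Id2 L (sq_bot q))),
      VComp = (\<lambda>y x. SquareCell (sc_src x) (sc_trg y)
         (sc_top y \<bullet>\<^bsub>L\<^esub> sc_top x) (sc_bot y \<bullet>\<^bsub>L\<^esub> sc_bot x)),
      HComp = (\<lambda>y x. SquareCell (square_comp L (sc_src y) (sc_src x))
         (square_comp L (sc_trg y) (sc_trg x))
         (sc_top y \<star>\<^bsub>L\<^esub> sc_top x) (sc_bot y \<star>\<^bsub>L\<^esub> sc_bot x))\<rparr>)"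

definition arrows_in :: "('o, 'm, 'c) two_cat \<Rightarrow> 'm set
    \<Rightarrow> ('m, ('m, 'c) square, ('m, 'c) square_cell) two_cat" where
  "arrows_in L S = full_sub (pseudo_arrow L) S"

definition dom_pfun :: "('o, 'm, 'c) two_cat \<Rightarrow> 'm set
    \<Rightarrow> ('m, ('m, 'c) square, ('m, 'c) square_cell, 'o, 'm, 'c) pfun" where
  "dom_pfun L S = strict_pfun (arrows_in L S) L (Dom L) sq_top sc_top"

definition cod_pfun :: "('o, 'm, 'c) two_cat \<Rightarrow> 'm set
    \<Rightarrow> ('m, ('m, 'c) square, ('m, 'c) square_cell, 'o, 'm, 'c) pfun" where
  "cod_pfun L S = strict_pfun (arrows_in L S) L (Cod L) sq_bot sc_bot"

definition normal_biequivalence_dom_cod :: "('o, 'm, 'c) two_cat \<Rightarrow> 'm set \<Rightarrow> 'm set \<Rightarrow> bool" where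
  "normal_biequivalence_dom_cod L \<E> \<M> \<longleftrightarrow>
     (\<exists>K C. normal (arrows_in L \<E>) (arrows_in L \<M>) K \<and> normal (arrows_in L \<M>) (arrows_in L \<E>) C \<and>
        biequivalence_over L (arrows_in L \<E>) (dom_pfun L \<E>) (arrows_in L \<M>) (cod_pfun L \<M>) K C)"

end

theory Submission
  imports Defs
begin

text \<open>
  Let \<open>m\<close> be a 2-kernel of \<open>f\<close> and \<open>e\<close> a 2-cokernel of \<open>g\<close>.  A square \<open>\<phi> : m s \<Rightarrow> t e\<close> carries the null
  structure of \<open>f m s\<close> over to \<open>f t e\<close>.  The condition on the square says that this is compatible with the null
  structure of \<open>e g\<close>, so \<open>f t\<close> is itself isomorphic to a null morphism because \<open>e\<close> weakly coreflects null
  morphisms, and \<open>t\<close> factors through \<open>m\<close>.  Fillers of 2-cells exist and are unique because \<open>e\<close> coreflects null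
  2-cells and \<open>m\<close> is faithful on 2-cells.

  For the biequivalence, normality puts every 2-cokernel \<open>e\<close> and every 2-kernel \<open>m\<close> into a triple \<open>(e, m, p)\<close>
  whose \<open>p : e m \<Rightarrow> n\<close> exhibits \<open>m\<close> as a 2-kernel of \<open>e\<close> and \<open>e\<close> as a 2-cokernel of \<open>m\<close>.  Given two such triples,
  a square \<open>\<phi> : e' u \<Rightarrow> v e\<close> and a square \<open>\<psi> : m' w \<Rightarrow> u m\<close> are matched if they induce the same null structure on
  \<open>e' u m\<close>.  By the universal properties every square has a matched partner, and a 2-cell between squares induces
  one between their partners.  Since \<open>dom\<close> on cokernels and \<open>cod\<close> on kernels are faithful on 2-cells, all
  coherence conditions may be checked in \<open>L\<close>, where every structure 2-cell is an identity.
\<close>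

section \<open>Calculus in strict 2-categories\<close>

text \<open>A whiskered null 1-cell is null only up to the invertible \<nu>, and N is only a
  pseudofunctor, so null structures obtained by different bracketings do not agree on the nose. The
  remedy is to compare 2-cells relative to presentations (\<open>rnull\<close>,
  \<open>riso\<close>): these relations compose and are preserved by whiskering, and a change of
  bracketing becomes an identity 2-cell that is \<open>riso\<close> between two presentations. The
  arguments are then chains of \<open>riso_VComp\<close>. Only a list of properties symmetric under
  reversal of 1-cells is extracted from the 2-ideal, so kernels and cokernels share proofs.

  The second obstacle is choice: partner squares exist but are not canonical. So K and C are chosen
  from one relation read in both directions, and their constraints are the unique 2-cells lying over
  identities. The relation needs one structure 2-cell p common to kernel and cokernel; exactness
  gives it only up to an invertible null 2-cell, which \<open>kernel_transport\<close> absorbs.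
  Identities are matched because N is normal. The Puppe case is the instance N = (0).\<close>

definition invertible_cell :: "('o, 'm, 'c) two_cat \<Rightarrow> 'c \<Rightarrow> bool" where
  "invertible_cell L x \<longleftrightarrow> (\<exists>y. inverse_cells L x y)"

context two_category
begin

abbreviation invertible :: "'c \<Rightarrow> bool" where
  "invertible \<equiv> invertible_cell L"

lemma invertibleI: "inverse_cells L x y \<Longrightarrow> invertible x"
  by (auto simp: invertible_cell_def)

text \<open>The axioms speak of hom-sets whose objects need not occur in the conclusion. In terms of
  \<open>Dom\<close> and \<open>Cod\<close> they become conditional rewrite rules, and typing
  conditions are discharged by simplification.\<close>

lemma Comp_simps [simp]:
  assumes "f \<in> Mor L" "g \<in> Mor L" "Dom L g = Cod L f"
  shows "g \<odot> f \<in> Mor L" "Dom L (g \<odot> f) = Dom L f" "Cod L (g \<odot> f) = Cod L g"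
  using Comp_hom[of f "Dom L f" "Cod L f" g "Cod L g"] assms by (auto simp: hom_def)

lemma Comp_assoc' [simp]:
  assumes "f \<in> Mor L" "g \<in> Mor L" "h \<in> Mor L" "Dom L g = Cod L f" "Dom L h = Cod L g"
  shows "(h \<odot> g) \<odot> f = h \<odot> (g \<odot> f)"
  using Comp_assoc[of f "Dom L f" "Cod L f" g "Cod L g" h "Cod L h"] assms by (auto simp: hom_def)

lemma Id1_simps [simp]:
  assumes "A \<in> Obj L"
  shows "Id1 L A \<in> Mor L" "Dom L (Id1 L A) = A" "Cod L (Id1 L A) = A"
  using Id1_hom[OF assms] by (auto simp: hom_def)

lemma Obj_simps [simp]:
  "f \<in> Mor L \<Longrightarrow> Dom L f \<in> Obj L" "f \<in> Mor L \<Longrightarrow> Cod L f \<in> Obj L"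
  by (auto simp: Dom_Obj Cod_Obj)

lemma Comp_Id1 [simp]:
  "f \<in> Mor L \<Longrightarrow> Dom L f = A \<Longrightarrow> f \<odot> Id1 L A = f"
  "f \<in> Mor L \<Longrightarrow> Cod L f = A \<Longrightarrow> Id1 L A \<odot> f = f"
  using Comp_Id1_right[of f A "Cod L f"] Comp_Id1_left[of f "Dom L f" A] by (auto simp: hom_def)

lemma Cell_simps [simp]:
  assumes "x \<in> Cell L"
  shows "Src L x \<in> Mor L" "Trg L x \<in> Mor L"
    "Dom L (Trg L x) = Dom L (Src L x)" "Cod L (Trg L x) = Cod L (Src L x)"
  using assms by (auto simp: Src_Mor Trg_Mor Dom_Trg Cod_Trg)

lemma Dom_Cod_of_cell:
  assumes "x \<in> Cell L" "Src L x = f" "Trg L x = g"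
  shows "Dom L g = Dom L f" "Cod L g = Cod L f" "f \<in> Mor L" "g \<in> Mor L"
  using assms Cell_simps[of x] by auto

lemma Id2_simps [simp]:
  assumes "f \<in> Mor L"
  shows "Id2 L f \<in> Cell L" "Src L (Id2 L f) = f" "Trg L (Id2 L f) = f"
  using Id2_cells[OF assms] by (auto simp: cells_def)

lemma VComp_simps [simp]:
  assumes "x \<in> Cell L" "y \<in> Cell L" "Src L y = Trg L x"
  shows "y \<bullet> x \<in> Cell L" "Src L (y \<bullet> x) = Src L x" "Trg L (y \<bullet> x) = Trg L y"
  using VComp_cells[of x "Src L x" "Trg L x" y "Trg L y"] assms by (auto simp: cells_def)

lemma VComp_assoc' [simp]:
  assumes "x \<in> Cell L" "y \<in> Cell L" "z \<in> Cell L" "Src L y = Trg L x" "Src L z = Trg L y"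
  shows "(z \<bullet> y) \<bullet> x = z \<bullet> (y \<bullet> x)"
  using VComp_assoc[of x "Src L x" "Trg L x" y "Trg L y" z "Trg L z"] assms by (auto simp: cells_def)

lemma VComp_Id2 [simp]:
  "x \<in> Cell L \<Longrightarrow> Src L x = f \<Longrightarrow> x \<bullet> Id2 L f = x"
  "x \<in> Cell L \<Longrightarrow> Trg L x = f \<Longrightarrow> Id2 L f \<bullet> x = x"
  using VComp_Id2_right[of x f "Trg L x"] VComp_Id2_left[of x "Src L x" f] by (auto simp: cells_def)

lemma HComp_simps [simp]:
  assumes "x \<in> Cell L" "y \<in> Cell L" "Dom L (Src L y) = Cod L (Src L x)"
  shows "y \<star> x \<in> Cell L" "Src L (y \<star> x) = Src L y \<odot> Src L x" "Trg L (y \<star> x) = Trg L y \<odot> Trg L x"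
  using HComp_cells[of x "Src L x" "Trg L x" y "Src L y" "Trg L y" "Dom L (Src L x)"
      "Cod L (Src L x)" "Cod L (Src L y)"] assms
  by (auto simp: cells_def hom_def)

lemma HComp_assoc' [simp]:
  assumes "x \<in> Cell L" "y \<in> Cell L" "z \<in> Cell L"
    "Dom L (Src L y) = Cod L (Src L x)" "Dom L (Src L z) = Cod L (Src L y)"
  shows "(z \<star> y) \<star> x = z \<star> (y \<star> x)"
  using HComp_assoc[of x y z] assms by (auto simp: hom_def)

lemma HComp_Id1 [simp]:
  "x \<in> Cell L \<Longrightarrow> Dom L (Src L x) = A \<Longrightarrow> x \<star> Id2 L (Id1 L A) = x"
  "x \<in> Cell L \<Longrightarrow> Cod L (Src L x) = A \<Longrightarrow> Id2 L (Id1 L A) \<star> x = x"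
  using HComp_Id1_right[of x A "Cod L (Src L x)"] HComp_Id1_left[of x "Dom L (Src L x)" A]
  by (auto simp: hom_def)

lemma HComp_Id2' [simp]:
  assumes "f \<in> Mor L" "g \<in> Mor L" "Dom L g = Cod L f"
  shows "Id2 L g \<star> Id2 L f = Id2 L (g \<odot> f)"
  using HComp_Id2[of f "Dom L f" "Cod L f" g "Cod L g"] assms by (auto simp: hom_def)

text \<open>Together with \<open>HComp_assoc'\<close> and \<open>HComp_Id2'\<close> this gives
  whiskered 2-cells the normal form \<open>b \<rhd> (x \<lhd> a)\<close>, with iterated whiskerings
  collected into one composite on each side.\<close>

lemma HComp_Id2_assoc [simp]:
  assumes "f \<in> Mor L" "g \<in> Mor L" "x \<in> Cell L" "Dom L g = Cod L f" "Cod L (Src L x) = Dom L f"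
  shows "Id2 L g \<star> Id2 L f \<star> x = Id2 L (g \<odot> f) \<star> x"
  using HComp_assoc'[of x "Id2 L f" "Id2 L g"] assms by simp

lemma interchange':
  assumes "x \<in> Cell L" "x' \<in> Cell L" "y \<in> Cell L" "y' \<in> Cell L"
    "Src L x' = Trg L x" "Src L y' = Trg L y" "Dom L (Src L y) = Cod L (Src L x)"
  shows "(y' \<bullet> y) \<star> (x' \<bullet> x) = (y' \<star> x') \<bullet> (y \<star> x)"
  using interchange[of x "Src L x" "Trg L x" x' "Trg L x'" y "Src L y" "Trg L y" y' "Trg L y'"
      "Dom L (Src L x)" "Cod L (Src L x)" "Cod L (Src L y)"] assms
  by (auto simp: cells_def hom_def)

lemma whisker_VComp [simp]:
  assumes "x \<in> Cell L" "y \<in> Cell L" "Src L y = Trg L x" "f \<in> Mor L"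
  shows "Dom L f = Cod L (Src L x) \<Longrightarrow> f \<rhd> (y \<bullet> x) = (f \<rhd> y) \<bullet> (f \<rhd> x)"
    "Dom L (Src L x) = Cod L f \<Longrightarrow> (y \<bullet> x) \<lhd> f = (y \<lhd> f) \<bullet> (x \<lhd> f)"
  using interchange'[of x y "Id2 L f" "Id2 L f"] interchange'[of "Id2 L f" "Id2 L f" x y] assms
  by auto

lemma HComp_as_VComp:
  assumes "x \<in> Cell L" "y \<in> Cell L" "Dom L (Src L y) = Cod L (Src L x)"
  shows "y \<star> x = (Trg L y \<rhd> x) \<bullet> (y \<lhd> Src L x)" "y \<star> x = (y \<lhd> Trg L x) \<bullet> (Src L y \<rhd> x)"
  using interchange'[of "Id2 L (Src L x)" x y "Id2 L (Trg L y)"]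
    interchange'[of x "Id2 L (Trg L x)" "Id2 L (Src L y)" y] assms by simp_all

lemma whisker_exchange:
  assumes "x \<in> Cell L" "y \<in> Cell L" "Src L x = f" "Trg L x = f'" "Src L y = g" "Trg L y = g'"
    "Dom L g = Cod L f"
  shows "(y \<lhd> f') \<bullet> (g \<rhd> x) = (g' \<rhd> x) \<bullet> (y \<lhd> f)"
  using HComp_as_VComp[of x y] assms by simp

text \<open>Vertical composites are kept bracketed to the right, so an exchange in the middle of a
  chain has to carry its tail z along.\<close>

lemma whisker_exchange_assoc:
  assumes "x \<in> Cell L" "y \<in> Cell L" "Src L x = f" "Trg L x = f'" "Src L y = g" "Trg L y = g'"
    "Dom L g = Cod L f" "z \<in> Cell L" "Trg L z = g \<odot> f"
  shows "(y \<lhd> f') \<bullet> (g \<rhd> x) \<bullet> z = (g' \<rhd> x) \<bullet> (y \<lhd> f) \<bullet> z"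
proof -
  have d: "Dom L g = Dom L g'" "Cod L f = Cod L f'" "f \<in> Mor L" "f' \<in> Mor L" "g \<in> Mor L" "g' \<in> Mor L"
    using assms Cell_simps[of x] Cell_simps[of y] by auto
  have "((y \<lhd> f') \<bullet> (g \<rhd> x)) \<bullet> z = ((g' \<rhd> x) \<bullet> (y \<lhd> f)) \<bullet> z"
    using whisker_exchange[OF assms(1-7)] by simp
  then show ?thesis using assms d by simp
qed

section \<open>Inverses of 2-cells\<close>

lemma inverse_cells_unique:
  assumes "inverse_cells L x y" "inverse_cells L x z"
  shows "y = z"
proof -
  have *: "y \<in> Cell L" "z \<in> Cell L" "x \<in> Cell L" "Src L y = Trg L x" "Src L z = Trg L x"
    "Trg L y = Src L x" "Trg L z = Src L x" "y \<bullet> x = Id2 L (Src L x)" "x \<bullet> z = Id2 L (Trg L x)"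
    using assms by (auto simp: inverse_cells_def cells_def)
  then show ?thesis using VComp_assoc'[of z x y] by simp
qed

lemma cinv_eq: "inverse_cells L x y \<Longrightarrow> cinv L x = y"
  unfolding cinv_def by (rule the_equality) (auto intro: inverse_cells_unique)

lemma inverse_cells_sym: "inverse_cells L x y \<Longrightarrow> inverse_cells L y x"
  by (auto simp: inverse_cells_def cells_def)

lemma inverse_cells_cinv: "invertible x \<Longrightarrow> inverse_cells L x (cinv L x)"
  using cinv_eq by (auto simp: invertible_cell_def)

lemma invertible_simps [simp]:
  assumes "invertible x"
  shows "x \<in> Cell L" "cinv L x \<in> Cell L" "Src L (cinv L x) = Trg L x" "Trg L (cinv L x) = Src L x"
    "cinv L x \<bullet> x = Id2 L (Src L x)" "x \<bullet> cinv L x = Id2 L (Trg L x)"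
    "invertible (cinv L x)" "cinv L (cinv L x) = x"
proof -
  have i: "inverse_cells L x (cinv L x)" by (rule inverse_cells_cinv[OF assms])
  show "x \<in> Cell L" "cinv L x \<in> Cell L" "Src L (cinv L x) = Trg L x" "Trg L (cinv L x) = Src L x"
    "cinv L x \<bullet> x = Id2 L (Src L x)" "x \<bullet> cinv L x = Id2 L (Trg L x)"
    using i by (auto simp: inverse_cells_def cells_def)
  show "invertible (cinv L x)" "cinv L (cinv L x) = x"
    using invertibleI[OF inverse_cells_sym[OF i]] cinv_eq[OF inverse_cells_sym[OF i]] by simp_all
qed

lemma invertible_Id2 [simp]: "f \<in> Mor L \<Longrightarrow> invertible (Id2 L f)" "f \<in> Mor L \<Longrightarrow> cinv L (Id2 L f) = Id2 L f"
proof -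
  assume "f \<in> Mor L"
  then have "inverse_cells L (Id2 L f) (Id2 L f)" by (auto simp: inverse_cells_def cells_def)
  then show "invertible (Id2 L f)" "cinv L (Id2 L f) = Id2 L f" by (auto dest: cinv_eq invertibleI)
qed

lemma cinv_cancel [simp]:
  assumes "invertible x" "y \<in> Cell L"
  shows "Trg L y = Src L x \<Longrightarrow> cinv L x \<bullet> x \<bullet> y = y"
    "Trg L y = Trg L x \<Longrightarrow> x \<bullet> cinv L x \<bullet> y = y"
proof -
  show "cinv L x \<bullet> x \<bullet> y = y" if t: "Trg L y = Src L x"
  proof -
    have "(cinv L x \<bullet> x) \<bullet> y = cinv L x \<bullet> x \<bullet> y" by (rule VComp_assoc') (simp_all add: assms t)
    then show ?thesis using assms t by simp
  qed
  show "x \<bullet> cinv L x \<bullet> y = y" if t: "Trg L y = Trg L x"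
  proof -
    have "(x \<bullet> cinv L x) \<bullet> y = x \<bullet> cinv L x \<bullet> y" by (rule VComp_assoc') (simp_all add: assms t)
    then show ?thesis using assms t by simp
  qed
qed

lemma invertible_VComp [simp]:
  assumes "invertible x" "invertible y" "Src L y = Trg L x"
  shows "invertible (y \<bullet> x)" "cinv L (y \<bullet> x) = cinv L x \<bullet> cinv L y"
proof -
  have "inverse_cells L (y \<bullet> x) (cinv L x \<bullet> cinv L y)"
    using assms by (auto simp: inverse_cells_def[of L "y \<bullet> x"] cells_def)
  then show "invertible (y \<bullet> x)" "cinv L (y \<bullet> x) = cinv L x \<bullet> cinv L y" by (auto dest: cinv_eq invertibleI)
qed

lemma invertible_HComp [simp]:
  assumes "invertible x" "invertible y" "Dom L (Src L y) = Cod L (Src L x)"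
  shows "invertible (y \<star> x)" "cinv L (y \<star> x) = cinv L y \<star> cinv L x"
proof -
  have "inverse_cells L (y \<star> x) (cinv L y \<star> cinv L x)"
    using assms interchange'[of x "cinv L x" y "cinv L y"] interchange'[of "cinv L x" x "cinv L y" y]
    by (auto simp: inverse_cells_def[of L "y \<star> x"] cells_def)
  then show "invertible (y \<star> x)" "cinv L (y \<star> x) = cinv L y \<star> cinv L x" by (auto dest: cinv_eq invertibleI)
qed

lemma whisker_cinv [simp]:
  assumes "invertible x"
  shows "f \<in> Mor L \<Longrightarrow> Dom L f = Cod L (Src L x) \<Longrightarrow> (f \<rhd> cinv L x) \<bullet> (f \<rhd> x) = Id2 L (f \<odot> Src L x)"
    "f \<in> Mor L \<Longrightarrow> Dom L f = Cod L (Src L x) \<Longrightarrow> (f \<rhd> x) \<bullet> (f \<rhd> cinv L x) = Id2 L (f \<odot> Trg L x)"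
    "f \<in> Mor L \<Longrightarrow> Dom L (Src L x) = Cod L f \<Longrightarrow> (cinv L x \<lhd> f) \<bullet> (x \<lhd> f) = Id2 L (Src L x \<odot> f)"
    "f \<in> Mor L \<Longrightarrow> Dom L (Src L x) = Cod L f \<Longrightarrow> (x \<lhd> f) \<bullet> (cinv L x \<lhd> f) = Id2 L (Trg L x \<odot> f)"
  using assms whisker_VComp[of x "cinv L x" f] whisker_VComp[of "cinv L x" x f] by auto

lemma whisker_cinv_cancel [simp]:
  assumes "invertible x" "y \<in> Cell L"
  shows "f \<in> Mor L \<Longrightarrow> Dom L f = Cod L (Src L x) \<Longrightarrow> Trg L y = f \<odot> Src L x \<Longrightarrow>
      (f \<rhd> cinv L x) \<bullet> (f \<rhd> x) \<bullet> y = y"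
    "f \<in> Mor L \<Longrightarrow> Dom L f = Cod L (Src L x) \<Longrightarrow> Trg L y = f \<odot> Trg L x \<Longrightarrow>
      (f \<rhd> x) \<bullet> (f \<rhd> cinv L x) \<bullet> y = y"
    "f \<in> Mor L \<Longrightarrow> Dom L (Src L x) = Cod L f \<Longrightarrow> Trg L y = Src L x \<odot> f \<Longrightarrow>
      (cinv L x \<lhd> f) \<bullet> (x \<lhd> f) \<bullet> y = y"
    "f \<in> Mor L \<Longrightarrow> Dom L (Src L x) = Cod L f \<Longrightarrow> Trg L y = Trg L x \<odot> f \<Longrightarrow>
      (x \<lhd> f) \<bullet> (cinv L x \<lhd> f) \<bullet> y = y"
  using assms cinv_cancel[of "f \<rhd> x" y] cinv_cancel[of "x \<lhd> f" y] by auto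

text \<open>\<open>whisker_cinv\<close> does not match a cell whiskered on both sides, because
  \<open>cinv L (x \<lhd> g)\<close> has already been rewritten to
  \<open>cinv L x \<lhd> g\<close>.\<close>

lemma sandwich_cinv [simp]:
  assumes "invertible x" "f \<in> Mor L" "Dom L f = Cod L (Src L x)" "g \<in> Mor L" "Dom L (Src L x) = Cod L g"
  shows "(f \<rhd> (cinv L x \<lhd> g)) \<bullet> (f \<rhd> (x \<lhd> g)) = Id2 L (f \<odot> Src L x \<odot> g)"
    "(f \<rhd> (x \<lhd> g)) \<bullet> (f \<rhd> (cinv L x \<lhd> g)) = Id2 L (f \<odot> Trg L x \<odot> g)"
    "y \<in> Cell L \<Longrightarrow> Trg L y = f \<odot> Src L x \<odot> g \<Longrightarrow>
      (f \<rhd> (cinv L x \<lhd> g)) \<bullet> (f \<rhd> (x \<lhd> g)) \<bullet> y = y"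
    "y \<in> Cell L \<Longrightarrow> Trg L y = f \<odot> Trg L x \<odot> g \<Longrightarrow>
      (f \<rhd> (x \<lhd> g)) \<bullet> (f \<rhd> (cinv L x \<lhd> g)) \<bullet> y = y"
  using assms whisker_cinv(1,2)[of "x \<lhd> g" f] whisker_cinv_cancel(1,2)[of "x \<lhd> g" y f] by auto

lemma iso_cells_iff: "x \<in> iso_cells L f g \<longleftrightarrow> invertible x \<and> Src L x = f \<and> Trg L x = g"
  unfolding iso_cells_def invertible_cell_def cells_def inverse_cells_def by blast

lemma cells_iff: "x \<in> cells L f g \<longleftrightarrow> x \<in> Cell L \<and> Src L x = f \<and> Trg L x = g"
  by (auto simp: cells_def)

lemma hom_iff: "f \<in> hom L A B \<longleftrightarrow> f \<in> Mor L \<and> Dom L f = A \<and> Cod L f = B"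
  by (auto simp: hom_def)

lemma VComp_left_cancel:
  assumes "invertible x" "y \<in> Cell L" "z \<in> Cell L" "Trg L y = Src L x" "Trg L z = Src L x"
    "x \<bullet> y = x \<bullet> z"
  shows "y = z"
proof -
  have "y = cinv L x \<bullet> (x \<bullet> y)" "z = cinv L x \<bullet> (x \<bullet> z)" using assms(1-5) by simp_all
  then show ?thesis using assms(6) by simp
qed

lemma VComp_right_cancel:
  assumes "invertible x" "y \<in> Cell L" "z \<in> Cell L" "Src L y = Trg L x" "Src L z = Trg L x"
    "y \<bullet> x = z \<bullet> x"
  shows "y = z"
proof -
  have "y = (y \<bullet> x) \<bullet> cinv L x" "z = (z \<bullet> x) \<bullet> cinv L x" using assms(1-5) by simp_all
  then show ?thesis using assms(6) by simp
qed

end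

section \<open>The dual 2-category\<close>

lemma op2_simps [simp]:
  "Obj (op2 L) = Obj L" "Mor (op2 L) = Mor L" "Cell (op2 L) = Cell L" "Dom (op2 L) = Cod L"
  "Cod (op2 L) = Dom L" "Src (op2 L) = Src L" "Trg (op2 L) = Trg L" "Id1 (op2 L) = Id1 L"
  "Id2 (op2 L) = Id2 L" "Comp (op2 L) g f = Comp L f g" "VComp (op2 L) = VComp L"
  "HComp (op2 L) y x = HComp L x y"
  by (simp_all add: op2_def)

lemma op2_derived [simp]:
  "cells (op2 L) = cells L" "inverse_cells (op2 L) = inverse_cells L" "iso_cells (op2 L) = iso_cells L"
  "invertible_cell (op2 L) = invertible_cell L" "cinv (op2 L) = cinv L" "f \<in> hom (op2 L) A B \<longleftrightarrow> f \<in> hom L B A"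
proof -
  show c: "cells (op2 L) = cells L" by (auto simp: cells_def fun_eq_iff)
  show i: "inverse_cells (op2 L) = inverse_cells L" by (auto simp: inverse_cells_def fun_eq_iff c)
  show "iso_cells (op2 L) = iso_cells L" by (auto simp: iso_cells_def fun_eq_iff c i)
  show "invertible_cell (op2 L) = invertible_cell L" by (auto simp: invertible_cell_def fun_eq_iff i)
  show "cinv (op2 L) = cinv L" by (auto simp: cinv_def fun_eq_iff i)
  show "f \<in> hom (op2 L) A B \<longleftrightarrow> f \<in> hom L B A" by (auto simp: hom_def)
qed

lemma op2_op2 [simp]: "op2 (op2 L) = L"
  by (simp add: op2_def)

lemma (in two_category) two_category_op2: "two_category (op2 L)"
  by unfold_locales (simp_all add: cells_iff hom_iff interchange')

section \<open>Null presentations\<close>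

text \<open>
  A 2-cell \<open>p : f \<Rightarrow> n\<close> with \<open>pres p\<close> presents \<open>f\<close> as isomorphic to a null 1-cell; presentations are whiskered by
  means of \<open>\<nu>\<close>.  The conditions on composites \<open>\<nu> \<dots> \<nu>\<^sup>-\<^sup>1\<close> in the definitions of kernels, (weak) reflection and
  orthogonality say that a 2-cell is null relative to two presentations.  (The simplifier would rewrite the
  \<open>Dom L n\<close> hidden in the abbreviations \<open>nu_left\<close> and \<open>nu_right\<close>, hence the constants \<open>lnu\<close> and \<open>rnu\<close>.)
\<close>

locale ideal_data =
  fixes L :: "('o, 'm, 'c) two_cat" (structure) and N :: "('o, 'm, 'c) ideal"
begin

definition "lnu b n = nu_left L N b n"

definition "rnu n a = nu_right L N n a"

definition "pres p \<longleftrightarrow> invertible_cell L p \<and> null L N (Trg L p)"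

definition "pres_left b p = lnu b (Trg L p) \<bullet> (b \<rhd> p)"

definition "pres_right p a = rnu (Trg L p) a \<bullet> (p \<lhd> a)"

definition "rnull p q x \<longleftrightarrow> pres p \<and> pres q \<and> x \<in> Cell L \<and> Src L x = Src L p \<and> Trg L x = Src L q \<and>
     null_cell L N (q \<bullet> x \<bullet> cinv L p)"

text \<open>The inverse of a null 2-cell need not be null, so both directions are required; this is
  isomorphism in N(A,B) after conjugation with p and q.\<close>

definition "riso p q x \<longleftrightarrow> invertible_cell L x \<and> rnull p q x \<and> rnull q p (cinv L x)"

definition "kernel_of f k p \<longleftrightarrow> is_kernel L N f k (Trg L p) p"

definition "cokernel_of g e p \<longleftrightarrow> is_cokernel L N g e (Trg L p) p"

end

text \<open>The properties of a 2-ideal needed below, as a list that is closed under duality.\<close>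

locale null_ideal = two_category L + ideal_data L N
  for L :: "('o, 'm, 'c) two_cat" (structure) and N :: "('o, 'm, 'c) ideal" +
  assumes null_Mor: "null L N n \<Longrightarrow> n \<in> Mor L"
    and null_cell_null: "null_cell L N x \<Longrightarrow> null L N (Src L x) \<and> null L N (Trg L x)"
    and null_cell_Id2: "null L N n \<Longrightarrow> null_cell L N (Id2 L n)"
    and null_cell_VComp: "\<lbrakk>null_cell L N x; null_cell L N y; Src L y = Trg L x\<rbrakk> \<Longrightarrow> null_cell L N (y \<bullet> x)"
    and lnu: "\<lbrakk>null L N n; b \<in> Mor L; Dom L b = Cod L n\<rbrakk> \<Longrightarrow>
          invertible_cell L (lnu b n) \<and> Src L (lnu b n) = b \<odot> n \<and>
          null L N (Trg L (lnu b n))"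
    and rnu: "\<lbrakk>null L N n; a \<in> Mor L; Dom L n = Cod L a\<rbrakk> \<Longrightarrow>
          invertible_cell L (rnu n a) \<and> Src L (rnu n a) = n \<odot> a \<and>
          null L N (Trg L (rnu n a))"
    and lnu_natural: "\<lbrakk>null_cell L N x; b \<in> Mor L; Dom L b = Cod L (Src L x)\<rbrakk> \<Longrightarrow>
          null_cell L N (lnu b (Trg L x) \<bullet> (b \<rhd> x) \<bullet> cinv L (lnu b (Src L x)))"
    and rnu_natural: "\<lbrakk>null_cell L N x; a \<in> Mor L; Dom L (Src L x) = Cod L a\<rbrakk> \<Longrightarrow>
          null_cell L N (rnu (Trg L x) a \<bullet> (x \<lhd> a) \<bullet> cinv L (rnu (Src L x) a))"
    and lnu_cell: "\<lbrakk>null L N n; y \<in> Cell L; Dom L (Src L y) = Cod L n\<rbrakk> \<Longrightarrow>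
          null_cell L N (lnu (Trg L y) n \<bullet> (y \<lhd> n) \<bullet> cinv L (lnu (Src L y) n))"
    and rnu_cell: "\<lbrakk>null L N n; y \<in> Cell L; Dom L n = Cod L (Src L y)\<rbrakk> \<Longrightarrow>
          null_cell L N (rnu n (Trg L y) \<bullet> (n \<rhd> y) \<bullet> cinv L (rnu n (Src L y)))"
    and lnu_left: "\<lbrakk>null L N n; b \<in> Mor L; b' \<in> Mor L; Dom L b = Cod L n; Dom L b' = Cod L b\<rbrakk> \<Longrightarrow>
          riso (lnu (b' \<odot> b) n) (pres_left b' (lnu b n)) (Id2 L (b' \<odot> b \<odot> n))"
    and rnu_right: "\<lbrakk>null L N n; a \<in> Mor L; a' \<in> Mor L; Dom L n = Cod L a; Dom L a = Cod L a'\<rbrakk> \<Longrightarrow>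
          riso (rnu n (a \<odot> a')) (pres_right (rnu n a) a') (Id2 L (n \<odot> a \<odot> a'))"
    \<comment> \<open>The two-sided \<nu> is the middle term between whiskering on the right first
      and whiskering on the left first. Under duality this item and the next exchange
      places.\<close>
    and lnu_rnu: "\<lbrakk>null L N n; b \<in> Mor L; a \<in> Mor L; Dom L b = Cod L n; Dom L n = Cod L a\<rbrakk> \<Longrightarrow>
          riso (nu L N b n a) (pres_left b (rnu n a)) (Id2 L (b \<odot> n \<odot> a))"
    and rnu_lnu: "\<lbrakk>null L N n; b \<in> Mor L; a \<in> Mor L; Dom L b = Cod L n; Dom L n = Cod L a\<rbrakk> \<Longrightarrow>
          riso (nu L N b n a) (pres_right (lnu b n) a) (Id2 L (b \<odot> n \<odot> a))"
    and lnu_Id1: "null L N n \<Longrightarrow> lnu (Id1 L (Cod L n)) n = Id2 L n"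
    and rnu_Id1: "null L N n \<Longrightarrow> rnu n (Id1 L (Dom L n)) = Id2 L n"
begin

declare null_Mor [simp]

lemma null_cell_Cell [simp]: "null_cell L N x \<Longrightarrow> x \<in> Cell L"
  by (simp add: null_cell_def)

lemma nu_simps [simp]:
  assumes "null L N n"
  shows "b \<in> Mor L \<Longrightarrow> Dom L b = Cod L n \<Longrightarrow> invertible (lnu b n)"
    "b \<in> Mor L \<Longrightarrow> Dom L b = Cod L n \<Longrightarrow> Src L (lnu b n) = b \<odot> n"
    "b \<in> Mor L \<Longrightarrow> Dom L b = Cod L n \<Longrightarrow> null L N (Trg L (lnu b n))"
    "a \<in> Mor L \<Longrightarrow> Dom L n = Cod L a \<Longrightarrow> invertible (rnu n a)"
    "a \<in> Mor L \<Longrightarrow> Dom L n = Cod L a \<Longrightarrow> Src L (rnu n a) = n \<odot> a"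
    "a \<in> Mor L \<Longrightarrow> Dom L n = Cod L a \<Longrightarrow> null L N (Trg L (rnu n a))"
  using lnu[OF assms] rnu[OF assms] by simp_all

lemma presD [simp]:
  assumes "pres p"
  shows "invertible p" "null L N (Trg L p)" "p \<in> Cell L"
    "Dom L (Trg L p) = Dom L (Src L p)" "Cod L (Trg L p) = Cod L (Src L p)"
  using assms by (simp_all add: pres_def)

lemma presI: "invertible p \<Longrightarrow> null L N (Trg L p) \<Longrightarrow> pres p"
  unfolding pres_def by blast

lemma pres_nu [simp]:
  assumes "null L N n"
  shows "b \<in> Mor L \<Longrightarrow> Dom L b = Cod L n \<Longrightarrow> pres (lnu b n)"
    "a \<in> Mor L \<Longrightarrow> Dom L n = Cod L a \<Longrightarrow> pres (rnu n a)"
  by (rule presI; use assms in simp)+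

lemma pres_left_simps [simp]:
  assumes "pres p" "b \<in> Mor L" "Dom L b = Cod L (Src L p)"
  shows "pres (pres_left b p)" "Src L (pres_left b p) = b \<odot> Src L p"
  unfolding pres_left_def by (rule presI) (use assms in simp_all)

lemma pres_right_simps [simp]:
  assumes "pres p" "a \<in> Mor L" "Dom L (Src L p) = Cod L a"
  shows "pres (pres_right p a)" "Src L (pres_right p a) = Src L p \<odot> a"
  unfolding pres_right_def by (rule presI) (use assms in simp_all)

lemma pres_VComp [simp]:
  assumes "pres p" "invertible x" "Trg L x = Src L p"
  shows "pres (p \<bullet> x)"
  by (rule presI) (use assms in simp_all)

lemma pres_left_VComp [simp]:
  assumes "pres p" "x \<in> Cell L" "Trg L x = Src L p" "b \<in> Mor L" "Dom L b = Cod L (Src L p)"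
  shows "pres_left b (p \<bullet> x) = pres_left b p \<bullet> (b \<rhd> x)"
proof -
  have "Cod L (Src L x) = Cod L (Src L p)" using assms Cell_simps(4)[of x] by simp
  then show ?thesis using assms by (simp add: pres_left_def)
qed

lemma pres_right_VComp [simp]:
  assumes "pres p" "x \<in> Cell L" "Trg L x = Src L p" "a \<in> Mor L" "Dom L (Src L p) = Cod L a"
  shows "pres_right (p \<bullet> x) a = pres_right p a \<bullet> (x \<lhd> a)"
proof -
  have "Dom L (Src L x) = Dom L (Src L p)" using assms Cell_simps(3)[of x] by simp
  then show ?thesis using assms by (simp add: pres_right_def)
qed

lemma pres_left_Id1: "pres p \<Longrightarrow> A = Cod L (Src L p) \<Longrightarrow> pres_left (Id1 L A) p = p"
  using lnu_Id1[of "Trg L p"] by (simp add: pres_left_def)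

lemma pres_right_Id1: "pres p \<Longrightarrow> A = Dom L (Src L p) \<Longrightarrow> pres_right p (Id1 L A) = p"
  using rnu_Id1[of "Trg L p"] by (simp add: pres_right_def)

section \<open>Calculus of 2-cells null relative to two presentations\<close>

lemma rnullD:
  assumes "rnull p q x"
  shows "pres p" "pres q" "x \<in> Cell L" "Src L x = Src L p" "Trg L x = Src L q"
    "null_cell L N (q \<bullet> x \<bullet> cinv L p)"
  using assms by (auto simp: rnull_def)

lemma risoD:
  assumes "riso p q x"
  shows "invertible x" "rnull p q x" "rnull q p (cinv L x)"
    "pres p" "pres q" "Src L x = Src L p" "Trg L x = Src L q"
  using assms by (auto simp: riso_def rnull_def)

lemma rnull_VComp:
  assumes "rnull p q x" "rnull q r y"
  shows "rnull p r (y \<bullet> x)"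
proof -
  note a = rnullD[OF assms(1)] and b = rnullD[OF assms(2)]
  have "null_cell L N ((r \<bullet> y \<bullet> cinv L q) \<bullet> q \<bullet> x \<bullet> cinv L p)"
    by (rule null_cell_VComp) (use a b in simp_all)
  also have "(r \<bullet> y \<bullet> cinv L q) \<bullet> q \<bullet> x \<bullet> cinv L p = r \<bullet> (y \<bullet> x) \<bullet> cinv L p"
    using a(1-5) b(1-5) by simp
  finally show ?thesis using a b by (simp add: rnull_def)
qed

lemma riso_VComp:
  assumes "riso p q x" "riso q r y"
  shows "riso p r (y \<bullet> x)"
  using rnull_VComp[OF risoD(2)[OF assms(1)] risoD(2)[OF assms(2)]]
    rnull_VComp[OF risoD(3)[OF assms(2)] risoD(3)[OF assms(1)]]
    risoD[OF assms(1)] risoD[OF assms(2)]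
  by (simp add: riso_def)

lemma riso_cinv: "riso p q x \<Longrightarrow> riso q p (cinv L x)"
  by (simp add: riso_def)

text \<open>Conjugating x with \<open>p \<bullet> x\<close> and p leaves an identity. A null
  structure carried along an invertible 2-cell is thus always compatible with it.\<close>

lemma riso_transport:
  assumes "pres p" "invertible x" "Trg L x = Src L p"
  shows "riso (p \<bullet> x) p x"
  using assms by (simp add: riso_def rnull_def null_cell_Id2)

text \<open>The bridge to the definitions of kernel, weak reflection and orthogonality: the inverse
  of the conjugate of x is the conjugate of the inverse, with p and q exchanged.\<close>

lemma riso_iff_null_iso:
  assumes "pres p" "pres q" "invertible x" "Src L x = Src L p" "Trg L x = Src L q"
  shows "riso p q x \<longleftrightarrow> null_iso L N (q \<bullet> x \<bullet> cinv L p)"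
proof -
  have i: "invertible (q \<bullet> x \<bullet> cinv L p)" "cinv L (q \<bullet> x \<bullet> cinv L p) = p \<bullet> cinv L x \<bullet> cinv L q"
    using assms by simp_all
  have "null_iso L N (q \<bullet> x \<bullet> cinv L p) \<longleftrightarrow> null_cell L N (q \<bullet> x \<bullet> cinv L p) \<and>
      null_cell L N (p \<bullet> cinv L x \<bullet> cinv L q)"
    using inverse_cells_cinv[OF i(1)] cinv_eq unfolding null_iso_def i(2)[symmetric] by blast
  then show ?thesis using assms by (auto simp: riso_def rnull_def)
qed

lemma null_isoD:
  assumes "null_iso L N x"
  shows "invertible x" "null_cell L N x" "null_cell L N (cinv L x)" "null L N (Src L x)" "null L N (Trg L x)"
proof -
  obtain y where y: "null_cell L N x" "null_cell L N y" "inverse_cells L x y"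
    using assms by (auto simp: null_iso_def)
  show "invertible x" using y(3) by (rule invertibleI)
  show "null_cell L N x" by (rule y)
  show "null_cell L N (cinv L x)" using y cinv_eq by simp
  show "null L N (Src L x)" "null L N (Trg L x)" using null_cell_null[OF y(1)] by auto
qed

lemma riso_Id2_iff:
  assumes "pres p" "pres q" "f = Src L p" "f = Src L q"
  shows "riso p q (Id2 L f) \<longleftrightarrow> null_iso L N (q \<bullet> cinv L p)"
  using riso_iff_null_iso[of p q "Id2 L f"] assms by simp

text \<open>The whiskered p and q cancel against the conjugation, which leaves naturality of \<nu>
  for the null 2-cell \<open>q \<bullet> x \<bullet> cinv L p\<close>.\<close>

lemma rnull_pres_left:
  assumes "rnull p q x" "b \<in> Mor L" "Dom L b = Cod L (Src L p)"
  shows "rnull (pres_left b p) (pres_left b q) (b \<rhd> x)"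
proof -
  note a = rnullD[OF assms(1)]
  have c: "Cod L (Src L q) = Cod L (Src L p)" using a Cell_simps(4)[of x] by simp
  have "null_cell L N (lnu b (Trg L q) \<bullet> (b \<rhd> (q \<bullet> x \<bullet> cinv L p)) \<bullet> cinv L (lnu b (Trg L p)))"
    using lnu_natural[OF a(6) assms(2)] a(1-5) assms c by simp
  then show ?thesis using a(1-5) assms c by (simp add: rnull_def pres_left_def)
qed

lemma rnull_pres_right:
  assumes "rnull p q x" "a \<in> Mor L" "Dom L (Src L p) = Cod L a"
  shows "rnull (pres_right p a) (pres_right q a) (x \<lhd> a)"
proof -
  note a = rnullD[OF assms(1)]
  have c: "Dom L (Src L q) = Dom L (Src L p)" using a Cell_simps(3)[of x] by simp
  have "null_cell L N (rnu (Trg L q) a \<bullet> ((q \<bullet> x \<bullet> cinv L p) \<lhd> a) \<bullet> cinv L (rnu (Trg L p) a))"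
    using rnu_natural[OF a(6) assms(2)] a(1-5) assms c by simp
  then show ?thesis using a(1-5) assms c by (simp add: rnull_def pres_right_def)
qed

lemma riso_pres_left:
  assumes "riso p q x" "b \<in> Mor L" "Dom L b = Cod L (Src L p)"
  shows "riso (pres_left b p) (pres_left b q) (b \<rhd> x)"
proof -
  note a = risoD[OF assms(1)]
  have c: "Cod L (Src L q) = Cod L (Src L p)" using a Cell_simps(4)[of x] by simp
  show ?thesis using rnull_pres_left[OF a(2) assms(2,3)] rnull_pres_left[OF a(3) assms(2)] a(1,4-) c assms
    by (simp add: riso_def)
qed

lemma riso_pres_right:
  assumes "riso p q x" "a \<in> Mor L" "Dom L (Src L p) = Cod L a"
  shows "riso (pres_right p a) (pres_right q a) (x \<lhd> a)"
proof -
  note a = risoD[OF assms(1)]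
  have c: "Dom L (Src L q) = Dom L (Src L p)" using a Cell_simps(3)[of x] by simp
  show ?thesis using rnull_pres_right[OF a(2) assms(2,3)] rnull_pres_right[OF a(3) assms(2)] a(1,4-) c assms
    by (simp add: riso_def)
qed

text \<open>Interchange moves y past the inverse of p, which reduces the claim to the action of N on
  2-cells. Hence a 2-cell whiskered with a presented 1-cell is null without further conditions; the
  later nullness checks end here.\<close>

lemma rnull_left_cell:
  assumes "pres p" "y \<in> Cell L" "Src L y = b" "Trg L y = b'" "Dom L b = Cod L (Src L p)"
  shows "rnull (pres_left b p) (pres_left b' p) (y \<lhd> Src L p)"
proof -
  have d: "Dom L b' = Dom L b" "b \<in> Mor L" "b' \<in> Mor L" using assms Cell_simps[of y] by auto
  have e: "(y \<lhd> Src L p) \<bullet> (b \<rhd> cinv L p) \<bullet> z = (b' \<rhd> cinv L p) \<bullet> (y \<lhd> Trg L p) \<bullet> z"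
    if "z \<in> Cell L" "Trg L z = b \<odot> Trg L p" for z
    by (rule whisker_exchange_assoc) (use assms that in simp_all)
  show ?thesis using lnu_cell[of "Trg L p" y] assms d
    by (simp add: rnull_def pres_left_def e)
qed

lemma rnull_right_cell:
  assumes "pres p" "y \<in> Cell L" "Src L y = a" "Trg L y = a'" "Dom L (Src L p) = Cod L a"
  shows "rnull (pres_right p a) (pres_right p a') (Src L p \<rhd> y)"
proof -
  have d: "Cod L a' = Cod L a" "a \<in> Mor L" "a' \<in> Mor L" using assms Cell_simps[of y] by auto
  have e: "(Src L p \<rhd> y) \<bullet> (cinv L p \<lhd> a) \<bullet> z = (cinv L p \<lhd> a') \<bullet> (Trg L p \<rhd> y) \<bullet> z"
    if "z \<in> Cell L" "Trg L z = Trg L p \<odot> a" for z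
    by (rule whisker_exchange_assoc[symmetric]) (use assms that in simp_all)
  show ?thesis using rnu_cell[of "Trg L p" y] assms d
    by (simp add: rnull_def pres_right_def e)
qed

lemma riso_left_left:
  assumes "pres p" "b \<in> Mor L" "b' \<in> Mor L" "Dom L b = Cod L (Src L p)" "Dom L b' = Cod L b"
    "f = b' \<odot> b \<odot> Src L p"
  shows "riso (pres_left (b' \<odot> b) p) (pres_left b' (pres_left b p)) (Id2 L f)"
  using lnu_left[of "Trg L p" b b'] assms
  by (simp add: riso_Id2_iff pres_left_def)

lemma riso_right_right:
  assumes "pres p" "a \<in> Mor L" "a' \<in> Mor L" "Dom L (Src L p) = Cod L a" "Dom L a = Cod L a'"
    "f = Src L p \<odot> a \<odot> a'"
  shows "riso (pres_right p (a \<odot> a')) (pres_right (pres_right p a) a') (Id2 L f)"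
  using rnu_right[of "Trg L p" a a'] assms
  by (simp add: riso_Id2_iff pres_right_def)

text \<open>Both orders of whiskering are compared with the two-sided \<nu> at the null 1-cell
  \<open>Trg L p\<close>; p itself cancels.\<close>

lemma riso_left_right:
  assumes "pres p" "b \<in> Mor L" "a \<in> Mor L" "Dom L b = Cod L (Src L p)" "Dom L (Src L p) = Cod L a"
    "f = b \<odot> Src L p \<odot> a"
  shows "riso (pres_left b (pres_right p a)) (pres_right (pres_left b p) a) (Id2 L f)"
proof -
  have "riso (pres_left b (rnu (Trg L p) a)) (pres_right (lnu b (Trg L p)) a) (Id2 L (b \<odot> Trg L p \<odot> a))"
    using riso_VComp[OF riso_cinv[OF lnu_rnu] rnu_lnu, of "Trg L p" b a] assms by simp
  then show ?thesis using assms by (simp add: riso_Id2_iff pres_left_def pres_right_def)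
qed

end

section \<open>2-kernels and 2-cokernels\<close>

context two_category
begin

lemma equivalenceE:
  assumes "equivalence L i"
  obtains j \<eta> \<epsilon> where "i \<in> Mor L" "j \<in> Mor L" "Dom L j = Cod L i" "Cod L j = Dom L i"
    "invertible \<eta>" "Src L \<eta> = Id1 L (Dom L i)" "Trg L \<eta> = j \<odot> i"
    "invertible \<epsilon>" "Src L \<epsilon> = i \<odot> j" "Trg L \<epsilon> = Id1 L (Cod L i)"
  using assms unfolding equivalence_def hom_iff iso_cells_iff
  by (auto simp: iso_cells_iff hom_iff set_eq_iff)

text \<open>Interchange of x with \<eta>, solved for x. It recovers x from its whiskering along any
  h isomorphic to an identity.\<close>

lemma whisker_conjugate:
  assumes "invertible \<eta>" "Src L \<eta> = Id1 L A" "Trg L \<eta> = h" "x \<in> Cell L" "Cod L (Src L x) = A"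
  shows "x = (cinv L \<eta> \<lhd> Trg L x) \<bullet> (h \<rhd> x) \<bullet> (\<eta> \<lhd> Src L x)"
proof -
  have A: "A \<in> Obj L" using assms by auto
  have "\<eta> \<in> Cell L" using assms by simp
  then have d: "Dom L h = A" "Cod L h = A" "h \<in> Mor L"
    using assms A Cell_simps[of \<eta>] by auto
  have "(\<eta> \<lhd> Trg L x) \<bullet> (Id1 L A \<rhd> x) = (h \<rhd> x) \<bullet> (\<eta> \<lhd> Src L x)"
    by (rule whisker_exchange) (use assms A d in simp_all)
  from this[symmetric] show ?thesis using assms A d by simp
qed

lemma whisker_conjugate_faithful:
  assumes "invertible \<eta>" "Src L \<eta> = Id1 L A" "Trg L \<eta> = h" "x \<in> Cell L" "y \<in> Cell L"
    "Cod L (Src L x) = A" "Src L x = Src L y" "Trg L x = Trg L y" "h \<rhd> x = h \<rhd> y"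
  shows "x = y"
  using whisker_conjugate[OF assms(1-4,6)] whisker_conjugate[OF assms(1-3,5)] assms by simp

lemma equivalence_faithful:
  assumes "equivalence L i" "x \<in> Cell L" "y \<in> Cell L" "Cod L (Src L x) = Dom L i"
    "Src L x = Src L y" "Trg L x = Trg L y" "i \<rhd> x = i \<rhd> y"
  shows "x = y"
proof -
  from assms(1) obtain j \<eta> \<epsilon> where e: "i \<in> Mor L" "j \<in> Mor L" "Dom L j = Cod L i" "Cod L j = Dom L i"
    "invertible \<eta>" "Src L \<eta> = Id1 L (Dom L i)" "Trg L \<eta> = j \<odot> i" by (rule equivalenceE)
  have "(j \<odot> i) \<rhd> x = j \<rhd> (i \<rhd> x)" "(j \<odot> i) \<rhd> y = j \<rhd> (i \<rhd> y)" using e assms(1-6) by simp_all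
  then have "(j \<odot> i) \<rhd> x = (j \<odot> i) \<rhd> y" using assms(7) by simp
  then show ?thesis using whisker_conjugate_faithful[of \<eta> "Dom L i" "j \<odot> i" x y] e assms by simp
qed

text \<open>No triangle identities are available. The candidate x is built from z with \<eta> alone,
  which yields equality with z only after whiskering along j; whiskering once more along i and
  conjugating with \<epsilon> removes the composite i j.\<close>

lemma equivalence_full:
  assumes i: "equivalence L i" and u: "u \<in> Mor L" "Cod L u = Dom L i" and v: "v \<in> Mor L" "Cod L v = Dom L i"
    and z: "z \<in> Cell L" "Src L z = i \<odot> u" "Trg L z = i \<odot> v" and d: "Dom L v = Dom L u"
  obtains x where "x \<in> Cell L" "Src L x = u" "Trg L x = v" "i \<rhd> x = z"
proof -
  from i obtain j \<eta> \<epsilon> where e: "i \<in> Mor L" "j \<in> Mor L" "Dom L j = Cod L i" "Cod L j = Dom L i"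
    "invertible \<eta>" "Src L \<eta> = Id1 L (Dom L i)" "Trg L \<eta> = j \<odot> i"
    "invertible \<epsilon>" "Src L \<epsilon> = i \<odot> j" "Trg L \<epsilon> = Id1 L (Cod L i)" by (rule equivalenceE)
  define x where "x = (cinv L \<eta> \<lhd> v) \<bullet> (j \<rhd> z) \<bullet> (\<eta> \<lhd> u)"
  have x: "x \<in> Cell L" "Src L x = u" "Trg L x = v" using e u v z d by (simp_all add: x_def)
  have "(\<eta> \<lhd> v) \<bullet> (Id1 L (Dom L i) \<rhd> x) = ((j \<odot> i) \<rhd> x) \<bullet> (\<eta> \<lhd> u)"
    by (rule whisker_exchange) (use e x u v in simp_all)
  moreover have "(\<eta> \<lhd> v) \<bullet> (Id1 L (Dom L i) \<rhd> x) = (j \<rhd> z) \<bullet> (\<eta> \<lhd> u)"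
    using e u v z d by (simp add: x_def)
  ultimately have "(j \<odot> i) \<rhd> x = j \<rhd> z"
    using VComp_right_cancel[of "\<eta> \<lhd> u" "(j \<odot> i) \<rhd> x" "j \<rhd> z"] e x u v z d by simp
  then have "i \<rhd> ((j \<odot> i) \<rhd> x) = i \<rhd> (j \<rhd> z)" by simp
  then have "(i \<odot> j) \<rhd> (i \<rhd> x) = (i \<odot> j) \<rhd> z" using e x u v z by simp
  then have "i \<rhd> x = z"
    using whisker_conjugate_faithful[of "cinv L \<epsilon>" "Cod L i" "i \<odot> j" "i \<rhd> x" z] e x u v z by simp
  with x show ?thesis by (rule that)
qed

text \<open>Duality exchanges unit and counit but does not reverse 2-cells, so both isomorphisms
  have to be inverted.\<close>

lemma equivalence_op2 [simp]: "equivalence (op2 L) i = equivalence L i"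
proof -
  have i: "cinv L x \<in> iso_cells L b a" if "x \<in> iso_cells L a b" for x a b
    using that by (simp add: iso_cells_iff)
  have s: "iso_cells L a b \<noteq> {} \<longleftrightarrow> iso_cells L b a \<noteq> {}" for a b
    using i by blast
  show ?thesis unfolding equivalence_def Bex_def op2_simps op2_derived
    using s[of "Id1 L (Dom L i)"] s[of _ "Id1 L (Cod L i)"] by blast
qed

end

section \<open>The universal property of kernels in terms of presentations\<close>

context null_ideal
begin

lemma kernel_iff:
  "kernel_of f k p \<longleftrightarrow> f \<in> Mor L \<and> k \<in> Mor L \<and> Cod L k = Dom L f \<and> pres p \<and> Src L p = f \<odot> k \<and>
     (\<forall>z q. z \<in> Mor L \<and> Cod L z = Dom L f \<and> pres q \<and> Src L q = f \<odot> z \<longrightarrow>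
        (\<exists>u x. u \<in> Mor L \<and> Dom L u = Dom L z \<and> Cod L u = Dom L k \<and> invertible x \<and> Src L x = z \<and>
           Trg L x = k \<odot> u \<and> riso q (pres_right p u) (f \<rhd> x))) \<and>
     (\<forall>u v x. u \<in> Mor L \<and> v \<in> Mor L \<and> Dom L u = Dom L v \<and> Cod L u = Dom L k \<and> Cod L v = Dom L k \<and>
        x \<in> Cell L \<and> Src L x = k \<odot> u \<and> Trg L x = k \<odot> v \<and>
        rnull (pres_right p u) (pres_right p v) (f \<rhd> x) \<longrightarrow>
        (\<exists>!y. y \<in> cells L u v \<and> k \<rhd> y = x))" (is "_ \<longleftrightarrow> _ \<and> _ \<and> _ \<and> _ \<and> _ \<and> ?one \<and> ?two")
proof (cases "f \<in> Mor L \<and> k \<in> Mor L \<and> Cod L k = Dom L f \<and> pres p \<and> Src L p = f \<odot> k")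
  case False
  have "f \<in> Mor L \<and> k \<in> Mor L \<and> Cod L k = Dom L f \<and> pres p \<and> Src L p = f \<odot> k" if "kernel_of f k p"
    using that presI[of p] unfolding kernel_of_def is_kernel_def iso_cells_iff by blast
  with False show ?thesis by blast
next
  case True
  \<comment> \<open>The composite in the lifting condition is
    \<open>pres_right p u \<bullet> (f \<rhd> x) \<bullet> cinv L q\<close> spelled out; B does the
    same for the condition on 2-cells.\<close>
  have A: "null_iso L N (nu_right L N (Trg L p) u \<bullet> (p \<lhd> u) \<bullet> (f \<rhd> x) \<bullet> cinv L q) \<longleftrightarrow>
      riso q (pres_right p u) (f \<rhd> x)"
    if "u \<in> Mor L" "Cod L u = Dom L k" "invertible x" "Trg L x = k \<odot> u"
      "pres q" "Src L q = f \<odot> Src L x" for u x q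
  proof -
    have c: "Cod L (Src L x) = Dom L f" "Dom L (Src L x) = Dom L u"
      using Dom_Cod_of_cell[of x "Src L x" "k \<odot> u"] True that by simp_all
    have "pres_right p u \<bullet> (f \<rhd> x) \<bullet> cinv L q = rnu (Trg L p) u \<bullet> (p \<lhd> u) \<bullet> (f \<rhd> x) \<bullet> cinv L q"
      using True that c by (simp add: pres_right_def)
    moreover have "riso q (pres_right p u) (f \<rhd> x) \<longleftrightarrow>
        null_iso L N (pres_right p u \<bullet> (f \<rhd> x) \<bullet> cinv L q)"
      by (rule riso_iff_null_iso) (use True that c in simp_all)
    ultimately show ?thesis unfolding rnu_def by simp
  qed
  have B: "null_cell L N (nu_right L N (Trg L p) v \<bullet> (p \<lhd> v) \<bullet> (f \<rhd> x) \<bullet> (cinv L p \<lhd> u) \<bullet>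
        cinv L (nu_right L N (Trg L p) u)) \<longleftrightarrow> rnull (pres_right p u) (pres_right p v) (f \<rhd> x)"
    if "u \<in> Mor L" "v \<in> Mor L" "Dom L u = Dom L v" "Cod L u = Dom L k" "Cod L v = Dom L k"
        "x \<in> Cell L" "Src L x = k \<odot> u" "Trg L x = k \<odot> v" for u v x
  proof -
    have "pres_right p v \<bullet> (f \<rhd> x) \<bullet> cinv L (pres_right p u) = rnu (Trg L p) v \<bullet> (p \<lhd> v) \<bullet>
        (f \<rhd> x) \<bullet> (cinv L p \<lhd> u) \<bullet> cinv L (rnu (Trg L p) u)"
      using True that by (simp add: pres_right_def)
    then show ?thesis using True that unfolding rnu_def by (simp add: rnull_def)
  qed
  have 1: "?one \<longleftrightarrow> (\<forall>z q \<beta>. z \<in> Mor L \<and> Cod L z = Dom L f \<and> null L N q \<and> \<beta> \<in> iso_cells L (f \<odot> z) q \<longrightarrow>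
        (\<exists>u \<gamma>. u \<in> hom L (Dom L z) (Dom L k) \<and> \<gamma> \<in> iso_cells L z (k \<odot> u) \<and>
           null_iso L N (nu_right L N (Trg L p) u \<bullet> (p \<lhd> u) \<bullet> (f \<rhd> \<gamma>) \<bullet> cinv L \<beta>)))"
    unfolding hom_iff iso_cells_iff using A presI presD(1,2) by blast
  have 2: "?two \<longleftrightarrow> (\<forall>Z u v \<xi>. u \<in> hom L Z (Dom L k) \<and> v \<in> hom L Z (Dom L k) \<and>
        \<xi> \<in> cells L (k \<odot> u) (k \<odot> v) \<and>
        null_cell L N (nu_right L N (Trg L p) v \<bullet> (p \<lhd> v) \<bullet> (f \<rhd> \<xi>)
          \<bullet> (cinv L p \<lhd> u) \<bullet> cinv L (nu_right L N (Trg L p) u)) \<longrightarrow>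
        (\<exists>!\<mu>. \<mu> \<in> cells L u v \<and> k \<rhd> \<mu> = \<xi>))"
    (is "_ \<longleftrightarrow> ?two'")
  proof
    assume l: ?two
    show ?two'
    proof (intro allI impI)
      fix Z u v x
      assume *: "u \<in> hom L Z (Dom L k) \<and> v \<in> hom L Z (Dom L k) \<and> x \<in> cells L (k \<odot> u) (k \<odot> v) \<and>
        null_cell L N (nu_right L N (Trg L p) v \<bullet> (p \<lhd> v) \<bullet> (f \<rhd> x) \<bullet> (cinv L p \<lhd> u) \<bullet>
          cinv L (nu_right L N (Trg L p) u))"
      then have "u \<in> Mor L \<and> v \<in> Mor L \<and> Dom L u = Dom L v \<and> Cod L u = Dom L k \<and> Cod L v = Dom L k \<and>
        x \<in> Cell L \<and> Src L x = k \<odot> u \<and> Trg L x = k \<odot> v" by (simp add: hom_iff cells_iff)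
      then show "\<exists>!\<mu>. \<mu> \<in> cells L u v \<and> k \<rhd> \<mu> = x" using l B[of u v x] * by blast
    qed
  next
    assume r: ?two'
    show ?two
    proof (intro allI impI)
      fix u v x
      assume *: "u \<in> Mor L \<and> v \<in> Mor L \<and> Dom L u = Dom L v \<and> Cod L u = Dom L k \<and> Cod L v = Dom L k \<and>
        x \<in> Cell L \<and> Src L x = k \<odot> u \<and> Trg L x = k \<odot> v \<and>
        rnull (pres_right p u) (pres_right p v) (f \<rhd> x)"
      then have "u \<in> hom L (Dom L u) (Dom L k) \<and> v \<in> hom L (Dom L u) (Dom L k) \<and> x \<in> cells L (k \<odot> u) (k \<odot> v)"
        by (simp add: hom_iff cells_iff)
      then show "\<exists>!y. y \<in> cells L u v \<and> k \<rhd> y = x" using r B[of u v x] * by blast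
    qed
  qed
  show ?thesis unfolding 1 2 using True by (simp add: kernel_of_def is_kernel_def iso_cells_iff)
qed

lemma kernelD:
  assumes "kernel_of f k p"
  shows "f \<in> Mor L" "k \<in> Mor L" "Cod L k = Dom L f" "pres p" "Src L p = f \<odot> k"
  using assms unfolding kernel_iff by blast+

lemma kernel_lift:
  assumes "kernel_of f k p" "z \<in> Mor L" "Cod L z = Dom L f" "pres q" "Src L q = f \<odot> z"
  obtains u x where "u \<in> Mor L" "Dom L u = Dom L z" "Cod L u = Dom L k" "invertible x" "Src L x = z"
    "Trg L x = k \<odot> u" "riso q (pres_right p u) (f \<rhd> x)"
  using assms unfolding kernel_iff by blast

lemma kernel_cell_lift_unique:
  assumes "kernel_of f k p" "u \<in> Mor L" "v \<in> Mor L" "Dom L u = Dom L v" "Cod L u = Dom L k" "Cod L v = Dom L k"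
    "x \<in> Cell L" "Src L x = k \<odot> u" "Trg L x = k \<odot> v"
    "rnull (pres_right p u) (pres_right p v) (f \<rhd> x)"
  shows "\<exists>!y. y \<in> cells L u v \<and> k \<rhd> y = x"
  using assms unfolding kernel_iff by blast

lemma kernel_cell_lift:
  assumes "kernel_of f k p" "u \<in> Mor L" "v \<in> Mor L" "Dom L u = Dom L v" "Cod L u = Dom L k" "Cod L v = Dom L k"
    "x \<in> Cell L" "Src L x = k \<odot> u" "Trg L x = k \<odot> v"
    "rnull (pres_right p u) (pres_right p v) (f \<rhd> x)"
  obtains y where "y \<in> Cell L" "Src L y = u" "Trg L y = v" "k \<rhd> y = x"
  using kernel_cell_lift_unique[OF assms] by (auto simp: cells_iff)

text \<open>The uniqueness clause applies to every \<open>k \<rhd> x\<close>: its whiskering with f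
  is \<open>(f \<odot> k) \<rhd> x\<close>, which is null by \<open>rnull_right_cell\<close> since p
  presents f k.\<close>

lemma kernel_faithful:
  assumes "kernel_of f k p" "x \<in> Cell L" "y \<in> Cell L" "Cod L (Src L x) = Dom L k"
    "Src L x = Src L y" "Trg L x = Trg L y" "k \<rhd> x = k \<rhd> y"
  shows "x = y"
proof -
  note k = kernelD[OF assms(1)]
  have "rnull (pres_right p (Src L x)) (pres_right p (Trg L x)) ((f \<odot> k) \<rhd> x)"
    using rnull_right_cell[of p x "Src L x" "Trg L x"] k assms(1-6) by simp
  moreover have "(f \<odot> k) \<rhd> x = f \<rhd> (k \<rhd> x)" using k assms(1-6) by simp
  ultimately have "rnull (pres_right p (Src L x)) (pres_right p (Trg L x)) (f \<rhd> (k \<rhd> x))"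
    by simp
  then have "\<exists>!z. z \<in> cells L (Src L x) (Trg L x) \<and> k \<rhd> z = k \<rhd> x"
    by (intro kernel_cell_lift_unique[OF assms(1)]) (use assms(1-6) k in simp_all)
  moreover have "x \<in> cells L (Src L x) (Trg L x)" "y \<in> cells L (Src L x) (Trg L x)"
    using assms by (simp_all add: cells_iff)
  ultimately show ?thesis using assms(7) by metis
qed

text \<open>Splits the unique existence of lifted 2-cells into existence and faithfulness, which are
  transported separately below.\<close>

lemma kernelI:
  assumes "f \<in> Mor L" "k \<in> Mor L" "Cod L k = Dom L f" "pres p" "Src L p = f \<odot> k"
    and lift: "\<And>z q. \<lbrakk>z \<in> Mor L; Cod L z = Dom L f; pres q; Src L q = f \<odot> z\<rbrakk> \<Longrightarrow>
        \<exists>u x. u \<in> Mor L \<and> Dom L u = Dom L z \<and> Cod L u = Dom L k \<and> invertible x \<and> Src L x = z \<and>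
           Trg L x = k \<odot> u \<and> riso q (pres_right p u) (f \<rhd> x)"
    and cell_lift: "\<And>u v x. \<lbrakk>u \<in> Mor L; v \<in> Mor L; Dom L u = Dom L v; Cod L u = Dom L k; Cod L v = Dom L k;
        x \<in> Cell L; Src L x = k \<odot> u; Trg L x = k \<odot> v;
        rnull (pres_right p u) (pres_right p v) (f \<rhd> x)\<rbrakk> \<Longrightarrow>
        \<exists>y. y \<in> Cell L \<and> Src L y = u \<and> Trg L y = v \<and> k \<rhd> y = x"
    and faithful: "\<And>x y. \<lbrakk>x \<in> Cell L; y \<in> Cell L; Cod L (Src L x) = Dom L k; Src L x = Src L y;
        Trg L x = Trg L y; k \<rhd> x = k \<rhd> y\<rbrakk> \<Longrightarrow> x = y"
  shows "kernel_of f k p"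
  unfolding kernel_iff
proof (intro conjI)
  show "\<forall>z q. z \<in> Mor L \<and> Cod L z = Dom L f \<and> pres q \<and> Src L q = f \<odot> z \<longrightarrow>
        (\<exists>u x. u \<in> Mor L \<and> Dom L u = Dom L z \<and> Cod L u = Dom L k \<and> invertible x \<and> Src L x = z \<and>
           Trg L x = k \<odot> u \<and> riso q (pres_right p u) (f \<rhd> x))"
    using lift by blast
  show "\<forall>u v x. u \<in> Mor L \<and> v \<in> Mor L \<and> Dom L u = Dom L v \<and> Cod L u = Dom L k \<and> Cod L v = Dom L k \<and>
        x \<in> Cell L \<and> Src L x = k \<odot> u \<and> Trg L x = k \<odot> v \<and>
        rnull (pres_right p u) (pres_right p v) (f \<rhd> x) \<longrightarrow>
        (\<exists>!y. y \<in> cells L u v \<and> k \<rhd> y = x)"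
  proof (intro allI impI, elim conjE)
    fix u v x
    assume *: "u \<in> Mor L" "v \<in> Mor L" "Dom L u = Dom L v" "Cod L u = Dom L k" "Cod L v = Dom L k"
        "x \<in> Cell L" "Src L x = k \<odot> u" "Trg L x = k \<odot> v"
        "rnull (pres_right p u) (pres_right p v) (f \<rhd> x)"
    obtain y where y: "y \<in> Cell L" "Src L y = u" "Trg L y = v" "k \<rhd> y = x" using cell_lift[OF *] by blast
    show "\<exists>!y. y \<in> cells L u v \<and> k \<rhd> y = x"
    proof (rule ex1I[of _ y])
      show "y \<in> cells L u v \<and> k \<rhd> y = x" using y by (simp add: cells_iff)
      show "z = y" if "z \<in> cells L u v \<and> k \<rhd> z = x" for z
        by (rule faithful) (use that y * in \<open>simp_all add: cells_iff\<close>)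
    qed
  qed
qed (use assms in simp_all)

lemma riso_right_cell:
  assumes "pres p" "invertible y" "Src L y = a" "Trg L y = a'" "Dom L (Src L p) = Cod L a"
  shows "riso (pres_right p a) (pres_right p a') (Src L p \<rhd> y)"
proof -
  have d: "Cod L a' = Cod L a" "a \<in> Mor L" using assms Dom_Cod_of_cell[of y a a'] by auto
  show ?thesis using rnull_right_cell[OF assms(1), of y a a'] rnull_right_cell[OF assms(1), of "cinv L y" a' a] assms d
    by (simp add: riso_def)
qed

text \<open>The inverse of x lifts as well, and faithfulness of k makes the two lifts mutually
  inverse.\<close>

lemma kernel_cell_lift_invertible:
  assumes "kernel_of f k p" "u \<in> Mor L" "v \<in> Mor L" "Dom L u = Dom L v" "Cod L u = Dom L k" "Cod L v = Dom L k"
    "Src L x = k \<odot> u" "Trg L x = k \<odot> v"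
    "riso (pres_right p u) (pres_right p v) (f \<rhd> x)" "invertible x"
  obtains y where "invertible y" "Src L y = u" "Trg L y = v" "k \<rhd> y = x"
proof -
  note k = kernelD[OF assms(1)]
  note r = risoD[OF assms(9)]
  have r3: "rnull (pres_right p v) (pres_right p u) (f \<rhd> cinv L x)" using r(3) k assms by simp
  obtain y where y: "y \<in> Cell L" "Src L y = u" "Trg L y = v" "k \<rhd> y = x"
    by (rule kernel_cell_lift[OF assms(1-6) _ assms(7,8) r(2)]) (use assms in simp_all)
  obtain z where z: "z \<in> Cell L" "Src L z = v" "Trg L z = u" "k \<rhd> z = cinv L x"
    by (rule kernel_cell_lift[OF assms(1,3,2) _ assms(6,5) _ _ _ r3]) (use assms in simp_all)
  have "z \<bullet> y = Id2 L u"
    by (rule kernel_faithful[OF assms(1)]) (use y z assms k in simp_all)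
  moreover have "y \<bullet> z = Id2 L v"
    by (rule kernel_faithful[OF assms(1)]) (use y z assms k in simp_all)
  ultimately have "inverse_cells L y z" using y z by (simp add: inverse_cells_def cells_iff)
  then have "invertible y" by (rule invertibleI)
  then show ?thesis using y that by blast
qed

text \<open>Whiskering r with u shows that p and q induce the same null structure on every f k u, so
  both test conditions are unchanged.\<close>

lemma kernel_transport:
  assumes k: "kernel_of f k p" and r: "riso p q (Id2 L (f \<odot> k))"
  shows "kernel_of f k q"
proof (rule kernelI)
  note kd = kernelD[OF k]
  note rd = risoD[OF r]
  show "f \<in> Mor L" "k \<in> Mor L" "Cod L k = Dom L f" "pres q" "Src L q = f \<odot> k" using kd rd by simp_all
  have w: "riso (pres_right p u) (pres_right q u) (Id2 L (f \<odot> k \<odot> u))"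
    if "u \<in> Mor L" "Cod L u = Dom L k" for u
    using riso_pres_right[OF r, of u] kd that by simp
  fix z s
  assume *: "z \<in> Mor L" "Cod L z = Dom L f" "pres s" "Src L s = f \<odot> z"
  from kernel_lift[OF k *] obtain u x where u: "u \<in> Mor L" "Dom L u = Dom L z" "Cod L u = Dom L k" "invertible x" "Src L x = z"
    "Trg L x = k \<odot> u" "riso s (pres_right p u) (f \<rhd> x)" .
  have "riso s (pres_right q u) (f \<rhd> x)"
    using riso_VComp[OF u(7) w[OF u(1,3)]] u kd * by simp
  then show "\<exists>u x. u \<in> Mor L \<and> Dom L u = Dom L z \<and> Cod L u = Dom L k \<and> invertible x \<and> Src L x = z \<and>
           Trg L x = k \<odot> u \<and> riso s (pres_right q u) (f \<rhd> x)" using u by blast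
next
  note kd = kernelD[OF k]
  fix u v x
  assume *: "u \<in> Mor L" "v \<in> Mor L" "Dom L u = Dom L v" "Cod L u = Dom L k" "Cod L v = Dom L k"
        "x \<in> Cell L" "Src L x = k \<odot> u" "Trg L x = k \<odot> v"
        "rnull (pres_right q u) (pres_right q v) (f \<rhd> x)"
  have w: "riso (pres_right p u) (pres_right q u) (Id2 L (f \<odot> k \<odot> u))"
    if "u \<in> Mor L" "Cod L u = Dom L k" for u
    using riso_pres_right[OF r, of u] kd that by simp
  have "rnull (pres_right p u) (pres_right p v) (f \<rhd> x)"
    using rnull_VComp[OF rnull_VComp[OF risoD(2)[OF w[OF *(1,4)]] *(9)] risoD(3)[OF w[OF *(2,5)]]] kd * by simp
  then show "\<exists>y. y \<in> Cell L \<and> Src L y = u \<and> Trg L y = v \<and> k \<rhd> y = x"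
    using kernel_cell_lift[OF k *(1-8)] by blast
qed (rule kernel_faithful[OF k])

lemma kernel_iso:
  assumes k: "kernel_of f k p" and t: "invertible t" "Src L t = k" "Trg L t = k'"
  shows "kernel_of f k' (p \<bullet> (f \<rhd> cinv L t))"
proof -
  note kd = kernelD[OF k]
  have kt: "k' \<in> Mor L" "Dom L k' = Dom L k" "Cod L k' = Cod L k" using t Dom_Cod_of_cell[of t k k'] by auto
  have w: "riso (pres_right p u) (pres_right (p \<bullet> (f \<rhd> cinv L t)) u) (f \<rhd> (t \<lhd> u))"
    if "u \<in> Mor L" "Cod L u = Dom L k" for u
    using riso_cinv[OF riso_transport[of "pres_right p u" "f \<rhd> (cinv L t \<lhd> u)"]] kd kt t that by simp
  show ?thesis
  proof (rule kernelI)
    show "f \<in> Mor L" "k' \<in> Mor L" "Cod L k' = Dom L f" "pres (p \<bullet> (f \<rhd> cinv L t))"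
      "Src L (p \<bullet> (f \<rhd> cinv L t)) = f \<odot> k'" using kd kt t by simp_all
    fix z s
    assume *: "z \<in> Mor L" "Cod L z = Dom L f" "pres s" "Src L s = f \<odot> z"
    from kernel_lift[OF k *] obtain u x where u: "u \<in> Mor L" "Dom L u = Dom L z" "Cod L u = Dom L k" "invertible x" "Src L x = z"
      "Trg L x = k \<odot> u" "riso s (pres_right p u) (f \<rhd> x)" .
    have "riso s (pres_right (p \<bullet> (f \<rhd> cinv L t)) u) (f \<rhd> ((t \<lhd> u) \<bullet> x))"
      using riso_VComp[OF u(7) w[OF u(1,3)]] u kd kt t * by simp
    then show "\<exists>u x. u \<in> Mor L \<and> Dom L u = Dom L z \<and> Cod L u = Dom L k' \<and> invertible x \<and> Src L x = z \<and>
           Trg L x = k' \<odot> u \<and> riso s (pres_right (p \<bullet> (f \<rhd> cinv L t)) u) (f \<rhd> x)"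
      using u kd kt t by (intro exI[of _ u] exI[of _ "(t \<lhd> u) \<bullet> x"]) simp
  next
    fix u v x
    assume *: "u \<in> Mor L" "v \<in> Mor L" "Dom L u = Dom L v" "Cod L u = Dom L k'" "Cod L v = Dom L k'"
        "x \<in> Cell L" "Src L x = k' \<odot> u" "Trg L x = k' \<odot> v"
        "rnull (pres_right (p \<bullet> (f \<rhd> cinv L t)) u) (pres_right (p \<bullet> (f \<rhd> cinv L t)) v) (f \<rhd> x)"
    have wu: "riso (pres_right p u) (pres_right (p \<bullet> (f \<rhd> cinv L t)) u) (f \<rhd> (t \<lhd> u))"
      and wv: "riso (pres_right p v) (pres_right (p \<bullet> (f \<rhd> cinv L t)) v) (f \<rhd> (t \<lhd> v))"
      using w * kt by simp_all
    \<comment> \<open>The test 2-cell for k' conjugated with t into one for k; interchange of t with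
      the lift then returns to k'.\<close>
    let ?x = "(cinv L t \<lhd> v) \<bullet> x \<bullet> (t \<lhd> u)"
    have r: "rnull (pres_right p u) (pres_right p v) (f \<rhd> ?x)"
      using rnull_VComp[OF rnull_VComp[OF risoD(2)[OF wu] *(9)] risoD(3)[OF wv]] kd kt t * by simp
    obtain y where y: "y \<in> Cell L" "Src L y = u" "Trg L y = v" "k \<rhd> y = ?x"
      by (rule kernel_cell_lift[OF k _ _ _ _ _ _ _ _ r]) (use * kd kt t in simp_all)
    have e: "(t \<lhd> v) \<bullet> (k \<rhd> y) = (k' \<rhd> y) \<bullet> (t \<lhd> u)"
      by (rule whisker_exchange) (use * kd kt t y in simp_all)
    have "k' \<rhd> y = x"
      by (rule VComp_right_cancel[of "t \<lhd> u"]) (use e[symmetric] * kd kt t y in simp_all)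
    then show "\<exists>y. y \<in> Cell L \<and> Src L y = u \<and> Trg L y = v \<and> k' \<rhd> y = x" using y by blast
  next
    fix x y
    assume *: "x \<in> Cell L" "y \<in> Cell L" "Cod L (Src L x) = Dom L k'" "Src L x = Src L y"
        "Trg L x = Trg L y" "k' \<rhd> x = k' \<rhd> y"
    have e: "(t \<lhd> Trg L z) \<bullet> (k \<rhd> z) = (k' \<rhd> z) \<bullet> (t \<lhd> Src L z)" if "z \<in> Cell L" "Cod L (Src L z) = Dom L k'" for z
      by (rule whisker_exchange) (use * kd kt t that in simp_all)
    have "(t \<lhd> Trg L x) \<bullet> (k \<rhd> x) = (t \<lhd> Trg L x) \<bullet> (k \<rhd> y)" using e[of x] e[of y] * by simp
    then have "k \<rhd> x = k \<rhd> y"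
      using VComp_left_cancel[of "t \<lhd> Trg L x" "k \<rhd> x" "k \<rhd> y"] * kd kt t by simp
    then show "x = y" using kernel_faithful[OF k, of x y] * kt by simp
  qed
qed

text \<open>A lift u through k becomes the lift j u through k i, corrected by the inverse of
  \<epsilon>. Lifted 2-cells descend along i because i is full and faithful.\<close>

lemma kernel_equivalence:
  assumes k: "kernel_of f k p" and i: "equivalence L i" "Cod L i = Dom L k"
  shows "kernel_of f (k \<odot> i) (pres_right p i)"
proof -
  note kd = kernelD[OF k]
  from i(1) obtain j \<eta> \<epsilon> where e: "i \<in> Mor L" "j \<in> Mor L" "Dom L j = Cod L i" "Cod L j = Dom L i"
    "invertible \<eta>" "Src L \<eta> = Id1 L (Dom L i)" "Trg L \<eta> = j \<odot> i"
    "invertible \<epsilon>" "Src L \<epsilon> = i \<odot> j" "Trg L \<epsilon> = Id1 L (Cod L i)" by (rule equivalenceE)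
  have w: "riso (pres_right p (i \<odot> u)) (pres_right (pres_right p i) u) (Id2 L (f \<odot> k \<odot> i \<odot> u))"
    if "u \<in> Mor L" "Cod L u = Dom L i" for u
    using riso_right_right[of p i u] kd e i that by simp
  show ?thesis
  proof (rule kernelI)
    show "f \<in> Mor L" "k \<odot> i \<in> Mor L" "Cod L (k \<odot> i) = Dom L f" "pres (pres_right p i)"
      "Src L (pres_right p i) = f \<odot> k \<odot> i" using kd e i by simp_all
    fix z s
    assume *: "z \<in> Mor L" "Cod L z = Dom L f" "pres s" "Src L s = f \<odot> z"
    from kernel_lift[OF k *] obtain u x where u: "u \<in> Mor L" "Dom L u = Dom L z" "Cod L u = Dom L k" "invertible x" "Src L x = z"
      "Trg L x = k \<odot> u" "riso s (pres_right p u) (f \<rhd> x)" .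
    have "riso (pres_right p u) (pres_right p (i \<odot> j \<odot> u)) ((f \<odot> k) \<rhd> (cinv L \<epsilon> \<lhd> u))"
      using riso_right_cell[of p "cinv L \<epsilon> \<lhd> u" u "i \<odot> j \<odot> u"] kd e i u by simp
    from riso_VComp[OF riso_VComp[OF u(7) this] w[of "j \<odot> u"]]
    have "riso s (pres_right (pres_right p i) (j \<odot> u)) (f \<rhd> ((k \<rhd> (cinv L \<epsilon> \<lhd> u)) \<bullet> x))"
      using u kd e i * by simp
    then show "\<exists>u x. u \<in> Mor L \<and> Dom L u = Dom L z \<and> Cod L u = Dom L (k \<odot> i) \<and> invertible x \<and> Src L x = z \<and>
           Trg L x = (k \<odot> i) \<odot> u \<and> riso s (pres_right (pres_right p i) u) (f \<rhd> x)"
      using u kd e i by (intro exI[of _ "j \<odot> u"] exI[of _ "(k \<rhd> (cinv L \<epsilon> \<lhd> u)) \<bullet> x"]) simp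
  next
    fix u v x
    assume *: "u \<in> Mor L" "v \<in> Mor L" "Dom L u = Dom L v" "Cod L u = Dom L (k \<odot> i)" "Cod L v = Dom L (k \<odot> i)"
        "x \<in> Cell L" "Src L x = (k \<odot> i) \<odot> u" "Trg L x = (k \<odot> i) \<odot> v"
        "rnull (pres_right (pres_right p i) u) (pres_right (pres_right p i) v) (f \<rhd> x)"
    have wu: "riso (pres_right p (i \<odot> u)) (pres_right (pres_right p i) u) (Id2 L (f \<odot> k \<odot> i \<odot> u))"
      and wv: "riso (pres_right p (i \<odot> v)) (pres_right (pres_right p i) v) (Id2 L (f \<odot> k \<odot> i \<odot> v))"
      using w * kd e i by simp_all
    have r: "rnull (pres_right p (i \<odot> u)) (pres_right p (i \<odot> v)) (f \<rhd> x)"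
      using rnull_VComp[OF rnull_VComp[OF risoD(2)[OF wu] *(9)] risoD(3)[OF wv]] kd e i * by simp
    obtain y where y: "y \<in> Cell L" "Src L y = i \<odot> u" "Trg L y = i \<odot> v" "k \<rhd> y = x"
      by (rule kernel_cell_lift[OF k _ _ _ _ _ _ _ _ r]) (use * kd e i in simp_all)
    obtain z where z: "z \<in> Cell L" "Src L z = u" "Trg L z = v" "i \<rhd> z = y"
      by (rule equivalence_full[OF i(1), of u v y]) (use * kd e i y in simp_all)
    have "(k \<odot> i) \<rhd> z = k \<rhd> (i \<rhd> z)" using z(1-3) * kd e i by simp
    then have "(k \<odot> i) \<rhd> z = x" using y z by simp
    then show "\<exists>y. y \<in> Cell L \<and> Src L y = u \<and> Trg L y = v \<and> (k \<odot> i) \<rhd> y = x" using z by blast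
  next
    fix x y
    assume *: "x \<in> Cell L" "y \<in> Cell L" "Cod L (Src L x) = Dom L (k \<odot> i)" "Src L x = Src L y"
        "Trg L x = Trg L y" "(k \<odot> i) \<rhd> x = (k \<odot> i) \<rhd> y"
    have "k \<rhd> (i \<rhd> x) = (k \<odot> i) \<rhd> x" "k \<rhd> (i \<rhd> y) = (k \<odot> i) \<rhd> y" using *(1-5) kd e i by simp_all
    then have kk: "k \<rhd> (i \<rhd> x) = k \<rhd> (i \<rhd> y)" using *(6) by simp
    have "i \<rhd> x = i \<rhd> y"
      by (rule kernel_faithful[OF k _ _ _ _ _ kk]) (use *(1-5) kd e i in simp_all)
    then show "x = y" using equivalence_faithful[OF i(1), of x y] * kd e i by simp
  qed
qed

end

section \<open>Duality between kernels and cokernels\<close>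

context ideal_data
begin

lemma op_ideal_simps [simp]:
  shows "null (op2 L) (op_ideal N) = null L N" "null_cell (op2 L) (op_ideal N) = null_cell L N"
    "null_iso (op2 L) (op_ideal N) = null_iso L N"
    "nu (op2 L) (op_ideal N) b n a = nu L N a n b"
    "ideal_data.lnu (op2 L) (op_ideal N) b n = rnu n b" "ideal_data.rnu (op2 L) (op_ideal N) n a = lnu a n"
    "ideal_data.pres (op2 L) (op_ideal N) = pres"
    "ideal_data.pres_left (op2 L) (op_ideal N) b p = pres_right p b"
    "ideal_data.pres_right (op2 L) (op_ideal N) p a = pres_left a p"
    "ideal_data.rnull (op2 L) (op_ideal N) = rnull" "ideal_data.riso (op2 L) (op_ideal N) = riso"
    "op_ideal (op_ideal N) = N"
proof -
  interpret op: ideal_data "op2 L" "op_ideal N" .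
  show n: "null (op2 L) (op_ideal N) = null L N" by (auto simp: null_def op_ideal_def fun_eq_iff)
  show c: "null_cell (op2 L) (op_ideal N) = null_cell L N" by (auto simp: null_cell_def op_ideal_def fun_eq_iff)
  show "null_iso (op2 L) (op_ideal N) = null_iso L N" by (auto simp: null_iso_def c fun_eq_iff)
  show nu: "nu (op2 L) (op_ideal N) b n a = nu L N a n b" for b n a
    by (simp add: nu_def null_name_def op_ideal_def)
  show l: "op.lnu b n = rnu n b" for b n by (simp add: op.lnu_def rnu_def nu)
  show r: "op.rnu n a = lnu a n" for n a by (simp add: lnu_def op.rnu_def nu)
  show p: "op.pres = pres" by (simp add: op.pres_def pres_def n fun_eq_iff)
  show "op.pres_left b p = pres_right p b" "op.pres_right p a = pres_left a p"
    by (simp_all add: op.pres_left_def pres_left_def op.pres_right_def pres_right_def l r)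
  show rn: "op.rnull = rnull" by (simp add: op.rnull_def rnull_def c p fun_eq_iff)
  show "op.riso = riso" by (simp add: op.riso_def riso_def rn fun_eq_iff)
  show "op_ideal (op_ideal N) = N" by (auto simp: op_ideal_def intro!: ideal.equality pfun.equality ptrans.equality ext)
qed

lemma kernel_of_op2 [simp]:
  "ideal_data.kernel_of (op2 L) (op_ideal N) = cokernel_of" "ideal_data.cokernel_of (op2 L) (op_ideal N) = kernel_of"
  by (simp_all add: ideal_data.kernel_of_def ideal_data.cokernel_of_def is_cokernel_def fun_eq_iff)

end

context null_ideal
begin

text \<open>The assumptions of the locale come in left and right versions, and duality permutes
  them.\<close>

lemma null_ideal_op2: "null_ideal (op2 L) (op_ideal N)"
proof -
  interpret op: two_category "op2 L" by (rule two_category_op2)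
  show ?thesis
    by (unfold_locales, unfold op2_simps op2_derived op_ideal_simps)
      (use lnu rnu lnu_natural rnu_natural lnu_cell rnu_cell rnu_right lnu_left rnu_lnu lnu_rnu in
        \<open>simp_all add: null_cell_null null_cell_Id2 null_cell_VComp lnu_Id1 rnu_Id1\<close>)
qed

lemmas dual_simps = op2_simps op2_derived op_ideal_simps kernel_of_op2
lemmas cokernelD = null_ideal.kernelD[OF null_ideal_op2, unfolded dual_simps]
lemmas cokernel_lift = null_ideal.kernel_lift[OF null_ideal_op2, unfolded dual_simps]
lemmas cokernel_cell_lift = null_ideal.kernel_cell_lift[OF null_ideal_op2, unfolded dual_simps]
lemmas cokernel_faithful = null_ideal.kernel_faithful[OF null_ideal_op2, unfolded dual_simps]
lemmas cokernel_iso = null_ideal.kernel_iso[OF null_ideal_op2, unfolded dual_simps]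
lemmas cokernel_equivalence =
  null_ideal.kernel_equivalence[OF null_ideal_op2, unfolded dual_simps equivalence_op2]

lemma kernel_ofI: "is_kernel L N f k n p \<Longrightarrow> kernel_of f k p"
proof -
  assume k: "is_kernel L N f k n p"
  then have "n = Trg L p" unfolding is_kernel_def iso_cells_iff by blast
  with k show ?thesis by (simp add: kernel_of_def)
qed

lemma cokernel_ofI: "is_cokernel L N g e n p \<Longrightarrow> cokernel_of g e p"
  using null_ideal.kernel_ofI[OF null_ideal_op2, of g e n p] by (simp add: is_cokernel_def)

lemma kernels_iff: "k \<in> kernels L N \<longleftrightarrow> (\<exists>f p. kernel_of f k p)"
  unfolding kernels_def using kernel_ofI unfolding kernel_of_def by blast

lemma cokernels_iff: "e \<in> cokernels L N \<longleftrightarrow> (\<exists>g p. cokernel_of g e p)"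
  unfolding cokernels_def using cokernel_ofI
  unfolding cokernel_of_def by blast

lemma weakly_reflects:
  assumes k: "kernel_of f k p" and w: "weakly_reflects_null L N f k (Trg L p) p"
    and s: "s \<in> Mor L" "Cod L s = Dom L k" and d: "pres d" "Src L d = k \<odot> s"
    and r: "riso (pres_left f d) (pres_right p s) (Id2 L (f \<odot> k \<odot> s))"
  obtains q where "pres q" "Src L q = s" "riso d (pres_left k q) (Id2 L (k \<odot> s))"
proof -
  note kd = kernelD[OF k]
  have t: "Dom L (Trg L d) = Dom L s" "Cod L (Trg L d) = Cod L k" "Dom L (Trg L p) = Dom L k" "Cod L (Trg L p) = Cod L f"
    using kd d s by simp_all
  have "pres_right p s \<bullet> cinv L (pres_left f d) =
      rnu (Trg L p) s \<bullet> (p \<lhd> s) \<bullet> (f \<rhd> cinv L d) \<bullet> cinv L (lnu f (Trg L d))"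
    using kd s d by (simp add: pres_right_def pres_left_def)
  moreover have "null_iso L N (pres_right p s \<bullet> cinv L (pres_left f d))"
    by (rule iffD1[OF riso_Id2_iff r]) (use kd s d in simp_all)
  ultimately have "null_iso L N (nu_right L N (Trg L p) s \<bullet> (p \<lhd> s) \<bullet> (f \<rhd> cinv L d) \<bullet> cinv L (nu_left L N f (Trg L d)))"
    by (simp only: lnu_def rnu_def)
  moreover have "s \<in> hom L (Dom L s) (Dom L k)" "null L N (Trg L d)" "Trg L d \<in> hom L (Dom L s) (Cod L k)"
    "d \<in> iso_cells L (k \<odot> s) (Trg L d)"
    using s d t by (simp_all add: hom_iff iso_cells_iff)
  ultimately obtain s' q where q: "null L N s'" "s' \<in> hom L (Dom L s) (Dom L k)" "q \<in> iso_cells L s s'"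
    "null_iso L N (nu_left L N k s' \<bullet> (k \<rhd> q) \<bullet> cinv L d)"
    using w unfolding weakly_reflects_null_def by blast
  have q': "pres q" "Src L q = s" "Trg L q = s'" using q presI[of q] by (simp_all add: iso_cells_iff)
  have "null_iso L N (pres_left k q \<bullet> cinv L d)"
    using q(1,2,4) q' kd s d unfolding lnu_def[symmetric] by (simp add: pres_left_def hom_iff)
  then have "riso d (pres_left k q) (Id2 L (k \<odot> s))"
    by (rule iffD2[OF riso_Id2_iff, rotated 4]) (use q' kd s d in simp_all)
  with q' show ?thesis using that by blast
qed

text \<open>Reflection is stated for 2-cells between null 1-cells. It is applied to the conjugate ?m
  of x, which runs between the targets of p and q.\<close>

lemma reflects_cells:
  assumes w: "reflects_null_cells L N k" and k: "k \<in> Mor L"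
    and p: "pres p" "Cod L (Src L p) = Dom L k" and q: "pres q"
    and x: "x \<in> Cell L" "Src L x = Src L p" "Trg L x = Src L q"
    and r: "rnull (pres_left k p) (pres_left k q) (k \<rhd> x)"
  shows "rnull p q x"
proof -
  let ?m = "q \<bullet> x \<bullet> cinv L p"
  have c: "Dom L (Src L q) = Dom L (Src L p)" "Cod L (Src L q) = Dom L k"
    using x p Cell_simps[of x] by simp_all
  have "pres_left k q \<bullet> (k \<rhd> x) \<bullet> cinv L (pres_left k p) =
      lnu k (Trg L q) \<bullet> (k \<rhd> ?m) \<bullet> cinv L (lnu k (Trg L p))"
    using k p q x c by (simp add: pres_left_def)
  moreover have "null_cell L N (pres_left k q \<bullet> (k \<rhd> x) \<bullet> cinv L (pres_left k p))"
    using rnullD(6)[OF r] .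
  ultimately have "null_cell L N (nu_left L N k (Trg L q) \<bullet> (k \<rhd> ?m) \<bullet> cinv L (nu_left L N k (Trg L p)))"
    by (simp only: lnu_def)
  moreover have "Trg L p \<in> hom L (Dom L (Src L p)) (Dom L k)" "Trg L q \<in> hom L (Dom L (Src L p)) (Dom L k)"
    "null L N (Trg L p)" "null L N (Trg L q)" "?m \<in> cells L (Trg L p) (Trg L q)"
    using p q x c by (simp_all add: hom_iff cells_iff)
  ultimately have "null_cell L N ?m" using w unfolding reflects_null_cells_def by blast
  then show ?thesis using p q x by (simp add: rnull_def)
qed

end

section \<open>Kernels and cokernels in the weakly exact situation\<close>

locale exact_ideal = null_ideal L N
  for L :: "('o, 'm, 'c) two_cat" (structure) and N :: "('o, 'm, 'c) ideal" +
  assumes has_kernels: "has_kernels L N" and has_cokernels: "has_cokernels L N"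
    and kernels_reflect: "kernels_reflect L N" and cokernels_reflect: "kernels_reflect (op2 L) (op_ideal N)"
    and kernels_normal: "kernels_normal L N" and cokernels_normal: "kernels_normal (op2 L) (op_ideal N)"
begin

lemma exact_ideal_op2: "exact_ideal (op2 L) (op_ideal N)"
proof -
  interpret op: null_ideal "op2 L" "op_ideal N" by (rule null_ideal_op2)
  show ?thesis
    by unfold_locales (use has_kernels has_cokernels kernels_reflect cokernels_reflect kernels_normal cokernels_normal in
      \<open>simp_all add: has_kernels_def has_cokernels_def is_cokernel_def\<close>)
qed

lemma kernel_exists: "f \<in> Mor L \<Longrightarrow> \<exists>k p. kernel_of f k p"
  using has_kernels kernel_ofI unfolding has_kernels_def by blast

lemma kernel_weakly_reflects:
  assumes "kernel_of f k p" "s \<in> Mor L" "Cod L s = Dom L k" "pres d" "Src L d = k \<odot> s"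
    "riso (pres_left f d) (pres_right p s) (Id2 L (f \<odot> k \<odot> s))"
  obtains q where "pres q" "Src L q = s" "riso d (pres_left k q) (Id2 L (k \<odot> s))"
  by (rule weakly_reflects[OF assms(1) _ assms(2-)])
    (use assms(1) kernels_reflect in \<open>auto simp: kernels_reflect_def kernel_of_def\<close>)

lemma kernel_reflects_cells:
  assumes "kernel_of f k p'" "pres p" "Cod L (Src L p) = Dom L k" "pres q"
    "x \<in> Cell L" "Src L x = Src L p" "Trg L x = Src L q"
    "rnull (pres_left k p) (pres_left k q) (k \<rhd> x)"
  shows "rnull p q x"
  by (rule reflects_cells[OF _ kernelD(2)[OF assms(1)] assms(2-)])
    (use assms(1) kernels_reflect in \<open>auto simp: kernels_reflect_def kernel_of_def\<close>)

text \<open>Exactness gives the structure 2-cell \<open>t \<bullet> p\<close> with t an invertible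
  null 2-cell. Relative to \<open>t \<bullet> p\<close> and p the identity is \<open>riso\<close>,
  so the kernel property passes to p itself.\<close>

lemma kernel_of_cokernel:
  assumes "kernel_of f m p'" "cokernel_of m c p"
  shows "kernel_of c m p"
proof -
  have "m \<in> kernels L N" using assms(1) kernels_iff by blast
  moreover have "is_cokernel L N m c (Trg L p) p"
    using assms(2) by (simp add: cokernel_of_def)
  ultimately obtain n' t where t: "null_iso L N t" "t \<in> cells L (Trg L p) n'" "is_kernel L N c m n' (t \<bullet> p)"
    using kernels_normal unfolding kernels_normal_def by blast
  have k: "kernel_of c m (t \<bullet> p)" using t(3) by (rule kernel_ofI)
  note c = cokernelD[OF assms(2)]
  note ti = null_isoD[OF t(1)]
  have tt: "Src L t = Trg L p" using t(2) by (simp add: cells_iff)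
  have "riso (t \<bullet> p) p (Id2 L (c \<odot> m))"
  proof -
    have "rnull (t \<bullet> p) p (Id2 L (c \<odot> m))" "rnull p (t \<bullet> p) (Id2 L (c \<odot> m))"
      using c ti tt kernelD[OF k] by (simp_all add: rnull_def)
    then show ?thesis using c by (simp add: riso_def)
  qed
  then show ?thesis by (rule kernel_transport[OF k])
qed

lemmas cokernel_exists = exact_ideal.kernel_exists[OF exact_ideal_op2, unfolded dual_simps]
lemmas cokernel_weakly_coreflects = exact_ideal.kernel_weakly_reflects[OF exact_ideal_op2, unfolded dual_simps]
lemmas cokernel_coreflects_cells = exact_ideal.kernel_reflects_cells[OF exact_ideal_op2, unfolded dual_simps]
lemmas cokernel_of_kernel = exact_ideal.kernel_of_cokernel[OF exact_ideal_op2, unfolded dual_simps]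

end

section \<open>The pseudo arrow 2-category\<close>

lemma full_sub_simps [simp]:
  "Obj (full_sub L S) = Obj L \<inter> S" "Mor (full_sub L S) = {f \<in> Mor L. Dom L f \<in> S \<and> Cod L f \<in> S}"
  "Cell (full_sub L S) = {x \<in> Cell L. Dom L (Src L x) \<in> S \<and> Cod L (Src L x) \<in> S}"
  "Dom (full_sub L S) = Dom L" "Cod (full_sub L S) = Cod L" "Src (full_sub L S) = Src L"
  "Trg (full_sub L S) = Trg L" "Id1 (full_sub L S) = Id1 L" "Comp (full_sub L S) = Comp L"
  "Id2 (full_sub L S) = Id2 L" "VComp (full_sub L S) = VComp L" "HComp (full_sub L S) = HComp L"
  by (simp_all add: full_sub_def)

context two_category
begin

abbreviation "Ar \<equiv> pseudo_arrow L"

lemma Ar_simps [simp]: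
  "Obj Ar = Mor L" "Dom Ar = sq_dom" "Cod Ar = sq_cod" "Src Ar = sc_src" "Trg Ar = sc_trg"
  "Id1 Ar f = Square f f (Id1 L (Dom L f)) (Id1 L (Cod L f)) (Id2 L f)"
  "Comp Ar = square_comp L"
  "Id2 Ar q = SquareCell q q (Id2 L (sq_top q)) (Id2 L (sq_bot q))"
  "VComp Ar y x = SquareCell (sc_src x) (sc_trg y) (sc_top y \<bullet> sc_top x) (sc_bot y \<bullet> sc_bot x)"
  "HComp Ar y x = SquareCell (square_comp L (sc_src y) (sc_src x)) (square_comp L (sc_trg y) (sc_trg x))
         (sc_top y \<star> sc_top x) (sc_bot y \<star> sc_bot x)"
  by (simp_all add: pseudo_arrow_def Let_def)

lemma square_comp_simps [simp]:
  "sq_dom (square_comp L q p) = sq_dom p" "sq_cod (square_comp L q p) = sq_cod q"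
  "sq_top (square_comp L q p) = sq_top q \<odot> sq_top p" "sq_bot (square_comp L q p) = sq_bot q \<odot> sq_bot p"
  "sq_fill (square_comp L q p) = (sq_bot q \<rhd> sq_fill p) \<bullet> (sq_fill q \<lhd> sq_top p)"
  by (simp_all add: square_comp_def)

lemma Ar_Mor:
  "q \<in> Mor Ar \<longleftrightarrow> sq_dom q \<in> Mor L \<and> sq_cod q \<in> Mor L \<and>
     sq_top q \<in> Mor L \<and> Dom L (sq_top q) = Dom L (sq_dom q) \<and> Cod L (sq_top q) = Dom L (sq_cod q) \<and>
     sq_bot q \<in> Mor L \<and> Dom L (sq_bot q) = Cod L (sq_dom q) \<and> Cod L (sq_bot q) = Cod L (sq_cod q) \<and>
     invertible (sq_fill q) \<and> Src L (sq_fill q) = sq_cod q \<odot> sq_top q \<and> Trg L (sq_fill q) = sq_bot q \<odot> sq_dom q"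
  by (simp add: pseudo_arrow_def Let_def is_square_def hom_iff iso_cells_iff)

lemma Ar_MorD [simp]:
  assumes "q \<in> Mor Ar"
  shows "sq_dom q \<in> Mor L" "sq_cod q \<in> Mor L"
     "sq_top q \<in> Mor L" "Dom L (sq_top q) = Dom L (sq_dom q)" "Cod L (sq_top q) = Dom L (sq_cod q)"
     "sq_bot q \<in> Mor L" "Dom L (sq_bot q) = Cod L (sq_dom q)" "Cod L (sq_bot q) = Cod L (sq_cod q)"
     "invertible (sq_fill q)" "Src L (sq_fill q) = sq_cod q \<odot> sq_top q" "Trg L (sq_fill q) = sq_bot q \<odot> sq_dom q"
  using assms unfolding Ar_Mor by blast+

lemma Ar_Cell:
  "x \<in> Cell Ar \<longleftrightarrow> sc_src x \<in> Mor Ar \<and> sc_trg x \<in> Mor Ar \<and>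
     sq_dom (sc_trg x) = sq_dom (sc_src x) \<and> sq_cod (sc_trg x) = sq_cod (sc_src x) \<and>
     sc_top x \<in> Cell L \<and> Src L (sc_top x) = sq_top (sc_src x) \<and> Trg L (sc_top x) = sq_top (sc_trg x) \<and>
     sc_bot x \<in> Cell L \<and> Src L (sc_bot x) = sq_bot (sc_src x) \<and> Trg L (sc_bot x) = sq_bot (sc_trg x) \<and>
     sq_fill (sc_trg x) \<bullet> (sq_cod (sc_src x) \<rhd> sc_top x) = (sc_bot x \<lhd> sq_dom (sc_src x)) \<bullet> sq_fill (sc_src x)"
  by (auto simp add: pseudo_arrow_def Let_def cells_iff)

lemma Ar_CellD [simp]:
  assumes "x \<in> Cell Ar"
  shows "sc_src x \<in> Mor Ar" "sc_trg x \<in> Mor Ar"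
     "sq_dom (sc_trg x) = sq_dom (sc_src x)" "sq_cod (sc_trg x) = sq_cod (sc_src x)"
     "sc_top x \<in> Cell L" "Src L (sc_top x) = sq_top (sc_src x)" "Trg L (sc_top x) = sq_top (sc_trg x)"
     "sc_bot x \<in> Cell L" "Src L (sc_bot x) = sq_bot (sc_src x)" "Trg L (sc_bot x) = sq_bot (sc_trg x)"
  using assms unfolding Ar_Cell by blast+

lemma Ar_Cell_compatible:
  "x \<in> Cell Ar \<Longrightarrow>
    sq_fill (sc_trg x) \<bullet> (sq_cod (sc_src x) \<rhd> sc_top x) = (sc_bot x \<lhd> sq_dom (sc_src x)) \<bullet> sq_fill (sc_src x)"
  unfolding Ar_Cell by blast

lemma Ar_Id1: "f \<in> Mor L \<Longrightarrow> Id1 Ar f \<in> Mor Ar"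
  by (simp add: Ar_Mor)

lemma Ar_Comp: "p \<in> Mor Ar \<Longrightarrow> q \<in> Mor Ar \<Longrightarrow> sq_dom q = sq_cod p \<Longrightarrow> square_comp L q p \<in> Mor Ar"
  by (simp add: Ar_Mor[of "square_comp L q p"])

lemma Ar_Id2: "q \<in> Mor Ar \<Longrightarrow> Id2 Ar q \<in> Cell Ar"
  by (simp add: Ar_Cell)

lemma Ar_VComp:
  assumes "x \<in> Cell Ar" "y \<in> Cell Ar" "sc_src y = sc_trg x"
  shows "VComp Ar y x \<in> Cell Ar"
proof -
  note x = Ar_Cell_compatible[OF assms(1)] and y = Ar_Cell_compatible[OF assms(2)]
  let ?e = "sq_dom (sc_src x)" and ?m = "sq_cod (sc_src x)"
  have "sq_fill (sc_trg y) \<bullet> (?m \<rhd> (sc_top y \<bullet> sc_top x)) =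
      (sq_fill (sc_trg y) \<bullet> (?m \<rhd> sc_top y)) \<bullet> (?m \<rhd> sc_top x)" using assms by simp
  also have "sq_fill (sc_trg y) \<bullet> (?m \<rhd> sc_top y) = (sc_bot y \<lhd> ?e) \<bullet> sq_fill (sc_trg x)"
    using y assms by simp
  also have "((sc_bot y \<lhd> ?e) \<bullet> sq_fill (sc_trg x)) \<bullet> (?m \<rhd> sc_top x) =
      (sc_bot y \<lhd> ?e) \<bullet> (sq_fill (sc_trg x) \<bullet> (?m \<rhd> sc_top x))" using assms by simp
  also have "\<dots> = ((sc_bot y \<bullet> sc_bot x) \<lhd> ?e) \<bullet> sq_fill (sc_src x)" unfolding x using assms by simp
  finally have c: "sq_fill (sc_trg y) \<bullet> (?m \<rhd> (sc_top y \<bullet> sc_top x)) =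
      ((sc_bot y \<bullet> sc_bot x) \<lhd> ?e) \<bullet> sq_fill (sc_src x)" .
  show ?thesis unfolding Ar_Cell[of "VComp Ar y x"] using c assms by simp
qed

text \<open>The two compatibility squares are pasted: y is moved through the filling of q,
  interchange moves the top of x past that filling, and then x is moved through the filling of
  p.\<close>

lemma Ar_HComp:
  assumes "x \<in> Cell Ar" "y \<in> Cell Ar" "sq_dom (sc_src y) = sq_cod (sc_src x)"
  shows "HComp Ar y x \<in> Cell Ar"
proof -
  define p p' q q' where d: "p = sc_src x" "p' = sc_trg x" "q = sc_src y" "q' = sc_trg y"
  define e m n where e: "e = sq_dom p" "m = sq_cod p" "n = sq_cod q"
  define xt xb yt yb where t: "xt = sc_top x" "xb = sc_bot x" "yt = sc_top y" "yb = sc_bot y"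
  have M: "p \<in> Mor Ar" "p' \<in> Mor Ar" "q \<in> Mor Ar" "q' \<in> Mor Ar" using assms d by simp_all
  have E: "sq_dom p = e" "sq_cod p = m" "sq_dom p' = e" "sq_cod p' = m" "sq_dom q = m" "sq_cod q = n" "sq_dom q' = m" "sq_cod q' = n"
    using assms by (simp_all add: d e)
  have T: "xt \<in> Cell L" "Src L xt = sq_top p" "Trg L xt = sq_top p'" "xb \<in> Cell L" "Src L xb = sq_bot p" "Trg L xb = sq_bot p'"
    "yt \<in> Cell L" "Src L yt = sq_top q" "Trg L yt = sq_top q'" "yb \<in> Cell L" "Src L yb = sq_bot q" "Trg L yb = sq_bot q'"
    using assms by (simp_all add: d t)
  have O: "e \<in> Mor L" "m \<in> Mor L" "n \<in> Mor L" using M E by force+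
  have D: "Dom L (sq_top p) = Dom L e" "Cod L (sq_top p) = Dom L m" "Dom L (sq_bot p) = Cod L e" "Cod L (sq_bot p) = Cod L m"
   "Dom L (sq_top p') = Dom L e" "Cod L (sq_top p') = Dom L m" "Dom L (sq_bot p') = Cod L e" "Cod L (sq_bot p') = Cod L m"
   "Dom L (sq_top q) = Dom L m" "Cod L (sq_top q) = Dom L n" "Dom L (sq_bot q) = Cod L m" "Cod L (sq_bot q) = Cod L n"
   "Dom L (sq_top q') = Dom L m" "Cod L (sq_top q') = Dom L n" "Dom L (sq_bot q') = Cod L m" "Cod L (sq_bot q') = Cod L n"
    "Src L (sq_fill p) = m \<odot> sq_top p" "Trg L (sq_fill p) = sq_bot p \<odot> e"
    "Src L (sq_fill p') = m \<odot> sq_top p'" "Trg L (sq_fill p') = sq_bot p' \<odot> e"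
    "Src L (sq_fill q) = n \<odot> sq_top q" "Trg L (sq_fill q) = sq_bot q \<odot> m"
    "Src L (sq_fill q') = n \<odot> sq_top q'" "Trg L (sq_fill q') = sq_bot q' \<odot> m"
    using M E by simp_all
  note ty = M(1-4) O T D
  have x: "sq_fill p' \<bullet> (m \<rhd> xt) = (xb \<lhd> e) \<bullet> sq_fill p" using Ar_Cell_compatible[OF assms(1)] by (simp add: d e t)
  have y: "sq_fill q' \<bullet> (n \<rhd> yt) = (yb \<lhd> m) \<bullet> sq_fill q" using Ar_Cell_compatible[OF assms(2)] assms(3) by (simp add: d e t)
  \<comment> \<open>Both horizontal composites are expanded with the x factor first, so that top and
    bottom are resolved in the same order.\<close>
  have h: "yt \<star> xt = (yt \<lhd> sq_top p') \<bullet> (sq_top q \<rhd> xt)" "yb \<star> xb = (yb \<lhd> sq_bot p') \<bullet> (sq_bot q \<rhd> xb)"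
    using HComp_as_VComp(2)[of xt yt] HComp_as_VComp(2)[of xb yb] ty by simp_all
  have e1: "(sq_fill q \<lhd> sq_top p') \<bullet> ((n \<odot> sq_top q) \<rhd> xt) = ((sq_bot q \<odot> m) \<rhd> xt) \<bullet> (sq_fill q \<lhd> sq_top p)"
    by (rule whisker_exchange) (use ty in simp_all)
  have e2: "(yb \<lhd> (sq_bot p' \<odot> e)) \<bullet> (sq_bot q \<rhd> sq_fill p') \<bullet> z = (sq_bot q' \<rhd> sq_fill p') \<bullet> (yb \<lhd> (m \<odot> sq_top p')) \<bullet> z"
    if "z \<in> Cell L" "Trg L z = sq_bot q \<odot> m \<odot> sq_top p'" for z
    by (rule whisker_exchange_assoc) (use ty that in simp_all)
  have "((sq_bot q' \<rhd> sq_fill p') \<bullet> (sq_fill q' \<lhd> sq_top p')) \<bullet> (n \<rhd> (yt \<star> xt)) =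
      (sq_bot q' \<rhd> sq_fill p') \<bullet> ((sq_fill q' \<bullet> (n \<rhd> yt)) \<lhd> sq_top p') \<bullet> ((n \<odot> sq_top q) \<rhd> xt)"
    unfolding h using ty by simp
  also have "\<dots> = (sq_bot q' \<rhd> sq_fill p') \<bullet> (yb \<lhd> (m \<odot> sq_top p')) \<bullet> ((sq_fill q \<lhd> sq_top p') \<bullet> ((n \<odot> sq_top q) \<rhd> xt))"
    unfolding y using ty by simp
  also have "\<dots> = (yb \<lhd> (sq_bot p' \<odot> e)) \<bullet> (sq_bot q \<rhd> sq_fill p') \<bullet> ((sq_bot q \<odot> m) \<rhd> xt) \<bullet> (sq_fill q \<lhd> sq_top p)"
    unfolding e1 by (rule e2[symmetric]) (use ty in simp_all)
  also have "\<dots> = (yb \<lhd> (sq_bot p' \<odot> e)) \<bullet> (sq_bot q \<rhd> (sq_fill p' \<bullet> (m \<rhd> xt))) \<bullet> (sq_fill q \<lhd> sq_top p)"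
    using ty by simp
  also have "\<dots> = ((yb \<star> xb) \<lhd> e) \<bullet> (sq_bot q \<rhd> sq_fill p) \<bullet> (sq_fill q \<lhd> sq_top p)"
    unfolding x h using ty by simp
  finally have c: "((sq_bot q' \<rhd> sq_fill p') \<bullet> (sq_fill q' \<lhd> sq_top p')) \<bullet> (n \<rhd> (yt \<star> xt)) =
     ((yb \<star> xb) \<lhd> e) \<bullet> (sq_bot q \<rhd> sq_fill p) \<bullet> (sq_fill q \<lhd> sq_top p)" .
  show ?thesis unfolding Ar_Cell[of "HComp Ar y x"]
    using c[unfolded t d e] Ar_Comp assms by simp
qed

text \<open>Strict, because iterated whiskerings and vertical composites in L have a common normal
  form.\<close>

lemma square_comp_assoc:
  assumes "p \<in> Mor Ar" "q \<in> Mor Ar" "r \<in> Mor Ar" "sq_dom q = sq_cod p" "sq_dom r = sq_cod q"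
  shows "square_comp L (square_comp L r q) p = square_comp L r (square_comp L q p)"
  by (rule square.expand) (use assms in simp)

lemma square_comp_Id1:
  "p \<in> Mor Ar \<Longrightarrow> sq_dom p = f \<Longrightarrow> square_comp L p (Id1 Ar f) = p"
  "p \<in> Mor Ar \<Longrightarrow> sq_cod p = f \<Longrightarrow> square_comp L (Id1 Ar f) p = p"
  by (rule square.expand; force)+

lemma two_category_pseudo_arrow: "two_category Ar"
  by unfold_locales
    (auto simp: hom_def cells_def interchange' square_comp_assoc Ar_Comp Ar_Id1[unfolded Ar_simps] Ar_Id2[unfolded Ar_simps]
      Ar_VComp[unfolded Ar_simps] Ar_HComp[unfolded Ar_simps] square_comp_Id1[unfolded Ar_simps]
      intro!: square_cell.expand)

lemma two_category_full_sub: "two_category (full_sub L S)"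
  by unfold_locales (auto simp: hom_def cells_def interchange')

end

section \<open>Orthogonality and matched squares\<close>

context two_category
begin

lemma is_squareD:
  assumes "is_square L e m s t \<phi>"
  shows "s \<in> Mor L" "t \<in> Mor L" "Dom L s = Dom L e" "Cod L s = Dom L m" "Dom L t = Cod L e" "Cod L t = Cod L m"
      "invertible \<phi>" "Src L \<phi> = m \<odot> s" "Trg L \<phi> = t \<odot> e"
  using assms by (simp_all add: is_square_def hom_iff iso_cells_iff)

lemma fillsD:
  assumes "fills L e m s t \<phi> d \<sigma> \<rho>"
  shows "d \<in> Mor L" "Dom L d = Cod L e" "Cod L d = Dom L m" "invertible \<sigma>" "Src L \<sigma> = s" "Trg L \<sigma> = d \<odot> e"
    "invertible \<rho>" "Src L \<rho> = m \<odot> d" "Trg L \<rho> = t" "\<phi> = (\<rho> \<lhd> e) \<bullet> (m \<rhd> \<sigma>)"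
  using assms by (simp_all add: fills_def hom_iff iso_cells_iff)

end

section \<open>Diagonal fillers\<close>

context exact_ideal
begin

lemma diagonal_exists:
  assumes k: "kernel_of f m p" and c: "cokernel_of g e q"
    and sq: "is_square L e m s t \<phi>"
    and r: "riso (pres_right p (s \<odot> g)) (pres_left (f \<odot> t) q) (f \<rhd> (\<phi> \<lhd> g))"
  shows "\<exists>d \<sigma> \<rho>. fills L e m s t \<phi> d \<sigma> \<rho>"
proof -
  note kd = kernelD[OF k] and cd = cokernelD[OF c]
  note t = is_squareD[OF sq]
  let ?c = "pres_right p s \<bullet> (f \<rhd> cinv L \<phi>)"
  have cp: "pres ?c" "Src L ?c = (f \<odot> t) \<odot> e" using kd cd t by simp_all
  have 1: "riso (pres_right ?c g) (pres_right (pres_right p s) g) (f \<rhd> (cinv L \<phi> \<lhd> g))"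
    using riso_transport[of "pres_right (pres_right p s) g" "f \<rhd> (cinv L \<phi> \<lhd> g)"] kd cd t by simp
  have 2: "riso (pres_right (pres_right p s) g) (pres_right p (s \<odot> g)) (Id2 L (f \<odot> m \<odot> s \<odot> g))"
    using riso_cinv[OF riso_right_right[of p s g]] kd cd t by simp
  \<comment> \<open>The relative condition r, reread: whiskered with g, the presentation ?c of f t e
    agrees with the one that q induces. This is the premise for weak coreflection along e.\<close>
  have 3: "riso (pres_right ?c g) (pres_left (f \<odot> t) q) (Id2 L (((f \<odot> t) \<odot> e) \<odot> g))"
    using riso_VComp[OF riso_VComp[OF 1 2] r] kd cd t by simp
  obtain h where h: "pres h" "Src L h = f \<odot> t" "riso ?c (pres_right h e) (Id2 L ((f \<odot> t) \<odot> e))"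
    by (rule cokernel_weakly_coreflects[OF c _ _ cp 3]) (use kd cd t in simp_all)
  \<comment> \<open>Since h presents f t, the kernel property of m applies to t; d is the diagonal
    and the inverse of x will be \<rho>.\<close>
  obtain d x where d: "d \<in> Mor L" "Dom L d = Dom L t" "Cod L d = Dom L m" "invertible x" "Src L x = t"
    "Trg L x = m \<odot> d" "riso h (pres_right p d) (f \<rhd> x)"
    by (rule kernel_lift[OF k _ _ h(1,2)]) (use kd cd t in simp_all)
  have 4: "riso (pres_right p s) ?c (f \<rhd> \<phi>)"
    using riso_cinv[OF riso_transport[of "pres_right p s" "f \<rhd> cinv L \<phi>"]] kd cd t by simp
  have 5: "riso (pres_right h e) (pres_right (pres_right p d) e) ((f \<rhd> x) \<lhd> e)"
    by (rule riso_pres_right[OF d(7)]) (use kd cd t h d in simp_all)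
  have 6: "riso (pres_right (pres_right p d) e) (pres_right p (d \<odot> e)) (Id2 L (f \<odot> m \<odot> d \<odot> e))"
    using riso_cinv[OF riso_right_right[of p d e]] kd cd t d by simp
  \<comment> \<open>The compatibility of h with ?c, whiskered and rebracketed, makes this 2-cell
    liftable through m; its lift is \<sigma>.\<close>
  have 7: "riso (pres_right p s) (pres_right p (d \<odot> e)) (f \<rhd> ((x \<lhd> e) \<bullet> \<phi>))"
    using riso_VComp[OF riso_VComp[OF riso_VComp[OF 4 h(3)] 5] 6] kd cd t d by simp
  obtain y where y: "invertible y" "Src L y = s" "Trg L y = d \<odot> e" "m \<rhd> y = (x \<lhd> e) \<bullet> \<phi>"
    by (rule kernel_cell_lift_invertible[OF k _ _ _ _ _ _ _ 7]) (use kd cd t d in simp_all)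
  have "\<phi> = (cinv L x \<lhd> e) \<bullet> (m \<rhd> y)" unfolding y(4) using kd cd t d by simp
  then have "fills L e m s t \<phi> d y (cinv L x)" using y d t by (simp add: fills_def hom_iff iso_cells_iff)
  then show ?thesis by blast
qed

lemma diagonal_cell:
  assumes k: "kernel_of f m p" and c: "cokernel_of g e q"
    and sq: "is_square L e m s t \<phi>" "fills L e m s t \<phi> d \<sigma> \<rho>"
    and sq': "is_square L e m s' t' \<phi>'" "fills L e m s' t' \<phi>' d' \<sigma>' \<rho>'"
    and lr: "l \<in> cells L s s'" "r \<in> cells L t t'" "\<phi>' \<bullet> (m \<rhd> l) = (r \<lhd> e) \<bullet> \<phi>"
  shows "\<exists>!y. y \<in> cells L d d' \<and> \<rho>' \<bullet> (m \<rhd> y) = r \<bullet> \<rho> \<and> (y \<lhd> e) \<bullet> \<sigma> = \<sigma>' \<bullet> l"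
proof -
  note kd = kernelD[OF k] and cd = cokernelD[OF c]
  note t = is_squareD(1-6)[OF sq(1)] and t' = is_squareD(1-6)[OF sq'(1)]
  note d = fillsD[OF sq(2)] and d' = fillsD[OF sq'(2)]
  have l: "l \<in> Cell L" "Src L l = s" "Trg L l = s'" "r \<in> Cell L" "Src L r = t" "Trg L r = t'"
    using lr by (simp_all add: cells_iff)
  note ty = kd cd t d(1-9) t' d'(1-9) l
  \<comment> \<open>The equation for \<rho> and \<rho>' forces \<open>m \<rhd> y = ?x\<close>; this
    alone determines y because m is faithful.\<close>
  let ?x = "cinv L \<rho>' \<bullet> r \<bullet> \<rho>"
  \<comment> \<open>Compatibility of l and r makes \<open>?x \<lhd> e\<close> equal to
    \<open>m \<rhd> ?t\<close>. After f the latter is a whiskering with the presented 1-cell f m,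
    hence null.\<close>
  let ?t = "\<sigma>' \<bullet> l \<bullet> cinv L \<sigma>"
  have eq: "(\<rho>' \<lhd> e) \<bullet> (m \<rhd> \<sigma>') \<bullet> (m \<rhd> l) = (r \<lhd> e) \<bullet> (\<rho> \<lhd> e) \<bullet> (m \<rhd> \<sigma>)"
    using lr(3) unfolding d(10) d'(10) using ty by simp
  have "?x \<lhd> e = (cinv L \<rho>' \<lhd> e) \<bullet> ((r \<lhd> e) \<bullet> (\<rho> \<lhd> e) \<bullet> (m \<rhd> \<sigma>)) \<bullet> (m \<rhd> cinv L \<sigma>)"
    using ty by simp
  also have "\<dots> = m \<rhd> ?t" unfolding eq[symmetric] using ty by simp
  finally have xe: "?x \<lhd> e = m \<rhd> ?t" .
  have "(f \<rhd> ?x) \<lhd> e = f \<rhd> (?x \<lhd> e)" using ty by simp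
  also have "\<dots> = (f \<odot> m) \<rhd> ?t" unfolding xe using ty by simp
  finally have fxe: "(f \<rhd> ?x) \<lhd> e = (f \<odot> m) \<rhd> ?t" .
  have 1: "riso (pres_right (pres_right p a) e) (pres_right p (a \<odot> e)) (Id2 L (f \<odot> m \<odot> a \<odot> e))"
    if "a \<in> Mor L" "Dom L a = Cod L e" "Cod L a = Dom L m" for a
    using riso_cinv[OF riso_right_right[of p a e]] kd cd that by simp
  have "rnull (pres_right p (d \<odot> e)) (pres_right p (d' \<odot> e)) (Src L p \<rhd> ?t)"
    by (rule rnull_right_cell) (use ty in simp_all)
  then have 2: "rnull (pres_right p (d \<odot> e)) (pres_right p (d' \<odot> e)) ((f \<rhd> ?x) \<lhd> e)"
    unfolding fxe using kd by simp
  have 3: "rnull (pres_right (pres_right p d) e) (pres_right (pres_right p d') e) ((f \<rhd> ?x) \<lhd> e)"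
    using rnull_VComp[OF rnull_VComp[OF risoD(2)[OF 1[OF d(1-3)]] 2] risoD(3)[OF 1[OF d'(1-3)]]] ty by simp
  \<comment> \<open>Nullness is known only after whiskering with e; coreflection of null 2-cells
    along e removes that whiskering.\<close>
  have 4: "rnull (pres_right p d) (pres_right p d') (f \<rhd> ?x)"
    by (rule cokernel_coreflects_cells[OF c _ _ _ _ _ _ 3]) (use ty in simp_all)
  obtain y where y: "y \<in> Cell L" "Src L y = d" "Trg L y = d'" "m \<rhd> y = ?x"
    by (rule kernel_cell_lift[OF k _ _ _ _ _ _ _ _ 4]) (use ty in simp_all)
  have y1: "\<rho>' \<bullet> (m \<rhd> y) = r \<bullet> \<rho>" unfolding y(4) using ty by simp
  have "m \<rhd> ((y \<lhd> e) \<bullet> \<sigma>) = ((m \<rhd> y) \<lhd> e) \<bullet> (m \<rhd> \<sigma>)" using ty y(1-3) by simp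
  also have "\<dots> = m \<rhd> (\<sigma>' \<bullet> l)" unfolding y(4) xe using ty by simp
  finally have y2': "m \<rhd> ((y \<lhd> e) \<bullet> \<sigma>) = m \<rhd> (\<sigma>' \<bullet> l)" .
  have y2: "(y \<lhd> e) \<bullet> \<sigma> = \<sigma>' \<bullet> l"
    by (rule kernel_faithful[OF k _ _ _ _ _ y2']) (use ty y(1-3) in simp_all)
  show ?thesis
  proof (rule ex1I[of _ y])
    show "y \<in> cells L d d' \<and> \<rho>' \<bullet> (m \<rhd> y) = r \<bullet> \<rho> \<and> (y \<lhd> e) \<bullet> \<sigma> = \<sigma>' \<bullet> l"
      using y y1 y2 by (simp add: cells_iff)
    fix z assume z: "z \<in> cells L d d' \<and> \<rho>' \<bullet> (m \<rhd> z) = r \<bullet> \<rho> \<and> (z \<lhd> e) \<bullet> \<sigma> = \<sigma>' \<bullet> l"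
    then have zc: "z \<in> Cell L" "Src L z = d" "Trg L z = d'" and zr: "\<rho>' \<bullet> (m \<rhd> z) = \<rho>' \<bullet> (m \<rhd> y)"
      unfolding y1 by (simp_all add: cells_iff)
    have mz: "m \<rhd> z = m \<rhd> y"
      by (rule VComp_left_cancel[OF _ _ _ _ _ zr]) (use ty y(1-3) zc in simp_all)
    show "z = y" by (rule kernel_faithful[OF k _ _ _ _ _ mz]) (use ty y(1-3) zc in simp_all)
  qed
qed

section \<open>Exact pairs and matched squares\<close>

definition exact_pair :: "'m \<Rightarrow> 'm \<Rightarrow> 'c \<Rightarrow> bool" where
  "exact_pair e m p \<longleftrightarrow> kernel_of e m p \<and> cokernel_of m e p"

text \<open>The last condition says that \<open>p'\<close> through \<open>g\<close> and \<open>p\<close> through \<open>f\<close> induce the same null structure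
  on \<open>sq_cod f \<odot> sq_top f \<odot> sq_dom g\<close>.\<close>

definition matched :: "'c \<Rightarrow> 'c \<Rightarrow> ('m, 'c) square \<Rightarrow> ('m, 'c) square \<Rightarrow> bool" where
  "matched p p' f g \<longleftrightarrow> f \<in> Mor Ar \<and> g \<in> Mor Ar \<and> sq_top f = sq_bot g \<and>
     exact_pair (sq_dom f) (sq_dom g) p \<and> exact_pair (sq_cod f) (sq_cod g) p' \<and>
     riso (pres_right p' (sq_top g)) (pres_left (sq_bot f) p)
       ((sq_fill f \<lhd> sq_dom g) \<bullet> (sq_cod f \<rhd> sq_fill g))"

lemma exact_pairD:
  assumes "exact_pair e m p"
  shows "e \<in> Mor L" "m \<in> Mor L" "Dom L e = Cod L m" "e \<in> cokernels L N" "m \<in> kernels L N"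
    "pres p" "Src L p = e \<odot> m" "kernel_of e m p" "cokernel_of m e p"
proof -
  show k: "kernel_of e m p" and c: "cokernel_of m e p" using assms by (simp_all add: exact_pair_def)
  show "e \<in> Mor L" "m \<in> Mor L" "Dom L e = Cod L m" "pres p" "Src L p = e \<odot> m" using kernelD[OF k] by simp_all
  show "e \<in> cokernels L N" "m \<in> kernels L N" using k c kernels_iff cokernels_iff by blast+
qed

text \<open>Take a kernel of e; by the dual of \<open>kernel_of_cokernel\<close>, e is a cokernel of
  it with the same structure 2-cell.\<close>

lemma exact_pair_of_cokernel: "e \<in> cokernels L N \<Longrightarrow> \<exists>m p. exact_pair e m p"
  using cokernels_iff kernel_exists cokernelD(2) cokernel_of_kernel unfolding exact_pair_def by metis

lemma exact_pair_of_kernel: "m \<in> kernels L N \<Longrightarrow> \<exists>e p. exact_pair e m p"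
  using kernels_iff cokernel_exists kernelD(2) kernel_of_cokernel unfolding exact_pair_def by metis

text \<open>Whiskering a presentation with an identity does not change it; this is
  \<open>lnu_Id1\<close> and \<open>rnu_Id1\<close>, which come from the normality of N.\<close>

lemma matched_Id1:
  assumes "exact_pair e m p"
  shows "matched p p (Id1 Ar e) (Id1 Ar m)"
proof -
  note d = exact_pairD[OF assms]
  have "riso p p (Id2 L (e \<odot> m))"
    using riso_transport[of p "Id2 L (e \<odot> m)"] d by simp
  then show ?thesis using d assms Ar_Id1[OF d(1)] Ar_Id1[OF d(2)]
    by (simp add: matched_def pres_left_Id1 pres_right_Id1)
qed

text \<open>The null structure given by p'' is carried through p' to p: split the whiskering by w'
  w, use M', exchange the two sides of p', use M, and merge the whiskerings by v and v'. Interchange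
  x identifies the composite 2-cell with the pasted fillings.\<close>

lemma matched_Comp:
  assumes M: "matched p p' f g" and M': "matched p' p'' f' g'" and eq: "sq_dom f' = sq_cod f" "sq_dom g' = sq_cod g"
  shows "matched p p'' (square_comp L f' f) (square_comp L g' g)"
proof -
  obtain e e' u v \<phi> where f: "f = Square e e' u v \<phi>" by (cases f)
  obtain m m' w \<psi> where g: "g = Square m m' w u \<psi>"
    using M by (cases g) (simp add: matched_def f)
  note Mt = M[unfolded matched_def Ar_Mor f g square.sel]
  have r: "riso (pres_right p' w) (pres_left v p) ((\<phi> \<lhd> m) \<bullet> (e' \<rhd> \<psi>))"
    using Mt by simp
  obtain a e'' u' v' \<phi>' where f': "f' = Square a e'' u' v' \<phi>'" by (cases f')
  obtain b m'' w' \<psi>' where g': "g' = Square b m'' w' u' \<psi>'"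
    using M' by (cases g') (simp add: matched_def f')
  note Mt' = M'[unfolded matched_def Ar_Mor f' g' square.sel]
  have r': "riso (pres_right p'' w') (pres_left v' p') ((\<phi>' \<lhd> b) \<bullet> (e'' \<rhd> \<psi>'))"
    using Mt' by simp
  have p: "exact_pair e m p" "exact_pair e' m' p'" and p': "exact_pair e'' m'' p''" using Mt Mt' by simp_all
  have ab: "a = e'" "b = m'" using eq by (simp_all add: f g f' g')
  note ty = exact_pairD(1-3,6,7)[OF p(1)] exact_pairD(1-3,6,7)[OF p(2)] exact_pairD(1-3,6,7)[OF p'] Mt Mt'[unfolded ab]
  have 1: "riso (pres_right p'' (w' \<odot> w)) (pres_right (pres_right p'' w') w) (Id2 L (e'' \<odot> m'' \<odot> w' \<odot> w))"
    using riso_right_right[of p'' w' w] ty by simp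
  have 2: "riso (pres_right (pres_right p'' w') w) (pres_right (pres_left v' p') w)
     (((\<phi>' \<lhd> m') \<bullet> (e'' \<rhd> \<psi>')) \<lhd> w)"
    by (rule riso_pres_right[OF r'[unfolded ab]]) (use ty in simp_all)
  have 3: "riso (pres_right (pres_left v' p') w) (pres_left v' (pres_right p' w)) (Id2 L (v' \<odot> e' \<odot> m' \<odot> w))"
    using riso_cinv[OF riso_left_right[of p' v' w]] ty by simp
  have 4: "riso (pres_left v' (pres_right p' w)) (pres_left v' (pres_left v p))
     (v' \<rhd> ((\<phi> \<lhd> m) \<bullet> (e' \<rhd> \<psi>)))"
    by (rule riso_pres_left[OF r]) (use ty in simp_all)
  have 5: "riso (pres_left v' (pres_left v p)) (pres_left (v' \<odot> v) p) (Id2 L (v' \<odot> v \<odot> e \<odot> m))"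
    using riso_cinv[OF riso_left_left[of p v v']] ty by simp
  have x: "(\<phi>' \<lhd> (u \<odot> m)) \<bullet> ((e'' \<odot> u') \<rhd> \<psi>) \<bullet> z = ((v' \<odot> e') \<rhd> \<psi>) \<bullet> (\<phi>' \<lhd> (m' \<odot> w)) \<bullet> z"
    if "z \<in> Cell L" "Trg L z = e'' \<odot> u' \<odot> m' \<odot> w" for z
    by (rule whisker_exchange_assoc) (use ty that in simp_all)
  have "riso (pres_right p'' (w' \<odot> w)) (pres_left (v' \<odot> v) p)
      ((((v' \<rhd> \<phi>) \<bullet> (\<phi>' \<lhd> u)) \<lhd> m) \<bullet> (e'' \<rhd> ((u' \<rhd> \<psi>) \<bullet> (\<psi>' \<lhd> w))))"
    using riso_VComp[OF riso_VComp[OF riso_VComp[OF riso_VComp[OF 1 2] 3] 4] 5] ty by (simp add: x)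
  moreover have "square_comp L f' f \<in> Mor Ar" "square_comp L g' g \<in> Mor Ar"
    using Ar_Comp M M' eq by (simp_all add: matched_def)
  ultimately show ?thesis using p p' by (simp add: matched_def f g f' g')
qed

lemma matched_ex_kernel_side:
  assumes f: "f \<in> Mor Ar" and p: "exact_pair (sq_dom f) m p" and p': "exact_pair (sq_cod f) m' p'"
  shows "\<exists>g. matched p p' f g \<and> sq_dom g = m \<and> sq_cod g = m'"
proof -
  obtain e e' u v \<phi> where ff: "f = Square e e' u v \<phi>" by (cases f)
  note t = f[unfolded Ar_Mor ff square.sel] and d = exact_pairD[OF p[unfolded ff square.sel]]
    and d' = exact_pairD[OF p'[unfolded ff square.sel]]
  \<comment> \<open>A presentation of e' u m obtained from p through \<phi>; lifting u m through the
    kernel m' along it yields w, and the inverse of x is the new filling.\<close>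
  let ?q = "pres_left v p \<bullet> (\<phi> \<lhd> m)"
  have q: "pres ?q" "Src L ?q = e' \<odot> (u \<odot> m)" using d d' t by simp_all
  obtain w x where w: "w \<in> Mor L" "Dom L w = Dom L (u \<odot> m)" "Cod L w = Dom L m'" "invertible x"
    "Src L x = u \<odot> m" "Trg L x = m' \<odot> w" "riso ?q (pres_right p' w) (e' \<rhd> x)"
    by (rule kernel_lift[OF d'(8) _ _ q]) (use t d d' in simp_all)
  have "riso ?q (pres_left v p) (\<phi> \<lhd> m)" by (rule riso_transport) (use t d d' in simp_all)
  from riso_VComp[OF riso_cinv[OF w(7)] this]
  have r: "riso (pres_right p' w) (pres_left v p) ((\<phi> \<lhd> m) \<bullet> (e' \<rhd> cinv L x))"
    using w t d d' by simp
  have "Square m m' w u (cinv L x) \<in> Mor Ar" unfolding Ar_Mor using w t d d' by simp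
  then have "matched p p' f (Square m m' w u (cinv L x))"
    using r f p p' by (simp add: matched_def ff)
  then show ?thesis by (intro exI[of _ "Square m m' w u (cinv L x)"]) simp
qed

lemma matched_ex_cokernel_side:
  assumes g: "g \<in> Mor Ar" and p: "exact_pair e (sq_dom g) p" and p': "exact_pair e' (sq_cod g) p'"
  shows "\<exists>f. matched p p' f g \<and> sq_dom f = e \<and> sq_cod f = e'"
proof -
  obtain m m' w u \<psi> where gg: "g = Square m m' w u \<psi>" by (cases g)
  note t = g[unfolded Ar_Mor gg square.sel] and d = exact_pairD[OF p[unfolded gg square.sel]]
    and d' = exact_pairD[OF p'[unfolded gg square.sel]]
  \<comment> \<open>Here e' u m is presented by p' through \<psi>, and the extension of e' u along
    the cokernel e yields v.\<close>
  let ?q = "pres_right p' w \<bullet> (e' \<rhd> cinv L \<psi>)"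
  have q: "pres ?q" "Src L ?q = (e' \<odot> u) \<odot> m" using d d' t by simp_all
  obtain v x where v: "v \<in> Mor L" "Cod L v = Cod L (e' \<odot> u)" "Dom L v = Cod L e" "invertible x"
    "Src L x = e' \<odot> u" "Trg L x = v \<odot> e" "riso ?q (pres_left v p) (x \<lhd> m)"
    by (rule cokernel_lift[OF d(9) _ _ q]) (use t d d' in simp_all)
  have "riso ?q (pres_right p' w) (e' \<rhd> cinv L \<psi>)" by (rule riso_transport) (use t d d' in simp_all)
  from riso_VComp[OF riso_cinv[OF this] v(7)]
  have r: "riso (pres_right p' w) (pres_left v p) ((x \<lhd> m) \<bullet> (e' \<rhd> \<psi>))" using t d d' by simp
  have "Square e e' u v x \<in> Mor Ar" unfolding Ar_Mor using v t d d' by simp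
  then have "matched p p' (Square e e' u v x) g"
    using r g p p' by (simp add: matched_def gg)
  then show ?thesis by (intro exI[of _ "Square e e' u v x"]) simp
qed

lemma matched_cell_kernel_side:
  assumes M: "matched p p' f g" and M1: "matched p p' f1 g1" and x: "x \<in> cells Ar f f1"
    and eq: "sq_dom g1 = sq_dom g" "sq_cod g1 = sq_cod g"
  shows "\<exists>y\<in>cells Ar g g1. sc_bot y = sc_top x"
proof -
  obtain e e' u v \<phi> where f: "f = Square e e' u v \<phi>" by (cases f)
  obtain m m' w \<psi> where g: "g = Square m m' w u \<psi>"
    using M by (cases g) (simp add: matched_def f)
  note Mt = M[unfolded matched_def Ar_Mor f g square.sel]
  have r: "riso (pres_right p' w) (pres_left v p) ((\<phi> \<lhd> m) \<bullet> (e' \<rhd> \<psi>))"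
    using Mt by simp
  obtain a a' u1 v1 \<phi>1 where f1: "f1 = Square a a' u1 v1 \<phi>1" by (cases f1)
  obtain b b' w1 \<psi>1 where g1: "g1 = Square b b' w1 u1 \<psi>1"
    using M1 by (cases g1) (simp add: matched_def f1)
  note M1t = M1[unfolded matched_def Ar_Mor f1 g1 square.sel]
  have r1: "riso (pres_right p' w1) (pres_left v1 p) ((\<phi>1 \<lhd> b) \<bullet> (a' \<rhd> \<psi>1))"
    using M1t by simp
  have p: "exact_pair e m p" "exact_pair e' m' p'" using Mt by simp_all
  note fg = f g f1 g1
  obtain l r' where xx: "x = SquareCell f f1 l r'" using x by (cases x) (simp add: cells_def)
  have xC: "x \<in> Cell Ar" using x by (simp add: cells_def)
  have ab: "a = e" "a' = e'" "b = m" "b' = m'" using Ar_CellD(3,4)[OF xC] eq by (simp_all add: fg xx)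
  have c: "l \<in> Cell L" "Src L l = u" "Trg L l = u1" "r' \<in> Cell L" "Src L r' = v" "Trg L r' = v1"
    using Ar_CellD(5-)[OF xC] by (simp_all add: fg xx)
  have cc: "\<phi>1 \<bullet> (e' \<rhd> l) = (r' \<lhd> e) \<bullet> \<phi>"
    using Ar_Cell_compatible[OF xC] by (simp add: fg xx)
  note d = exact_pairD[OF p(1)] and d' = exact_pairD[OF p(2)]
  note ty = d(1-3,6,7) d'(1-3,6,7) Mt M1t[unfolded ab] c
  \<comment> \<open>Compatibility with the fillings forces \<open>m' \<rhd> y = ?x\<close>.\<close>
  let ?x = "cinv L \<psi>1 \<bullet> (l \<lhd> m) \<bullet> \<psi>"
  have l: "e' \<rhd> l = cinv L \<phi>1 \<bullet> (r' \<lhd> e) \<bullet> \<phi>"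
    by (rule VComp_left_cancel[of \<phi>1]) (use ty cc in simp_all)
  have "e' \<rhd> (l \<lhd> m) = (e' \<rhd> l) \<lhd> m" using ty by simp
  also have "\<dots> = (cinv L \<phi>1 \<lhd> m) \<bullet> (r' \<lhd> (e \<odot> m)) \<bullet> (\<phi> \<lhd> m)" unfolding l using ty by simp
  finally have el: "e' \<rhd> (l \<lhd> m) = (cinv L \<phi>1 \<lhd> m) \<bullet> (r' \<lhd> (e \<odot> m)) \<bullet> (\<phi> \<lhd> m)" .
  \<comment> \<open>Up to the matched fillings, the whiskering of ?x with e' is r' whiskered with e
    m, which p presents; such a 2-cell is null.\<close>
  have "rnull (pres_left v p) (pres_left v1 p) (r' \<lhd> (e \<odot> m))"
    using rnull_left_cell[of p r' v v1] ty by simp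
  from rnull_VComp[OF rnull_VComp[OF risoD(2)[OF r] this] risoD(3)[OF r1[unfolded ab]]]
  have n: "rnull (pres_right p' w) (pres_right p' w1) (e' \<rhd> ?x)" using ty el by simp
  obtain y where y: "y \<in> Cell L" "Src L y = w" "Trg L y = w1" "m' \<rhd> y = ?x"
    by (rule kernel_cell_lift[OF d'(8) _ _ _ _ _ _ _ _ n]) (use ty in simp_all)
  have "\<psi>1 \<bullet> (m' \<rhd> y) = (l \<lhd> m) \<bullet> \<psi>" using y ty by simp
  then have "SquareCell g g1 y l \<in> Cell Ar"
    unfolding Ar_Cell using y c M M1 by (simp add: matched_def fg ab)
  then have "SquareCell g g1 y l \<in> cells Ar g g1" by (simp add: cells_def)
  then show ?thesis by (rule rev_bexI) (simp add: xx)
qed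

lemma matched_cell_cokernel_side:
  assumes M: "matched p p' f g" and M1: "matched p p' f1 g1" and y: "y \<in> cells Ar g g1"
    and eq: "sq_dom f1 = sq_dom f" "sq_cod f1 = sq_cod f"
  shows "\<exists>x\<in>cells Ar f f1. sc_top x = sc_bot y"
proof -
  obtain e e' u v \<phi> where f: "f = Square e e' u v \<phi>" by (cases f)
  obtain m m' w \<psi> where g: "g = Square m m' w u \<psi>"
    using M by (cases g) (simp add: matched_def f)
  note Mt = M[unfolded matched_def Ar_Mor f g square.sel]
  have r: "riso (pres_right p' w) (pres_left v p) ((\<phi> \<lhd> m) \<bullet> (e' \<rhd> \<psi>))"
    using Mt by simp
  obtain a a' u1 v1 \<phi>1 where f1: "f1 = Square a a' u1 v1 \<phi>1" by (cases f1)
  obtain b b' w1 \<psi>1 where g1: "g1 = Square b b' w1 u1 \<psi>1"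
    using M1 by (cases g1) (simp add: matched_def f1)
  note M1t = M1[unfolded matched_def Ar_Mor f1 g1 square.sel]
  have r1: "riso (pres_right p' w1) (pres_left v1 p) ((\<phi>1 \<lhd> b) \<bullet> (a' \<rhd> \<psi>1))"
    using M1t by simp
  have p: "exact_pair e m p" "exact_pair e' m' p'" using Mt by simp_all
  note fg = f g f1 g1
  obtain k l where yy: "y = SquareCell g g1 k l" using y by (cases y) (simp add: cells_def)
  have yC: "y \<in> Cell Ar" using y by (simp add: cells_def)
  have ab: "a = e" "a' = e'" "b = m" "b' = m'" using Ar_CellD(3,4)[OF yC] eq by (simp_all add: fg yy)
  have c: "k \<in> Cell L" "Src L k = w" "Trg L k = w1" "l \<in> Cell L" "Src L l = u" "Trg L l = u1"
    using Ar_CellD(5-)[OF yC] by (simp_all add: fg yy)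
  have cc: "\<psi>1 \<bullet> (m' \<rhd> k) = (l \<lhd> m) \<bullet> \<psi>"
    using Ar_Cell_compatible[OF yC] by (simp add: fg yy)
  note d = exact_pairD[OF p(1)] and d' = exact_pairD[OF p(2)]
  note ty = d(1-3,6,7) d'(1-3,6,7) Mt M1t[unfolded ab] c
  \<comment> \<open>Forced by compatibility. Whiskered with m, it becomes k whiskered with e' m' up
    to the matched fillings, and p' presents e' m'.\<close>
  let ?x = "\<phi>1 \<bullet> (e' \<rhd> l) \<bullet> cinv L \<phi>"
  have l: "l \<lhd> m = \<psi>1 \<bullet> (m' \<rhd> k) \<bullet> cinv L \<psi>"
    by (rule VComp_right_cancel[of \<psi>]) (use ty cc in simp_all)
  have el: "e' \<rhd> (l \<lhd> m) = (e' \<rhd> \<psi>1) \<bullet> ((e' \<odot> m') \<rhd> k) \<bullet> (e' \<rhd> cinv L \<psi>)"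
    unfolding l using ty by simp
  have "rnull (pres_right p' w) (pres_right p' w1) ((e' \<odot> m') \<rhd> k)"
    using rnull_right_cell[of p' k w w1] ty by simp
  from rnull_VComp[OF rnull_VComp[OF risoD(3)[OF r] this] risoD(2)[OF r1[unfolded ab]]]
  have n: "rnull (pres_left v p) (pres_left v1 p) (?x \<lhd> m)" using ty el by simp
  obtain x where x: "x \<in> Cell L" "Src L x = v" "Trg L x = v1" "x \<lhd> e = ?x"
    by (rule cokernel_cell_lift[OF d(9) _ _ _ _ _ _ _ _ n]) (use ty in simp_all)
  have "\<phi>1 \<bullet> (e' \<rhd> l) = (x \<lhd> e) \<bullet> \<phi>" using x ty by simp
  then have "SquareCell f f1 l x \<in> Cell Ar"
    unfolding Ar_Cell using x c M M1 by (simp add: matched_def fg ab)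
  then have "SquareCell f f1 l x \<in> cells Ar f f1" by (simp add: cells_def)
  then show ?thesis by (rule rev_bexI) (simp add: yy)
qed

end

section \<open>Unfolding the definition of a 2-ideal\<close>

lemma Cat_simps:
  "Obj Cat = Collect category" "Mor Cat = Collect is_functor" "Cell Cat = Collect is_nat"
  "Dom Cat = FDom" "Cod Cat = FCod" "Src Cat = NSrc" "Trg Cat = NTrg"
  "Comp Cat G F = \<lparr>FDom = FDom F, FCod = FCod G, FObj = restrict (\<lambda>a. FObj G (FObj F a)) (CObj (FDom F)),
        FArr = restrict (\<lambda>u. FArr G (FArr F u)) (CArr (FDom F))\<rparr>"
  "NComp (VComp Cat T S) = restrict (\<lambda>a. CComp (FCod (NSrc S)) (NComp T a) (NComp S a)) (CObj (FDom (NSrc S)))"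
  "NComp (HComp Cat T S) = restrict (\<lambda>a. CComp (FCod (NSrc T)) (NComp T (FObj (NTrg S) a))
                                   (FArr (NSrc T) (NComp S a))) (CObj (FDom (NSrc S)))"
  "Id1 Cat X = \<lparr>FDom = X, FCod = X, FObj = restrict (\<lambda>a. a) (CObj X), FArr = restrict (\<lambda>u. u) (CArr X)\<rparr>"
  "Id2 Cat F = \<lparr>NSrc = F, NTrg = F, NComp = restrict (\<lambda>a. CId (FCod F) (FObj F a)) (CObj (FDom F))\<rparr>"
  by (simp_all add: Cat_def)

lemma nat_component:
  assumes "T \<in> cells Cat S R" "n \<in> CObj (FDom S)"
  shows "NComp T n \<in> CArr (FCod S)" "CDom (FCod S) (NComp T n) = FObj S n" "CCod (FCod S) (NComp T n) = FObj R n"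
  using assms by (auto simp: cells_def Cat_simps is_nat_def Let_def)

lemma nat_functors:
  assumes "T \<in> cells Cat S R"
  shows "is_functor S" "is_functor R" "FDom R = FDom S" "FCod R = FCod S" "NSrc T = S" "NTrg T = R"
  using assms by (auto simp: cells_def Cat_simps is_nat_def Let_def)

lemma nat_natural:
  assumes "T \<in> cells Cat S R" "u \<in> CArr (FDom S)"
  shows "CComp (FCod S) (NComp T (CCod (FDom S) u)) (FArr S u) = CComp (FCod S) (FArr R u) (NComp T (CDom (FDom S) u))"
  using assms by (auto simp: cells_def Cat_simps is_nat_def Let_def)

lemma functorD:
  assumes "is_functor F"
  shows "category (FDom F)" "category (FCod F)" "a \<in> CObj (FDom F) \<Longrightarrow> FObj F a \<in> CObj (FCod F)"
    "u \<in> CArr (FDom F) \<Longrightarrow> FArr F u \<in> CArr (FCod F)"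
    "u \<in> CArr (FDom F) \<Longrightarrow> CDom (FCod F) (FArr F u) = FObj F (CDom (FDom F) u)"
    "u \<in> CArr (FDom F) \<Longrightarrow> CCod (FCod F) (FArr F u) = FObj F (CCod (FDom F) u)"
    "a \<in> CObj (FDom F) \<Longrightarrow> FArr F (CId (FDom F) a) = CId (FCod F) (FObj F a)"
    "u \<in> CArr (FDom F) \<Longrightarrow> v \<in> CArr (FDom F) \<Longrightarrow> CDom (FDom F) v = CCod (FDom F) u \<Longrightarrow>
        FArr F (CComp (FDom F) v u) = CComp (FCod F) (FArr F v) (FArr F u)"
  using assms unfolding is_functor_def by (auto dest: PiE_mem)

lemma nat_iso_component:
  assumes "T \<in> iso_cells Cat S R"
  obtains U where "U \<in> cells Cat R S"
    "\<And>n. n \<in> CObj (FDom S) \<Longrightarrow> CComp (FCod S) (NComp U n) (NComp T n) = CId (FCod S) (FObj S n)"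
    "\<And>n. n \<in> CObj (FDom S) \<Longrightarrow> CComp (FCod S) (NComp T n) (NComp U n) = CId (FCod S) (FObj R n)"
proof -
  from assms obtain U where T: "T \<in> cells Cat S R" and i: "inverse_cells Cat T U"
    by (auto simp: iso_cells_def)
  note t = nat_functors[OF T]
  have U: "U \<in> cells Cat R S" using i t by (simp add: inverse_cells_def Cat_simps)
  have e: "NComp (VComp Cat U T) = NComp (Id2 Cat S)" "NComp (VComp Cat T U) = NComp (Id2 Cat R)"
    using i t by (simp_all only: inverse_cells_def Cat_simps(6,7))
  note u = nat_functors[OF U]
  show ?thesis
  proof (rule that[OF U])
    fix n assume n: "n \<in> CObj (FDom S)"
    show "CComp (FCod S) (NComp U n) (NComp T n) = CId (FCod S) (FObj S n)"
      using fun_cong[OF e(1), of n] n t u(5,6) by (simp add: Cat_simps)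
    show "CComp (FCod S) (NComp T n) (NComp U n) = CId (FCod S) (FObj R n)"
      using fun_cong[OF e(2), of n] n t u(5,6) by (simp add: Cat_simps)
  qed
qed

text \<open>Whiskering in \<open>Cat\<close> is horizontal composition with an identity
  transformation; its component is again an identity after S and is deleted by the unit law.\<close>

lemma whisker_right_component:
  assumes "T \<in> cells Cat S R" "is_functor F" "FCod F = FDom S" "n \<in> CObj (FDom F)"
  shows "NComp (T \<lhd>\<^bsub>Cat\<^esub> F) n = NComp T (FObj F n)"
proof -
  have o: "FObj F n \<in> CObj (FDom S)" using functorD(3)[OF assms(2)] assms by auto
  note t = nat_functors[OF assms(1)] and c = nat_component[OF assms(1) o]
  have "CComp (FCod S) (NComp T (FObj F n)) (CId (FCod S) (FObj S (FObj F n))) = NComp T (FObj F n)"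
    using category.CComp_CId_right[OF functorD(2)[OF t(1)] c(1)] c(2) by simp
  then show ?thesis using assms o t functorD(7)[OF t(1) o] by (simp add: Cat_simps)
qed

lemma whisker_left_component:
  assumes "T \<in> cells Cat S R" "is_functor F" "FDom F = FCod S" "n \<in> CObj (FDom S)"
  shows "NComp (F \<rhd>\<^bsub>Cat\<^esub> T) n = FArr F (NComp T n)"
proof -
  note t = nat_functors[OF assms(1)] and c = nat_component[OF assms(1,4)]
  have o: "FObj R n \<in> CObj (FCod S)" using functorD(3)[OF t(2)] t assms by auto
  have a: "FArr F (NComp T n) \<in> CArr (FCod F)" "CCod (FCod F) (FArr F (NComp T n)) = FObj F (FObj R n)"
    using functorD(4,6)[OF assms(2)] c assms(3) by auto
  have "CComp (FCod F) (CId (FCod F) (FObj F (FObj R n))) (FArr F (NComp T n)) = FArr F (NComp T n)"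
    using category.CComp_CId_left[OF functorD(2)[OF assms(2)] a(1)] a(2) by simp
  then show ?thesis using assms o t by (simp add: Cat_simps)
qed

lemma hom_cat_simps [simp]:
  "CObj (hom_cat L A B) = hom L A B" "CArr (hom_cat L A B) = {x \<in> Cell L. Src L x \<in> hom L A B}"
  "CDom (hom_cat L A B) = Src L" "CCod (hom_cat L A B) = Trg L" "CId (hom_cat L A B) = Id2 L"
  "CComp (hom_cat L A B) = VComp L"
  by (simp_all add: hom_cat_def)

section \<open>Null 1-cells and 2-cells as images from N(A,B)\<close>

locale two_ideal_context = two_category L + ideal_data L N
  for L :: "('o, 'm, 'c) two_cat" (structure) and N :: "('o, 'm, 'c) ideal" +
  assumes two_ideal: "two_ideal L N"
begin

abbreviation "P \<equiv> prod2 (op2 L) L"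
abbreviation "H \<equiv> hom_pfun L"
text \<open>The category N(A,B), the component \<nu> from N(A,B) to Hom(A,B), the functor N(a,b),
  and the pseudonaturality constraint of \<nu> at (a,b), in this order.\<close>

abbreviation "cat A B \<equiv> PObj (IFun N) (A, B)"
abbreviation "inc A B \<equiv> TComp (INat N) (A, B)"
abbreviation "act a b \<equiv> PMor (IFun N) (a, b)"
abbreviation "str a b \<equiv> TCell (INat N) (a, b)"

sublocale T: pseudonatural P Cat "IFun N" H "INat N"
  using two_ideal by (simp add: two_ideal_def)

lemma P_hom: "a \<in> hom L A' A \<Longrightarrow> b \<in> hom L B B' \<Longrightarrow> (a, b) \<in> hom P (A, B) (A', B')"
  by (simp add: hom_def prod2_def)

lemma P_cells: "x \<in> cells L a a' \<Longrightarrow> y \<in> cells L b b' \<Longrightarrow> (x, y) \<in> cells P (a, b) (a', b')"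
  by (simp add: cells_def prod2_def)

lemma P_Obj: "A \<in> Obj L \<Longrightarrow> B \<in> Obj L \<Longrightarrow> (A, B) \<in> Obj P"
  by (simp add: prod2_def)

lemma H_simps:
  "PObj H (A, B) = hom_cat L A B"
  "PMor H (a, b) = sandwich_fun L (hom_cat L (Cod L a) (Dom L b)) (hom_cat L (Dom L a) (Cod L b)) a b"
  "PCell H (x, y) = sandwich_nat L (hom_cat L (Cod L (Src L x)) (Dom L (Src L y))) (hom_cat L (Dom L (Src L x)) (Cod L (Src L y))) x y"
  "PComp H g f = Id2 Cat (PMor H (Comp P g f))" "PUnit H Z = Id2 Cat (Id1 Cat (PObj H Z))"
  by (simp_all add: hom_pfun_def sandwich_pfun_def strict_pfun_def case_prod_unfold)

lemma inc_functor:
  assumes "A \<in> Obj L" "B \<in> Obj L"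
  shows "is_functor (inc A B)" "FDom (inc A B) = cat A B" "FCod (inc A B) = hom_cat L A B"
  using T.TComp_hom[OF P_Obj[OF assms]] by (simp_all add: hom_def Cat_simps H_simps)

lemma inc_simps:
  assumes "A \<in> Obj L" "B \<in> Obj L"
  shows "n \<in> CObj (cat A B) \<Longrightarrow> FObj (inc A B) n \<in> hom L A B"
    "x \<in> CArr (cat A B) \<Longrightarrow> FArr (inc A B) x \<in> Cell L \<and> Src L (FArr (inc A B) x) \<in> hom L A B \<and>
      Src L (FArr (inc A B) x) = FObj (inc A B) (CDom (cat A B) x) \<and>
      Trg L (FArr (inc A B) x) = FObj (inc A B) (CCod (cat A B) x)"
    "n \<in> CObj (cat A B) \<Longrightarrow> FArr (inc A B) (CId (cat A B) n) = Id2 L (FObj (inc A B) n)"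
    "x \<in> CArr (cat A B) \<Longrightarrow> y \<in> CArr (cat A B) \<Longrightarrow> CDom (cat A B) y = CCod (cat A B) x \<Longrightarrow>
      FArr (inc A B) (CComp (cat A B) y x) = FArr (inc A B) y \<bullet> FArr (inc A B) x"
    "category (cat A B)" "inj_on (FObj (inc A B)) (CObj (cat A B))"
proof -
  show "inj_on (FObj (inc A B)) (CObj (cat A B))" using two_ideal assms by (auto simp: two_ideal_def)
qed (use functorD[OF inc_functor(1)[OF assms], unfolded inc_functor(2,3)[OF assms] hom_cat_simps] in \<open>simp_all\<close>)

text \<open>Injectivity of \<nu> on objects makes the partial inverse in \<open>null_name\<close> a
  genuine inverse on the image.\<close>

lemma null_name:
  assumes "null L N n"
  shows "n \<in> Mor L" "null_name L N n \<in> CObj (cat (Dom L n) (Cod L n))"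
    "FObj (inc (Dom L n) (Cod L n)) (null_name L N n) = n"
proof -
  show n: "n \<in> Mor L" using assms by (simp add: null_def)
  then have j: "inj_on (FObj (inc (Dom L n) (Cod L n))) (CObj (cat (Dom L n) (Cod L n)))"
    by (intro inc_simps) simp_all
  have m: "n \<in> FObj (inc (Dom L n) (Cod L n)) ` CObj (cat (Dom L n) (Cod L n))"
    using assms by (simp add: null_def)
  show "null_name L N n \<in> CObj (cat (Dom L n) (Cod L n))"
    unfolding null_name_def by (rule the_inv_into_into[OF j m order_refl])
  show "FObj (inc (Dom L n) (Cod L n)) (null_name L N n) = n"
    unfolding null_name_def by (rule f_the_inv_into_f[OF j m])
qed

lemma null_inc:
  assumes "A \<in> Obj L" "B \<in> Obj L" "n \<in> CObj (cat A B)"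
  shows "null L N (FObj (inc A B) n)" "null_name L N (FObj (inc A B) n) = n"
proof -
  have "FObj (inc A B) n \<in> hom L A B" using inc_simps assms by blast
  then have h: "FObj (inc A B) n \<in> Mor L" "Dom L (FObj (inc A B) n) = A" "Cod L (FObj (inc A B) n) = B"
    by (simp_all add: hom_iff)
  show "null L N (FObj (inc A B) n)" using h assms by (simp add: null_def)
  show "null_name L N (FObj (inc A B) n) = n"
    using the_inv_into_f_f[OF inc_simps(6)] assms h by (simp add: null_name_def)
qed

lemma null_cell_inc:
  assumes "A \<in> Obj L" "B \<in> Obj L" "x \<in> CArr (cat A B)"
  shows "null_cell L N (FArr (inc A B) x)"
  using inc_simps(2)[OF assms] assms by (auto simp: null_cell_def hom_iff)

lemma null_cellE:
  assumes "null_cell L N x"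
  obtains A B y where "A \<in> Obj L" "B \<in> Obj L" "y \<in> CArr (cat A B)" "x = FArr (inc A B) y" "x \<in> Cell L"
    "Src L x \<in> hom L A B"
    "CDom (cat A B) y \<in> CObj (cat A B)" "CCod (cat A B) y \<in> CObj (cat A B)"
    "Src L x = FObj (inc A B) (CDom (cat A B) y)" "Trg L x = FObj (inc A B) (CCod (cat A B) y)"
proof -
  let ?A = "Dom L (Src L x)" and ?B = "Cod L (Src L x)"
  from assms obtain y where y: "x \<in> Cell L" "x = FArr (inc ?A ?B) y" "y \<in> CArr (cat ?A ?B)"
    by (auto simp: null_cell_def)
  have o: "?A \<in> Obj L" "?B \<in> Obj L" using y(1) by simp_all
  note i = inc_simps(2)[OF o y(3), folded y(2)]
  note c = category.CDom_CObj[OF inc_simps(5)[OF o] y(3)] category.CCod_CObj[OF inc_simps(5)[OF o] y(3)]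
  show ?thesis by (rule that[OF o y(3,2,1) _ c]) (use i in simp_all)
qed

lemma act_functor:
  assumes "a \<in> hom L A' A" "b \<in> hom L B B'"
  shows "is_functor (act a b)" "FDom (act a b) = cat A B" "FCod (act a b) = cat A' B'"
  using T.F.PMor_hom[OF P_hom[OF assms]] by (simp_all add: hom_def Cat_simps)

lemma sandwich:
  assumes "a \<in> hom L A' A" "b \<in> hom L B B'"
  shows "is_functor (PMor H (a, b))" "FDom (PMor H (a, b)) = hom_cat L A B" "FCod (PMor H (a, b)) = hom_cat L A' B'"
    "f \<in> hom L A B \<Longrightarrow> FObj (PMor H (a, b)) f = b \<odot> f \<odot> a"
    "x \<in> Cell L \<Longrightarrow> Src L x \<in> hom L A B \<Longrightarrow> FArr (PMor H (a, b)) x = b \<rhd> (x \<lhd> a)"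
  using T.G.PMor_hom[OF P_hom[OF assms]] assms
  by (auto simp: hom_def Cat_simps H_simps sandwich_fun_def)

lemma str_cells:
  assumes "a \<in> hom L A' A" "b \<in> hom L B B'"
  shows "str a b \<in> iso_cells Cat (Comp Cat (PMor H (a, b)) (inc A B)) (Comp Cat (inc A' B') (act a b))"
    "str a b \<in> cells Cat (Comp Cat (PMor H (a, b)) (inc A B)) (Comp Cat (inc A' B') (act a b))"
  using T.TCell_iso[OF P_hom[OF assms]] by (simp_all add: iso_cells_def)

lemma str_component:
  assumes a: "a \<in> hom L A' A" and b: "b \<in> hom L B B'" and n: "n \<in> CObj (cat A B)"
  shows "invertible (NComp (str a b) n)" "Src L (NComp (str a b) n) = b \<odot> FObj (inc A B) n \<odot> a"
    "Trg L (NComp (str a b) n) = FObj (inc A' B') (FObj (act a b) n)" "FObj (act a b) n \<in> CObj (cat A' B')"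
proof -
  have o: "A \<in> Obj L" "B \<in> Obj L" "A' \<in> Obj L" "B' \<in> Obj L" using a b by (auto simp: hom_iff)
  note i = inc_functor[OF o(1,2)] and i' = inc_functor[OF o(3,4)] and f = act_functor[OF a b] and s = sandwich[OF a b]
  let ?S = "Comp Cat (PMor H (a, b)) (inc A B)" and ?R = "Comp Cat (inc A' B') (act a b)"
  have S: "FDom ?S = cat A B" "FCod ?S = hom_cat L A' B'" "FObj ?S n = b \<odot> FObj (inc A B) n \<odot> a"
    "FObj ?R n = FObj (inc A' B') (FObj (act a b) n)"
    using n i f s(2,3) s(4)[OF inc_simps(1)[OF o(1,2) n]] by (simp_all add: Cat_simps)
  note c = nat_component[OF str_cells(2)[OF a b], unfolded S hom_cat_simps, OF n]
  show 1: "Src L (NComp (str a b) n) = b \<odot> FObj (inc A B) n \<odot> a"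
    and 2: "Trg L (NComp (str a b) n) = FObj (inc A' B') (FObj (act a b) n)"
    using c S by simp_all
  show "FObj (act a b) n \<in> CObj (cat A' B')" using functorD(3)[OF f(1)] f n by simp
  obtain U where U: "U \<in> cells Cat ?R ?S"
    "\<And>n. n \<in> CObj (FDom ?S) \<Longrightarrow> CComp (FCod ?S) (NComp U n) (NComp (str a b) n) = CId (FCod ?S) (FObj ?S n)"
    "\<And>n. n \<in> CObj (FDom ?S) \<Longrightarrow> CComp (FCod ?S) (NComp (str a b) n) (NComp U n) = CId (FCod ?S) (FObj ?R n)"
    using nat_iso_component[OF str_cells(1)[OF a b]] by blast
  have R: "FDom ?R = cat A B" "FCod ?R = hom_cat L A' B'" using f i' by (simp_all add: Cat_simps)
  note u = nat_component[OF U(1), unfolded R hom_cat_simps, OF n]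
  have "inverse_cells L (NComp (str a b) n) (NComp U n)"
    using c u U(2,3)[unfolded S(1,2) hom_cat_simps, OF n] S 1 2 by (simp add: inverse_cells_def cells_iff)
  then show "invertible (NComp (str a b) n)" by (rule invertibleI)
qed

text \<open>The last clause identifies the name of the target, which is what allows \<nu> to be
  iterated in \<open>nu_assoc\<close>.\<close>

lemma nu_component:
  assumes n: "null L N n" and a: "a \<in> Mor L" "Cod L a = Dom L n" and b: "b \<in> Mor L" "Dom L b = Cod L n"
  shows "invertible (nu L N b n a)" "Src L (nu L N b n a) = b \<odot> n \<odot> a" "null L N (Trg L (nu L N b n a))"
    "null_name L N (Trg L (nu L N b n a)) = FObj (act a b) (null_name L N n)"
proof -
  note m = null_name[OF n]
  have h: "a \<in> hom L (Dom L a) (Dom L n)" "b \<in> hom L (Cod L n) (Cod L b)" using a b by (simp_all add: hom_iff)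
  note s = str_component[OF h m(2)]
  show "invertible (nu L N b n a)" "Src L (nu L N b n a) = b \<odot> n \<odot> a"
    using s m by (simp_all add: nu_def)
  show "null L N (Trg L (nu L N b n a))"
    "null_name L N (Trg L (nu L N b n a)) = FObj (act a b) (null_name L N n)"
    using s null_inc[OF _ _ s(4)] a b by (simp_all add: nu_def)
qed

text \<open>Naturality of the single transformation \<open>str a b\<close> at the arrow y over x:
  the conjugate is the image of N(a,b)(y).\<close>

lemma nu_natural:
  assumes x: "null_cell L N x" and a: "a \<in> Mor L" "Cod L a = Dom L (Src L x)" and b: "b \<in> Mor L" "Dom L b = Cod L (Src L x)"
  shows "null_cell L N (nu L N b (Trg L x) a \<bullet> (b \<rhd> (x \<lhd> a)) \<bullet> cinv L (nu L N b (Src L x) a))"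
proof -
  obtain A B y where y: "A \<in> Obj L" "B \<in> Obj L" "y \<in> CArr (cat A B)" "x = FArr (inc A B) y" "x \<in> Cell L"
    "Src L x \<in> hom L A B"
    "CDom (cat A B) y \<in> CObj (cat A B)" "CCod (cat A B) y \<in> CObj (cat A B)"
    "Src L x = FObj (inc A B) (CDom (cat A B) y)" "Trg L x = FObj (inc A B) (CCod (cat A B) y)"
    using x by (rule null_cellE)
  have h: "a \<in> hom L (Dom L a) A" "b \<in> hom L B (Cod L b)" using a b y(6) by (simp_all add: hom_iff)
  have o: "Dom L a \<in> Obj L" "Cod L b \<in> Obj L" using a b by simp_all
  note i = inc_functor[OF y(1,2)] and i' = inc_functor[OF o] and f = act_functor[OF h] and s = sandwich[OF h]
  let ?S = "Comp Cat (PMor H (a, b)) (inc A B)" and ?R = "Comp Cat (inc (Dom L a) (Cod L b)) (act a b)"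
  have S: "FDom ?S = cat A B" "FCod ?S = hom_cat L (Dom L a) (Cod L b)" using i s(3) by (simp_all add: Cat_simps)
  have Sy: "FArr ?S y = b \<rhd> (x \<lhd> a)" "FArr ?R y = FArr (inc (Dom L a) (Cod L b)) (FArr (act a b) y)"
    using i f y(3,4) s(5)[OF y(5,6)] by (simp_all add: Cat_simps)
  have ay: "FArr (act a b) y \<in> CArr (cat (Dom L a) (Cod L b))" using functorD(4)[OF f(1)] f y by simp
  have t: "null_name L N (Trg L x) = CCod (cat A B) y" "null_name L N (Src L x) = CDom (cat A B) y"
    using null_inc(2)[OF y(1,2)] y by simp_all
  have e: "nu L N b (Trg L x) a \<bullet> (b \<rhd> (x \<lhd> a)) = FArr (inc (Dom L a) (Cod L b)) (FArr (act a b) y) \<bullet> nu L N b (Src L x) a"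
    using nat_natural[OF str_cells(2)[OF h], unfolded S hom_cat_simps, OF y(3)] Sy by (simp add: nu_def t)
  have ns: "null L N (Src L x)" "null L N (Trg L x)" using null_inc(1)[OF y(1,2)] y by simp_all
  have dx: "Dom L (Trg L x) = Dom L (Src L x)" "Cod L (Trg L x) = Cod L (Src L x)" using y(5) by simp_all
  note c = nu_component[OF ns(1) a b] and ct = nu_component[OF ns(2)]
  have w: "FArr (inc (Dom L a) (Cod L b)) (FArr (act a b) y) \<in> Cell L" "null_cell L N (FArr (inc (Dom L a) (Cod L b)) (FArr (act a b) y))"
    using inc_simps(2)[OF o ay] null_cell_inc[OF o ay] by simp_all
  have ws: "Src L (FArr (inc (Dom L a) (Cod L b)) (FArr (act a b) y)) = Trg L (nu L N b (Src L x) a)"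
    using inc_simps(2)[OF o ay] functorD(5)[OF f(1)] f y t str_component(3)[OF h y(7)] by (simp add: nu_def)
  have "nu L N b (Trg L x) a \<bullet> (b \<rhd> (x \<lhd> a)) \<bullet> cinv L (nu L N b (Src L x) a) =
      (nu L N b (Trg L x) a \<bullet> (b \<rhd> (x \<lhd> a))) \<bullet> cinv L (nu L N b (Src L x) a)"
    using c ct[of a b] dx a b y(5) by simp
  also have "\<dots> = FArr (inc (Dom L a) (Cod L b)) (FArr (act a b) y)" unfolding e using c w ws by simp
  finally show ?thesis using w by simp
qed

end

lemma Cat_NSrc:
  "FDom (NSrc (HComp Cat T S)) = FDom (NSrc S)" "FCod (NSrc (HComp Cat T S)) = FCod (NSrc T)"
  "NSrc (VComp Cat T S) = NSrc S"
  by (simp_all add: Cat_def)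

lemma VComp_component:
  "n \<in> CObj (FDom (NSrc S)) \<Longrightarrow> NComp (VComp Cat T S) n = CComp (FCod (NSrc S)) (NComp T n) (NComp S n)"
  by (simp add: Cat_simps)

context two_ideal_context
begin

lemma null_iso_inc:
  assumes o: "A \<in> Obj L" "B \<in> Obj L" and y: "y \<in> CArr (cat A B)" "z \<in> CArr (cat A B)"
    "CDom (cat A B) z = CCod (cat A B) y" "CCod (cat A B) z = CDom (cat A B) y"
    "CComp (cat A B) z y = CId (cat A B) (CDom (cat A B) y)"
    "CComp (cat A B) y z = CId (cat A B) (CCod (cat A B) y)"
  shows "null_iso L N (FArr (inc A B) y)"
proof -
  note c = category.CDom_CObj[OF inc_simps(5)[OF o]] category.CCod_CObj[OF inc_simps(5)[OF o]]
  have "FArr (inc A B) z \<bullet> FArr (inc A B) y = Id2 L (Src L (FArr (inc A B) y))"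
    using inc_simps(4)[OF o y(1,2,3), symmetric] inc_simps(2)[OF o y(1)] inc_simps(3)[OF o c(1)[OF y(1)]] y(5) by simp
  moreover have "FArr (inc A B) y \<bullet> FArr (inc A B) z = Id2 L (Trg L (FArr (inc A B) y))"
    using inc_simps(4)[OF o y(2,1) y(4)[symmetric], symmetric] inc_simps(2)[OF o y(1)]
      inc_simps(3)[OF o c(2)[OF y(1)]] y(6) by simp
  ultimately have "inverse_cells L (FArr (inc A B) y) (FArr (inc A B) z)"
    using inc_simps(2)[OF o y(1)] inc_simps(2)[OF o y(2)] y(3,4) by (simp add: inverse_cells_def cells_iff)
  then show ?thesis
    using null_cell_inc[OF o y(1)] null_cell_inc[OF o y(2)] unfolding null_iso_def by blast
qed

text \<open>Here it is naturality of the constraints in the 2-cell (x, y): the conjugate is the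
  image of the component of N(x, y) at the name of n.\<close>

lemma nu_cell:
  assumes n: "null L N n" and x: "x \<in> Cell L" "Cod L (Src L x) = Dom L n"
    and y: "y \<in> Cell L" "Dom L (Src L y) = Cod L n"
  shows "null_cell L N (nu L N (Trg L y) n (Trg L x) \<bullet> (y \<star> (n \<rhd> x)) \<bullet> cinv L (nu L N (Src L y) n (Src L x)))"
proof -
  let ?a = "Src L x" and ?a' = "Trg L x" and ?b = "Src L y" and ?b' = "Trg L y"
  let ?A = "Dom L n" and ?B = "Cod L n" and ?A' = "Dom L ?a" and ?B' = "Cod L ?b"
  let ?n = "null_name L N n"
  note m = null_name[OF n]
  have o: "?A \<in> Obj L" "?B \<in> Obj L" "?A' \<in> Obj L" "?B' \<in> Obj L" using m x y by simp_all
  have h: "?a \<in> hom L ?A' ?A" "?b \<in> hom L ?B ?B'" and h': "?a' \<in> hom L ?A' ?A" "?b' \<in> hom L ?B ?B'"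
    using x y by (simp_all add: hom_iff)
  have c: "(x, y) \<in> cells P (?a, ?b) (?a', ?b')" by (rule P_cells) (use x y in \<open>simp_all add: cells_iff\<close>)
  note i = inc_functor[OF o(1,2)] and i' = inc_functor[OF o(3,4)] and f = act_functor[OF h] and s = sandwich[OF h]
  have pc: "PCell (IFun N) (x, y) \<in> cells Cat (act ?a ?b) (act ?a' ?b')" by (rule T.F.PCell_cells[OF c])
  have hc: "PCell H (x, y) \<in> cells Cat (PMor H (?a, ?b)) (PMor H (?a', ?b'))" by (rule T.G.PCell_cells[OF c])
  note pf = nat_functors[OF pc] and hf = nat_functors[OF hc]
  note sf = nat_functors[OF str_cells(2)[OF h]]
  let ?q = "NComp (PCell (IFun N) (x, y)) ?n"
  have q: "?q \<in> CArr (cat ?A' ?B')" "CDom (cat ?A' ?B') ?q = FObj (act ?a ?b) ?n"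
    using nat_component[OF pc, of ?n] m(2) f by simp_all
  have n0: "n \<in> CObj (hom_cat L ?A ?B)" using m by (simp add: hom_iff)
  have e0: "NComp (PCell H (x, y) \<lhd>\<^bsub>Cat\<^esub> inc ?A ?B) ?n = y \<star> (n \<rhd> x)"
  proof -
    have "NComp (PCell H (x, y) \<lhd>\<^bsub>Cat\<^esub> inc ?A ?B) ?n = NComp (PCell H (x, y)) n"
      using whisker_right_component[OF hc i(1), of ?n] i s(2) m by simp
    also have "\<dots> = y \<star> (n \<rhd> x)" using n0 x y by (simp add: H_simps sandwich_nat_def)
    finally show ?thesis .
  qed
  have e1: "NComp (inc ?A' ?B' \<rhd>\<^bsub>Cat\<^esub> PCell (IFun N) (x, y)) ?n = FArr (inc ?A' ?B') ?q"
    using whisker_left_component[OF pc i'(1), of ?n] i' f m by simp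
  have "NComp (str ?a' ?b' \<bullet>\<^bsub>Cat\<^esub> (PCell H (x, y) \<lhd>\<^bsub>Cat\<^esub> inc ?A ?B)) ?n =
      NComp ((inc ?A' ?B' \<rhd>\<^bsub>Cat\<^esub> PCell (IFun N) (x, y)) \<bullet>\<^bsub>Cat\<^esub> str ?a ?b) ?n"
    using T.TCell_natural[OF c P_hom[OF h]] by simp
  moreover have "NComp (str ?a' ?b' \<bullet>\<^bsub>Cat\<^esub> (PCell H (x, y) \<lhd>\<^bsub>Cat\<^esub> inc ?A ?B)) ?n =
      nu L N ?b' n ?a' \<bullet> (y \<star> (n \<rhd> x))"
    by (subst VComp_component) (use i m hf(5) s(3) e0 in \<open>simp_all add: Cat_NSrc nu_def Cat_simps\<close>)
  moreover have "NComp ((inc ?A' ?B' \<rhd>\<^bsub>Cat\<^esub> PCell (IFun N) (x, y)) \<bullet>\<^bsub>Cat\<^esub> str ?a ?b) ?n =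
      FArr (inc ?A' ?B') ?q \<bullet> nu L N ?b n ?a"
    by (subst VComp_component) (use i m sf(5) s(3) e1 in \<open>simp_all add: nu_def Cat_simps(8)\<close>)
  ultimately have e: "nu L N ?b' n ?a' \<bullet> (y \<star> (n \<rhd> x)) = FArr (inc ?A' ?B') ?q \<bullet> nu L N ?b n ?a" by simp
  have nn: "invertible (nu L N ?b n ?a)" "Src L (nu L N ?b n ?a) = ?b \<odot> n \<odot> ?a"
    "invertible (nu L N ?b' n ?a')" "Src L (nu L N ?b' n ?a') = ?b' \<odot> n \<odot> ?a'"
    using nu_component[OF n, of ?a ?b] nu_component[OF n, of ?a' ?b'] x y by simp_all
  have w: "FArr (inc ?A' ?B') ?q \<in> Cell L" "Src L (FArr (inc ?A' ?B') ?q) = Trg L (nu L N ?b n ?a)"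
    using inc_simps(2)[OF o(3,4) q(1)] q(2) str_component(3)[OF h m(2)] by (simp_all add: nu_def)
  have "nu L N ?b' n ?a' \<bullet> (y \<star> (n \<rhd> x)) \<bullet> cinv L (nu L N ?b n ?a) =
      (nu L N ?b' n ?a' \<bullet> (y \<star> (n \<rhd> x))) \<bullet> cinv L (nu L N ?b n ?a)"
    using nn m x y by simp
  also have "\<dots> = FArr (inc ?A' ?B') ?q" unfolding e using nn w by simp
  finally show ?thesis using null_cell_inc[OF o(3,4) q(1)] by simp
qed

lemma null_iso_simps:
  assumes "null_iso L N x"
  shows "invertible x" "null_cell L N x" "null_cell L N (cinv L x)"
proof -
  obtain y where y: "null_cell L N x" "null_cell L N y" "inverse_cells L x y"
    using assms by (auto simp: null_iso_def)
  show "invertible x" using y(3) by (rule invertibleI)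
  show "null_cell L N x" by (rule y)
  show "null_cell L N (cinv L x)" using y cinv_eq by simp
qed

lemma riso_null_iso:
  assumes p: "invertible p" "null L N (Trg L p)" and q: "invertible q" "null L N (Trg L q)"
    and t: "null_iso L N t" "Src L t = Trg L q" "p = t \<bullet> q" "f = Src L q"
  shows "riso p q (Id2 L f)"
proof -
  note ti = null_iso_simps[OF t(1)]
  have "null_cell L N (q \<bullet> Id2 L f \<bullet> cinv L p)" "null_cell L N (p \<bullet> Id2 L f \<bullet> cinv L q)"
    using ti t(2,4) q unfolding t(3) by simp_all
  moreover have "pres p" "pres q" using p q unfolding pres_def by blast+
  moreover have "Src L p = f" "f \<in> Mor L" "Src L q = f" using t(2,4) ti q unfolding t(3) by simp_all
  ultimately show "riso p q (Id2 L f)"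
    unfolding riso_def rnull_def by simp
qed

text \<open>The only use of the composition constraints of N. Since Hom is strict, compatibility of
  \<nu> with composition says that the one-step and two-step \<nu> differ by the image of a
  constraint component, an invertible null 2-cell.\<close>

lemma nu_assoc:
  assumes n: "null L N n" and a: "a \<in> Mor L" "Cod L a = Dom L n" and b: "b \<in> Mor L" "Dom L b = Cod L n"
    and a': "a' \<in> Mor L" "Cod L a' = Dom L a" and b': "b' \<in> Mor L" "Dom L b' = Cod L b"
  shows "riso (nu L N (b' \<odot> b) n (a \<odot> a'))
    (nu L N b' (Trg L (nu L N b n a)) a' \<bullet> (b' \<rhd> (nu L N b n a \<lhd> a'))) (Id2 L (b' \<odot> b \<odot> n \<odot> a \<odot> a'))"
proof -
  let ?A = "Dom L n" and ?B = "Cod L n" and ?A' = "Dom L a" and ?B' = "Cod L b" and ?A'' = "Dom L a'" and ?B'' = "Cod L b'"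
  let ?n = "null_name L N n" and ?m = "FObj (act a b) (null_name L N n)"
  note m = null_name[OF n]
  have o: "?A \<in> Obj L" "?B \<in> Obj L" "?A' \<in> Obj L" "?B' \<in> Obj L" "?A'' \<in> Obj L" "?B'' \<in> Obj L" using m a b a' b' by simp_all
  have h: "a \<in> hom L ?A' ?A" "b \<in> hom L ?B ?B'" and h': "a' \<in> hom L ?A'' ?A'" "b' \<in> hom L ?B' ?B''"
    and hh: "a \<odot> a' \<in> hom L ?A'' ?A" "b' \<odot> b \<in> hom L ?B ?B''"
    using a b a' b' by (simp_all add: hom_iff)
  note p = P_hom[OF h] and p' = P_hom[OF h']
  have pp: "Comp P (a', b') (a, b) = (a \<odot> a', b' \<odot> b)" by (simp add: prod2_def)
  note i = inc_functor[OF o(1,2)] and i' = inc_functor[OF o(3,4)] and i'' = inc_functor[OF o(5,6)]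
  note f = act_functor[OF h] and s = sandwich[OF h] and f' = act_functor[OF h'] and s' = sandwich[OF h'] and ss = sandwich[OF hh]
  note ff = act_functor[OF hh]
  note st = str_component[OF h m(2)]
  let ?F = "PComp (IFun N) (a', b') (a, b)"
  have Fi: "?F \<in> iso_cells Cat (Comp Cat (act a' b') (act a b)) (act (a \<odot> a') (b' \<odot> b))"
    using T.F.PComp_iso[OF p p'] by (simp add: pp)
  then have Fc: "?F \<in> cells Cat (Comp Cat (act a' b') (act a b)) (act (a \<odot> a') (b' \<odot> b))" by (simp add: iso_cells_def)
  have S: "FDom (Comp Cat (act a' b') (act a b)) = cat ?A ?B" "FCod (Comp Cat (act a' b') (act a b)) = cat ?A'' ?B''"
    "FObj (Comp Cat (act a' b') (act a b)) ?n = FObj (act a' b') ?m"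
    using f f' m by (simp_all add: Cat_simps)
  obtain U where U: "U \<in> cells Cat (act (a \<odot> a') (b' \<odot> b)) (Comp Cat (act a' b') (act a b))"
    "CComp (cat ?A'' ?B'') (NComp U ?n) (NComp ?F ?n) = CId (cat ?A'' ?B'') (FObj (act a' b') ?m)"
    "CComp (cat ?A'' ?B'') (NComp ?F ?n) (NComp U ?n) = CId (cat ?A'' ?B'') (FObj (act (a \<odot> a') (b' \<odot> b)) ?n)"
    using nat_iso_component[OF Fi] S m(2) by metis
  let ?q = "NComp ?F ?n"
  have q: "?q \<in> CArr (cat ?A'' ?B'')" "CDom (cat ?A'' ?B'') ?q = FObj (act a' b') ?m"
     "CCod (cat ?A'' ?B'') ?q = FObj (act (a \<odot> a') (b' \<odot> b)) ?n"
    using nat_component[OF Fc, of ?n] m(2) S by simp_all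
  have u: "NComp U ?n \<in> CArr (cat ?A'' ?B'')" "CCod (cat ?A'' ?B'') (NComp U ?n) = FObj (act a' b') ?m"
     "CDom (cat ?A'' ?B'') (NComp U ?n) = FObj (act (a \<odot> a') (b' \<odot> b)) ?n"
    using nat_component[OF U(1), of ?n] m(2) S ff by simp_all
  have ni: "null_iso L N (FArr (inc ?A'' ?B'') ?q)"
    by (rule null_iso_inc[OF o(5,6) q(1) u(1)]) (use q u U(2,3) in simp_all)
  note iq = inc_simps(2)[OF o(5,6) q(1)]
  note nc = nu_component[OF n a b]
  have d: "Dom L (Trg L (nu L N b n a)) = ?A'" "Cod L (Trg L (nu L N b n a)) = ?B'"
    using nc a b m invertible_simps(1)[OF nc(1)] by simp_all
  have nq: "Src L (FArr (inc ?A'' ?B'') ?q) = Trg L (nu L N b' (Trg L (nu L N b n a)) a')"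
    using iq q str_component(3)[OF h' st(4)] nc(4) by (simp add: nu_def[of L N b'])
  let ?l = "PComp H (a', b') (a, b) \<lhd>\<^bsub>Cat\<^esub> inc ?A ?B"
  let ?r1 = "inc ?A'' ?B'' \<rhd>\<^bsub>Cat\<^esub> ?F" and ?r2 = "str a' b' \<lhd>\<^bsub>Cat\<^esub> act a b" and ?r3 = "PMor H (a', b') \<rhd>\<^bsub>Cat\<^esub> str a b"
  have Hc: "PComp H (a', b') (a, b) \<in> cells Cat (PMor H (a \<odot> a', b' \<odot> b)) (PMor H (a \<odot> a', b' \<odot> b))"
    unfolding H_simps(4) pp by (rule T.F.M.Id2_cells) (use ss(1) in \<open>simp add: Cat_simps(2)\<close>)
  \<comment> \<open>Evaluated at the name of n, the factors on the right are the image of the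
    constraint of N, \<nu> for the outer pair and \<nu> for the inner pair, whiskered.\<close>
  have E: "NComp (str (a \<odot> a') (b' \<odot> b) \<bullet>\<^bsub>Cat\<^esub> ?l) ?n = NComp (?r1 \<bullet>\<^bsub>Cat\<^esub> ?r2 \<bullet>\<^bsub>Cat\<^esub> ?r3) ?n"
    using T.TCell_Comp[OF p p'] by (simp add: pp)
  have "NComp ?l ?n = NComp (PComp H (a', b') (a, b)) n"
    using whisker_right_component[OF Hc i(1), of ?n] i ss(2) m by simp
  also have "\<dots> = Id2 L ((b' \<odot> b) \<odot> n \<odot> a \<odot> a')"
  proof -
    have "n \<in> hom L ?A ?B" using m by (simp add: hom_iff)
    then show ?thesis using ss(2,3) ss(4)[of n] by (simp add: H_simps(4) pp Cat_simps(12))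
  qed
  finally have l: "NComp ?l ?n = Id2 L ((b' \<odot> b) \<odot> n \<odot> a \<odot> a')" .
  have Hs: "NSrc (PComp H (a', b') (a, b)) = PMor H (a \<odot> a', b' \<odot> b)" using nat_functors[OF Hc] by simp
  have L1: "NComp (str (a \<odot> a') (b' \<odot> b) \<bullet>\<^bsub>Cat\<^esub> ?l) ?n = nu L N (b' \<odot> b) n (a \<odot> a') \<bullet> Id2 L ((b' \<odot> b) \<odot> n \<odot> a \<odot> a')"
    by (subst VComp_component) (use i m Hs ss(3) l in \<open>simp_all add: Cat_NSrc nu_def Cat_simps(12)\<close>)
  note sf = nat_functors[OF str_cells(2)[OF h]]
  have r1: "NComp ?r1 ?n = FArr (inc ?A'' ?B'') ?q"
    using whisker_left_component[OF Fc i''(1), of ?n] i'' S m by simp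
  have r2: "NComp ?r2 ?n = nu L N b' (Trg L (nu L N b n a)) a'"
    using whisker_right_component[OF str_cells(2)[OF h'] f(1), of ?n] f m nc(4) i'
    by (simp add: nu_def[of L N b'] Cat_simps(8))
  have r3: "NComp ?r3 ?n = b' \<rhd> (nu L N b n a \<lhd> a')"
  proof -
    have "NComp ?r3 ?n = FArr (PMor H (a', b')) (nu L N b n a)"
      using whisker_left_component[OF str_cells(2)[OF h] s'(1), of ?n] s s' i m by (simp add: nu_def Cat_simps(8))
    also have "\<dots> = b' \<rhd> (nu L N b n a \<lhd> a')"
      by (rule s'(5)) (use nc a b m in \<open>simp_all add: hom_iff\<close>)
    finally show ?thesis .
  qed
  have "NComp (?r1 \<bullet>\<^bsub>Cat\<^esub> ?r2 \<bullet>\<^bsub>Cat\<^esub> ?r3) ?n = FArr (inc ?A'' ?B'') ?q \<bullet> NComp (?r2 \<bullet>\<^bsub>Cat\<^esub> ?r3) ?n"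
    by (subst VComp_component) (use i m s s' sf(5) r1 in \<open>simp_all add: Cat_NSrc Cat_simps(8,12)\<close>)
  also have "NComp (?r2 \<bullet>\<^bsub>Cat\<^esub> ?r3) ?n = nu L N b' (Trg L (nu L N b n a)) a' \<bullet> (b' \<rhd> (nu L N b n a \<lhd> a'))"
    by (subst VComp_component) (use i m s s' sf(5) r2 r3 in \<open>simp_all add: Cat_NSrc Cat_simps(8,12)\<close>)
  finally have "nu L N (b' \<odot> b) n (a \<odot> a') \<bullet> Id2 L ((b' \<odot> b) \<odot> n \<odot> a \<odot> a') =
      FArr (inc ?A'' ?B'') ?q \<bullet> nu L N b' (Trg L (nu L N b n a)) a' \<bullet> (b' \<rhd> (nu L N b n a \<lhd> a'))"
    using E L1 by simp
  moreover have "nu L N (b' \<odot> b) n (a \<odot> a') \<bullet> Id2 L ((b' \<odot> b) \<odot> n \<odot> a \<odot> a') = nu L N (b' \<odot> b) n (a \<odot> a')"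
    by (rule VComp_Id2) (use nu_component[OF n, of "a \<odot> a'" "b' \<odot> b"] a a' b b' in simp_all)
  ultimately have eq: "nu L N (b' \<odot> b) n (a \<odot> a') =
      FArr (inc ?A'' ?B'') ?q \<bullet> nu L N b' (Trg L (nu L N b n a)) a' \<bullet> (b' \<rhd> (nu L N b n a \<lhd> a'))" by simp
  have t: "b' \<in> Mor L" "Dom L b' = Cod L (Trg L (nu L N b n a))" "a' \<in> Mor L" "Cod L a' = Dom L (Trg L (nu L N b n a))"
    using a' b' d by simp_all
  note nc' = nu_component[OF nc(3) t(3,4,1,2)]
  show ?thesis
    by (rule riso_null_iso[OF _ _ _ _ ni _ eq])
      (use nu_component[OF n, of "a \<odot> a'" "b' \<odot> b"] nc nc' nq a a' b b' m d in simp_all)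
qed

text \<open>The unit axiom for \<nu>, where both unit constraints are identities: that of Hom
  because it is strict, that of N because it is normal.\<close>

lemma nu_Id1:
  assumes n: "null L N n"
  shows "nu L N (Id1 L (Cod L n)) n (Id1 L (Dom L n)) = Id2 L n"
proof -
  let ?A = "Dom L n" and ?B = "Cod L n" and ?n = "null_name L N n"
  let ?I = "Id1 L (Dom L n)" and ?J = "Id1 L (Cod L n)"
  note m = null_name[OF n]
  have o: "?A \<in> Obj L" "?B \<in> Obj L" using m by simp_all
  have h: "?I \<in> hom L ?A ?A" "?J \<in> hom L ?B ?B" using o by (simp_all add: hom_iff)
  have IP: "Id1 P (?A, ?B) = (?I, ?J)" by (simp add: prod2_def)
  note i = inc_functor[OF o] and s = sandwich[OF h]
  have nf: "PUnit (IFun N) (?A, ?B) = Id2 Cat (Id1 Cat (cat ?A ?B))"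
    using two_ideal P_Obj[OF o] by (simp add: two_ideal_def normal_def)
  have Ic: "Id1 Cat (cat ?A ?B) \<in> Mor Cat" "Id1 Cat (hom_cat L ?A ?B) \<in> Mor Cat"
    using T.F.M.Id1_simps(1) functorD(1,2)[OF i(1)] i by (simp_all add: Cat_simps(1))
  have Fc: "PUnit (IFun N) (?A, ?B) \<in> cells Cat (Id1 Cat (cat ?A ?B)) (Id1 Cat (cat ?A ?B))"
    unfolding nf by (rule T.F.M.Id2_cells[OF Ic(1)])
  have Hc: "PUnit H (?A, ?B) \<in> cells Cat (Id1 Cat (hom_cat L ?A ?B)) (Id1 Cat (hom_cat L ?A ?B))"
    unfolding H_simps(5) H_simps(1) by (rule T.F.M.Id2_cells[OF Ic(2)])
  have n0: "n \<in> hom L ?A ?B" using m by (simp add: hom_iff)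
  have l: "NComp (PUnit H (?A, ?B) \<lhd>\<^bsub>Cat\<^esub> inc ?A ?B) ?n = Id2 L n"
  proof -
    have "NComp (PUnit H (?A, ?B) \<lhd>\<^bsub>Cat\<^esub> inc ?A ?B) ?n = NComp (PUnit H (?A, ?B)) n"
      using whisker_right_component[OF Hc i(1), of ?n] i m by (simp add: Cat_simps(11))
    also have "\<dots> = Id2 L n" using n0 by (simp add: H_simps(5) H_simps(1) Cat_simps(11,12))
    finally show ?thesis .
  qed
  have r: "NComp (inc ?A ?B \<rhd>\<^bsub>Cat\<^esub> PUnit (IFun N) (?A, ?B)) ?n = Id2 L n"
  proof -
    have "NComp (inc ?A ?B \<rhd>\<^bsub>Cat\<^esub> PUnit (IFun N) (?A, ?B)) ?n = FArr (inc ?A ?B) (NComp (PUnit (IFun N) (?A, ?B)) ?n)"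
      using whisker_left_component[OF Fc i(1), of ?n] i m by (simp add: Cat_simps(11))
    also have "\<dots> = Id2 L n" using inc_simps(3)[OF o m(2)] m by (simp add: nf Cat_simps(11,12))
    finally show ?thesis .
  qed
  have "NComp (str ?I ?J \<bullet>\<^bsub>Cat\<^esub> (PUnit H (?A, ?B) \<lhd>\<^bsub>Cat\<^esub> inc ?A ?B)) ?n = Id2 L n"
    using T.TCell_Id1[OF P_Obj[OF o]] r by (simp add: IP)
  moreover have "NComp (str ?I ?J \<bullet>\<^bsub>Cat\<^esub> (PUnit H (?A, ?B) \<lhd>\<^bsub>Cat\<^esub> inc ?A ?B)) ?n = nu L N ?J n ?I \<bullet> Id2 L n"
    by (subst VComp_component) (use i m nat_functors(5)[OF Hc] l in \<open>simp_all add: Cat_NSrc nu_def Cat_simps(11,12)\<close>)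
  moreover have "nu L N ?J n ?I \<bullet> Id2 L n = nu L N ?J n ?I"
    by (rule VComp_Id2) (use nu_component[OF n, of ?I ?J] m in simp_all)
  ultimately show ?thesis by simp
qed

lemma null_cell_VComp:
  assumes x: "null_cell L N x" and y: "null_cell L N y" and t: "Src L y = Trg L x"
  shows "null_cell L N (y \<bullet> x)"
proof -
  obtain A B u where u: "A \<in> Obj L" "B \<in> Obj L" "u \<in> CArr (cat A B)" "x = FArr (inc A B) u" "x \<in> Cell L"
    "Src L x \<in> hom L A B"
    "CDom (cat A B) u \<in> CObj (cat A B)" "CCod (cat A B) u \<in> CObj (cat A B)"
    "Src L x = FObj (inc A B) (CDom (cat A B) u)" "Trg L x = FObj (inc A B) (CCod (cat A B) u)"
    using x by (rule null_cellE)
  obtain A' B' v where v: "A' \<in> Obj L" "B' \<in> Obj L" "v \<in> CArr (cat A' B')" "y = FArr (inc A' B') v" "y \<in> Cell L"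
    "Src L y \<in> hom L A' B'"
    "CDom (cat A' B') v \<in> CObj (cat A' B')" "CCod (cat A' B') v \<in> CObj (cat A' B')"
    "Src L y = FObj (inc A' B') (CDom (cat A' B') v)" "Trg L y = FObj (inc A' B') (CCod (cat A' B') v)"
    using y by (rule null_cellE)
  have "Dom L (Trg L x) = A" "Cod L (Trg L x) = B" using u(5,6) by (simp_all add: hom_iff)
  then have AB: "A' = A" "B' = B" using v(6) t by (simp_all add: hom_iff)
  \<comment> \<open>Composability in L is lifted to N(A,B) by injectivity of \<nu> on
    objects.\<close>
  have "CDom (cat A B) v = CCod (cat A B) u"
    using inj_onD[OF inc_simps(6)[OF u(1,2)], of "CDom (cat A B) v" "CCod (cat A B) u"] u v t AB by simp
  note c = inc_simps(4)[OF u(1,2,3) v(3)[unfolded AB] this] category.CComp_CArr[OF inc_simps(5)[OF u(1,2)] u(3) v(3)[unfolded AB] this]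
  show ?thesis using null_cell_inc[OF u(1,2)] c u(4) v(4) AB by metis
qed

lemma null_cell_Id2:
  assumes n: "null L N n"
  shows "null_cell L N (Id2 L n)"
proof -
  note m = null_name[OF n]
  have o: "Dom L n \<in> Obj L" "Cod L n \<in> Obj L" using m by simp_all
  have "null_cell L N (FArr (inc (Dom L n) (Cod L n)) (CId (cat (Dom L n) (Cod L n)) (null_name L N n)))"
    by (rule null_cell_inc[OF o]) (use category.CId_CArr[OF inc_simps(5)[OF o] m(2)] in simp)
  then show ?thesis using inc_simps(3)[OF o m(2)] m by simp
qed

lemma lnu_component:
  assumes "null L N n" "b \<in> Mor L" "Dom L b = Cod L n"
  shows "invertible (lnu b n)" "Src L (lnu b n) = b \<odot> n" "null L N (Trg L (lnu b n))"
    "Dom L (Trg L (lnu b n)) = Dom L n" "Cod L (Trg L (lnu b n)) = Cod L b"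
proof -
  note m = null_name(1)[OF assms(1)]
  show *: "invertible (lnu b n)" "Src L (lnu b n) = b \<odot> n" "null L N (Trg L (lnu b n))"
    using nu_component[OF assms(1), of "Id1 L (Dom L n)" b] m assms by (simp_all add: lnu_def)
  show "Dom L (Trg L (lnu b n)) = Dom L n" "Cod L (Trg L (lnu b n)) = Cod L b"
    using Dom_Cod_of_cell[of "lnu b n" "b \<odot> n"] * m assms by simp_all
qed

lemma rnu_component:
  assumes "null L N n" "a \<in> Mor L" "Dom L n = Cod L a"
  shows "invertible (rnu n a)" "Src L (rnu n a) = n \<odot> a" "null L N (Trg L (rnu n a))"
    "Dom L (Trg L (rnu n a)) = Dom L a" "Cod L (Trg L (rnu n a)) = Cod L n"
proof -
  note m = null_name(1)[OF assms(1)]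
  show *: "invertible (rnu n a)" "Src L (rnu n a) = n \<odot> a" "null L N (Trg L (rnu n a))"
    using nu_component[OF assms(1), of a "Id1 L (Cod L n)"] m assms by (simp_all add: rnu_def)
  show "Dom L (Trg L (rnu n a)) = Dom L a" "Cod L (Trg L (rnu n a)) = Cod L n"
    using Dom_Cod_of_cell[of "rnu n a" "n \<odot> a"] * m assms by simp_all
qed

lemma null_ideal: "null_ideal L N"
proof
  fix n b a assume n: "null L N n"
  note m = null_name(1)[OF n]
  show "n \<in> Mor L" by (rule m)
  show "null_cell L N (Id2 L n)" by (rule null_cell_Id2[OF n])
  show "lnu (Id1 L (Cod L n)) n = Id2 L n" "rnu n (Id1 L (Dom L n)) = Id2 L n"
    using nu_Id1[OF n] by (simp_all add: lnu_def rnu_def)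
  show "b \<in> Mor L \<Longrightarrow> Dom L b = Cod L n \<Longrightarrow>
      invertible (lnu b n) \<and> Src L (lnu b n) = b \<odot> n \<and> null L N (Trg L (lnu b n))" using lnu_component[OF n] by blast
  show "a \<in> Mor L \<Longrightarrow> Dom L n = Cod L a \<Longrightarrow>
      invertible (rnu n a) \<and> Src L (rnu n a) = n \<odot> a \<and> null L N (Trg L (rnu n a))" using rnu_component[OF n] by blast
  fix y assume y: "y \<in> Cell L"
  { assume d: "Dom L (Src L y) = Cod L n"
    show "null_cell L N (lnu (Trg L y) n \<bullet> (y \<lhd> n) \<bullet> cinv L (lnu (Src L y) n))"
      using nu_cell[OF n, of "Id2 L (Id1 L (Dom L n))" y] m y d by (simp add: lnu_def) }
  { assume d: "Dom L n = Cod L (Src L y)"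
    show "null_cell L N (rnu n (Trg L y) \<bullet> (n \<rhd> y) \<bullet> cinv L (rnu n (Src L y)))"
      using nu_cell[OF n, of y "Id2 L (Id1 L (Cod L n))"] m y d by (simp add: rnu_def) }
next
  fix x assume x: "null_cell L N x"
  obtain A B u where u: "A \<in> Obj L" "B \<in> Obj L" "u \<in> CArr (cat A B)" "x = FArr (inc A B) u" "x \<in> Cell L"
    "Src L x \<in> hom L A B"
    "CDom (cat A B) u \<in> CObj (cat A B)" "CCod (cat A B) u \<in> CObj (cat A B)"
    "Src L x = FObj (inc A B) (CDom (cat A B) u)" "Trg L x = FObj (inc A B) (CCod (cat A B) u)"
    using x by (rule null_cellE)
  show "null L N (Src L x) \<and> null L N (Trg L x)" using null_inc(1)[OF u(1,2)] u by simp
  show "null_cell L N y \<Longrightarrow> Src L y = Trg L x \<Longrightarrow> null_cell L N (y \<bullet> x)" for y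
    by (rule null_cell_VComp[OF x])
  show "b \<in> Mor L \<Longrightarrow> Dom L b = Cod L (Src L x) \<Longrightarrow>
      null_cell L N (lnu b (Trg L x) \<bullet> (b \<rhd> x) \<bullet> cinv L (lnu b (Src L x)))" for b
    using nu_natural[OF x, of "Id1 L (Dom L (Src L x))" b] u(5) by (simp add: lnu_def)
  show "a \<in> Mor L \<Longrightarrow> Dom L (Src L x) = Cod L a \<Longrightarrow>
      null_cell L N (rnu (Trg L x) a \<bullet> (x \<lhd> a) \<bullet> cinv L (rnu (Src L x) a))" for a
    using nu_natural[OF x, of a "Id1 L (Cod L (Src L x))"] u(5) by (simp add: rnu_def)
next
  fix n b b' assume *: "null L N n" "b \<in> Mor L" "b' \<in> Mor L" "Dom L b = Cod L n" "Dom L b' = Cod L b"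
  note m = null_name(1)[OF *(1)] and q = lnu_component[OF *(1,2,4)]
  let ?I = "Id1 L (Dom L n)"
  \<comment> \<open>The coherence items are \<open>nu_assoc\<close> with identities for some of the
    four 1-cells; these equations remove the identities again.\<close>
  have I: "?I \<in> Mor L" "Cod L ?I = Dom L n" "Cod L ?I = Dom L ?I" "?I \<odot> ?I = ?I" "n \<odot> ?I = n" "lnu b n \<lhd> ?I = lnu b n"
    using m q * by simp_all
  show "riso (lnu (b' \<odot> b) n) (pres_left b' (lnu b n)) (Id2 L (b' \<odot> b \<odot> n))"
    using nu_assoc[OF *(1) I(1,2) *(2,4) I(1,3) *(3,5), unfolded I(4,5) lnu_def[symmetric] I(6)]
    by (simp add: lnu_def[of b' "Trg L (lnu b n)"] pres_left_def q(4))
next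
  fix n a a' assume *: "null L N n" "a \<in> Mor L" "a' \<in> Mor L" "Dom L n = Cod L a" "Dom L a = Cod L a'"
  note m = null_name(1)[OF *(1)] and q = rnu_component[OF *(1,2,4)]
  let ?I = "Id1 L (Cod L n)"
  have I: "?I \<in> Mor L" "Dom L ?I = Cod L n" "Dom L ?I = Cod L ?I" "?I \<odot> ?I = ?I" "?I \<odot> n \<odot> a \<odot> a' = n \<odot> a \<odot> a'"
    "?I \<rhd> (rnu n a \<lhd> a') = rnu n a \<lhd> a'"
    using m q * by simp_all
  show "riso (rnu n (a \<odot> a')) (pres_right (rnu n a) a') (Id2 L (n \<odot> a \<odot> a'))"
    using nu_assoc[OF *(1,2) *(4)[symmetric] I(1,2) *(3) *(5)[symmetric] I(1,3), unfolded I(4,5) rnu_def[symmetric] I(6)] m *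
    by (simp add: rnu_def[of "Trg L (rnu n a)"] pres_right_def q(5))
next
  fix n b a assume *: "null L N n" "b \<in> Mor L" "a \<in> Mor L" "Dom L b = Cod L n" "Dom L n = Cod L a"
  note m = null_name(1)[OF *(1)] and l = lnu_component[OF *(1,2,4)] and r = rnu_component[OF *(1,3,5)]
  let ?I = "Id1 L (Cod L n)" and ?J = "Id1 L (Dom L a)" and ?K = "Id1 L (Dom L n)" and ?L = "Id1 L (Cod L b)"
  have I: "?I \<in> Mor L" "Dom L ?I = Cod L n" "?J \<in> Mor L" "Cod L ?J = Dom L a" "Dom L b = Cod L ?I"
    "b \<odot> ?I = b" "a \<odot> ?J = a" "?I \<odot> n \<odot> a = n \<odot> a" "rnu n a \<lhd> ?J = rnu n a"
    using m r * by simp_all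
  have K: "?K \<in> Mor L" "Cod L ?K = Dom L n" "?L \<in> Mor L" "Dom L ?L = Cod L b" "Cod L a = Dom L ?K"
    "?L \<odot> b = b" "?K \<odot> a = a" "?L \<odot> b \<odot> n \<odot> a = b \<odot> n \<odot> a" "?L \<rhd> (lnu b n \<lhd> a) = lnu b n \<lhd> a"
    using m l * by simp_all
  \<comment> \<open>Identities next to n on the left and outermost on the right make the right
    whiskering come first; the opposite placement gives the other order.\<close>
  show "riso (nu L N b n a) (pres_left b (rnu n a)) (Id2 L (b \<odot> n \<odot> a))"
    using nu_assoc[OF *(1,3) *(5)[symmetric] I(1,2,3,4) *(2) I(5), unfolded I(6,7,8) rnu_def[symmetric] I(9)]
    by (simp add: lnu_def pres_left_def r(4))
  show "riso (nu L N b n a) (pres_right (lnu b n) a) (Id2 L (b \<odot> n \<odot> a))"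
    using nu_assoc[OF *(1) K(1,2) *(2,4,3) K(5,3,4), unfolded K(6,7,8) lnu_def[symmetric] K(9)]
    by (simp add: rnu_def pres_right_def l(5))
qed

end

section \<open>Biequivalences over a 2-category from matched pairs\<close>

text \<open>A strict 2-functor that is faithful on parallel 2-cells; the instances are dom on
  cokernels and cod on kernels.\<close>

locale faithful_over = X: two_category X + L: two_category L
  for X :: "('p, 'n, 'd) two_cat" and L :: "('o, 'm, 'c) two_cat" +
  fixes P :: "('p, 'n, 'd, 'o, 'm, 'c) pfun"
  assumes PObj: "A \<in> Obj X \<Longrightarrow> PObj P A \<in> Obj L"
    and PMor: "f \<in> Mor X \<Longrightarrow> PMor P f \<in> hom L (PObj P (Dom X f)) (PObj P (Cod X f))"
    and PCell: "x \<in> Cell X \<Longrightarrow> PCell P x \<in> cells L (PMor P (Src X x)) (PMor P (Trg X x))"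
    and PMor_Id1 [simp]: "A \<in> Obj X \<Longrightarrow> PMor P (Id1 X A) = Id1 L (PObj P A)"
    and PMor_Comp [simp]: "\<lbrakk>f \<in> Mor X; g \<in> Mor X; Dom X g = Cod X f\<rbrakk> \<Longrightarrow>
          PMor P (Comp X g f) = Comp L (PMor P g) (PMor P f)"
    and PCell_Id2 [simp]: "f \<in> Mor X \<Longrightarrow> PCell P (Id2 X f) = Id2 L (PMor P f)"
    and PCell_VComp [simp]: "\<lbrakk>x \<in> Cell X; y \<in> Cell X; Src X y = Trg X x\<rbrakk> \<Longrightarrow>
          PCell P (VComp X y x) = VComp L (PCell P y) (PCell P x)"
    and PCell_HComp [simp]: "\<lbrakk>x \<in> Cell X; y \<in> Cell X; Dom X (Src X y) = Cod X (Src X x)\<rbrakk> \<Longrightarrow>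
          PCell P (HComp X y x) = HComp L (PCell P y) (PCell P x)"
    and PComp [simp]: "PComp P g f = Id2 L (PMor P (Comp X g f))"
    and PUnit [simp]: "PUnit P A = Id2 L (Id1 L (PObj P A))"
    and faithful: "\<lbrakk>x \<in> Cell X; y \<in> Cell X; Src X x = Src X y; Trg X x = Trg X y; PCell P x = PCell P y\<rbrakk> \<Longrightarrow> x = y"
begin

lemma P_simps [simp]:
  "A \<in> Obj X \<Longrightarrow> PObj P A \<in> Obj L"
  "f \<in> Mor X \<Longrightarrow> PMor P f \<in> Mor L"
  "f \<in> Mor X \<Longrightarrow> Dom L (PMor P f) = PObj P (Dom X f)"
  "f \<in> Mor X \<Longrightarrow> Cod L (PMor P f) = PObj P (Cod X f)"
  "x \<in> Cell X \<Longrightarrow> PCell P x \<in> Cell L"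
  "x \<in> Cell X \<Longrightarrow> Src L (PCell P x) = PMor P (Src X x)"
  "x \<in> Cell X \<Longrightarrow> Trg L (PCell P x) = PMor P (Trg X x)"
  using PObj[of A] PMor[of f] PCell[of x] by (simp_all add: L.hom_iff L.cells_iff)

lemma pseudofunctor: "pseudofunctor X L P"
  by unfold_locales (simp_all add: X.hom_iff X.cells_iff L.hom_iff L.cells_iff L.iso_cells_iff)

lemma invertible_over_Id2:
  assumes "x \<in> cells X f g" "y \<in> cells X g f" "PMor P f = PMor P g"
    "PCell P x = Id2 L (PMor P f)" "PCell P y = Id2 L (PMor P f)"
  shows "X.invertible x"
proof -
  have *: "x \<in> Cell X" "y \<in> Cell X" "Src X x = f" "Trg X x = g" "Src X y = g" "Trg X y = f" "f \<in> Mor X" "g \<in> Mor X"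
    using assms X.Dom_Cod_of_cell[of x f g] by (auto simp: X.cells_iff)
  have "VComp X y x = Id2 X f" "VComp X x y = Id2 X g"
    by (rule faithful; use * assms(3-) in simp)+
  then have "inverse_cells X x y" using * by (simp add: inverse_cells_def X.cells_iff)
  then show ?thesis by (rule X.invertibleI)
qed

end

section \<open>Pseudofunctors and transformations over L\<close>

definition pfun_over :: "('p, 'n, 'd) two_cat \<Rightarrow> ('q, 'l, 'e) two_cat \<Rightarrow> ('o, 'm, 'c) two_cat \<Rightarrow>
    ('p, 'n, 'd, 'o, 'm, 'c) pfun \<Rightarrow> ('q, 'l, 'e, 'o, 'm, 'c) pfun \<Rightarrow>
    ('p, 'n, 'd, 'q, 'l, 'e) pfun \<Rightarrow> bool" where
  "pfun_over X Y L P Q F \<longleftrightarrow>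
     (\<forall>A\<in>Obj X. PObj F A \<in> Obj Y \<and> PObj Q (PObj F A) = PObj P A \<and>
        PUnit F A \<in> iso_cells Y (Id1 Y (PObj F A)) (PMor F (Id1 X A)) \<and>
        PCell Q (PUnit F A) = Id2 L (Id1 L (PObj P A))) \<and>
     (\<forall>f\<in>Mor X. PMor F f \<in> hom Y (PObj F (Dom X f)) (PObj F (Cod X f)) \<and> PMor Q (PMor F f) = PMor P f) \<and>
     (\<forall>x\<in>Cell X. PCell F x \<in> cells Y (PMor F (Src X x)) (PMor F (Trg X x)) \<and> PCell Q (PCell F x) = PCell P x) \<and>
     (\<forall>f\<in>Mor X. \<forall>g\<in>Mor X. Dom X g = Cod X f \<longrightarrow>
        PComp F g f \<in> iso_cells Y (Comp Y (PMor F g) (PMor F f)) (PMor F (Comp X g f)) \<and>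
        PCell Q (PComp F g f) = Id2 L (PMor P (Comp X g f)))"

locale faithful_over_pair = X: faithful_over X L P + Y: faithful_over Y L Q
  for X :: "('p, 'n, 'd) two_cat" and Y :: "('q, 'l, 'e) two_cat" and L :: "('o, 'm, 'c) two_cat"
    and P :: "('p, 'n, 'd, 'o, 'm, 'c) pfun" and Q :: "('q, 'l, 'e, 'o, 'm, 'c) pfun"
begin

lemma pfun_overD:
  assumes "pfun_over X Y L P Q F"
  shows "A \<in> Obj X \<Longrightarrow> PObj F A \<in> Obj Y" "A \<in> Obj X \<Longrightarrow> PObj Q (PObj F A) = PObj P A"
    "A \<in> Obj X \<Longrightarrow> Y.X.invertible (PUnit F A)" "A \<in> Obj X \<Longrightarrow> Src Y (PUnit F A) = Id1 Y (PObj F A)"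
    "A \<in> Obj X \<Longrightarrow> Trg Y (PUnit F A) = PMor F (Id1 X A)" "A \<in> Obj X \<Longrightarrow> PCell Q (PUnit F A) = Id2 L (Id1 L (PObj P A))"
    "f \<in> Mor X \<Longrightarrow> PMor F f \<in> Mor Y" "f \<in> Mor X \<Longrightarrow> Dom Y (PMor F f) = PObj F (Dom X f)"
    "f \<in> Mor X \<Longrightarrow> Cod Y (PMor F f) = PObj F (Cod X f)" "f \<in> Mor X \<Longrightarrow> PMor Q (PMor F f) = PMor P f"
    "x \<in> Cell X \<Longrightarrow> PCell F x \<in> Cell Y" "x \<in> Cell X \<Longrightarrow> Src Y (PCell F x) = PMor F (Src X x)"
    "x \<in> Cell X \<Longrightarrow> Trg Y (PCell F x) = PMor F (Trg X x)" "x \<in> Cell X \<Longrightarrow> PCell Q (PCell F x) = PCell P x"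
    "f \<in> Mor X \<Longrightarrow> g \<in> Mor X \<Longrightarrow> Dom X g = Cod X f \<Longrightarrow> Y.X.invertible (PComp F g f)"
    "f \<in> Mor X \<Longrightarrow> g \<in> Mor X \<Longrightarrow> Dom X g = Cod X f \<Longrightarrow> Src Y (PComp F g f) = Comp Y (PMor F g) (PMor F f)"
    "f \<in> Mor X \<Longrightarrow> g \<in> Mor X \<Longrightarrow> Dom X g = Cod X f \<Longrightarrow> Trg Y (PComp F g f) = PMor F (Comp X g f)"
    "f \<in> Mor X \<Longrightarrow> g \<in> Mor X \<Longrightarrow> Dom X g = Cod X f \<Longrightarrow> PCell Q (PComp F g f) = Id2 L (Comp L (PMor P g) (PMor P f))"
  using assms unfolding pfun_over_def by (simp_all add: Y.X.hom_iff Y.X.cells_iff Y.X.iso_cells_iff)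

text \<open>\<open>pfun_over\<close> asks only for typed data over L. Each axiom equates parallel
  2-cells of Y whose images in L agree, since the constraints lie over identities and P is strict;
  faithfulness of Q does the rest.\<close>

lemma pfun_over_pseudofunctor:
  assumes F: "pfun_over X Y L P Q F"
  shows "pseudofunctor X Y F"
proof -
  note F [simp] = pfun_overD[OF F]
  show ?thesis
    by unfold_locales
      (simp_all add: X.X.hom_iff X.X.cells_iff Y.X.hom_iff Y.X.cells_iff Y.X.iso_cells_iff,
        (rule Y.faithful; force simp: X.X.Dom_Cod_of_cell)+)
qed

lemma pfun_over_eq:
  assumes F: "pfun_over X Y L P Q F"
  shows "pfun_eq X (comp_pfun L Q F) P"
  unfolding pfun_eq_def comp_pfun_def using pfun_overD[OF F] by simp

lemma pseudonatural_over:
  assumes F: "pfun_over X Y L P Q F" and G: "pfun_over X Y L P Q G"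
    and T: "\<And>A. A \<in> Obj X \<Longrightarrow> TComp T A \<in> Mor Y" "\<And>A. A \<in> Obj X \<Longrightarrow> Dom Y (TComp T A) = PObj F A"
      "\<And>A. A \<in> Obj X \<Longrightarrow> Cod Y (TComp T A) = PObj G A" "\<And>A. A \<in> Obj X \<Longrightarrow> PMor Q (TComp T A) = Id1 L (PObj P A)"
      "\<And>f. f \<in> Mor X \<Longrightarrow> Y.X.invertible (TCell T f)"
      "\<And>f. f \<in> Mor X \<Longrightarrow> Src Y (TCell T f) = Comp Y (PMor G f) (TComp T (Dom X f))"
      "\<And>f. f \<in> Mor X \<Longrightarrow> Trg Y (TCell T f) = Comp Y (TComp T (Cod X f)) (PMor F f)"
      "\<And>f. f \<in> Mor X \<Longrightarrow> PCell Q (TCell T f) = Id2 L (PMor P f)"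
  shows "pseudonatural X Y F G T"
proof -
  note F' [simp] = pfun_overD[OF F] and G' [simp] = pfun_overD[OF G] and T' [simp] = T
  interpret F: pseudofunctor X Y F by (rule pfun_over_pseudofunctor[OF F])
  interpret G: pseudofunctor X Y G by (rule pfun_over_pseudofunctor[OF G])
  show "pseudonatural X Y F G T"
    by unfold_locales
      (simp_all add: X.X.hom_iff X.X.cells_iff Y.X.hom_iff Y.X.cells_iff Y.X.iso_cells_iff,
        (rule Y.faithful; force simp: X.X.Dom_Cod_of_cell)+)
qed

end

lemma pfun_over_id:
  assumes "faithful_over X L P"
  shows "pfun_over X X L P P (id_pfun X)"
proof -
  interpret faithful_over X L P by fact
  show ?thesis
    by (auto simp: pfun_over_def id_pfun_def strict_pfun_def X.hom_iff X.cells_iff X.iso_cells_iff)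
qed

lemma pfun_over_comp:
  assumes "faithful_over_pair X Y L P Q" "faithful_over Z L R" "pfun_over X Y L P Q F" "pfun_over Y Z L Q R G"
  shows "pfun_over X Z L P R (comp_pfun Z G F)"
proof -
  interpret XY: faithful_over_pair X Y L P Q by fact
  interpret Z: faithful_over Z L R by fact
  interpret YZ: faithful_over_pair Y Z L Q R by unfold_locales
  note [simp] = XY.pfun_overD[OF assms(3)] YZ.pfun_overD[OF assms(4)]
  \<comment> \<open>The constraints of a composite are images under G of constraints of F followed
    by those of G, so invertibility has to survive G.\<close>
  have G: "Z.X.invertible (PCell G x)" if x: "XY.Y.X.invertible x" for x
  proof -
    interpret G: pseudofunctor Y Z G by (rule YZ.pfun_over_pseudofunctor[OF assms(4)])
    note G.PCell_VComp[unfolded XY.Y.X.cells_iff, of x "Src Y x" "Trg Y x" "cinv Y x" "Src Y x"]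
      G.PCell_VComp[unfolded XY.Y.X.cells_iff, of "cinv Y x" "Trg Y x" "Src Y x" x "Trg Y x"]
    then have "inverse_cells Z (PCell G x) (PCell G (cinv Y x))"
      using x G.PCell_Id2 by (simp add: inverse_cells_def Z.X.cells_iff)
    then show ?thesis by (rule Z.X.invertibleI)
  qed
  show ?thesis
    using G by (auto simp: pfun_over_def comp_pfun_def Z.X.hom_iff Z.X.cells_iff Z.X.iso_cells_iff)
qed

text \<open>\<open>R0 a b w\<close>: the object \<open>b\<close> corresponds to \<open>a\<close> by way of the datum \<open>w\<close>.  \<open>R1 w w' f g\<close>: the 1-cell \<open>g\<close>
  corresponds to \<open>f\<close>, relative to data at the sources and the targets.  There may be many such \<open>g\<close> over \<open>f\<close>; any two of
  them are isomorphic over \<open>L\<close>.\<close>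

locale span = faithful_over_pair X Y L P Q
  for X :: "('p, 'n, 'd) two_cat" and Y :: "('q, 'l, 'e) two_cat" and L :: "('o, 'm, 'c) two_cat"
    and P :: "('p, 'n, 'd, 'o, 'm, 'c) pfun" and Q :: "('q, 'l, 'e, 'o, 'm, 'c) pfun" +
  fixes R0 :: "'p \<Rightarrow> 'q \<Rightarrow> 'w \<Rightarrow> bool" and R1 :: "'w \<Rightarrow> 'w \<Rightarrow> 'n \<Rightarrow> 'l \<Rightarrow> bool"
  assumes R0_Obj: "R0 a b w \<Longrightarrow> a \<in> Obj X \<and> b \<in> Obj Y \<and> PObj P a = PObj Q b"
    and R0_total: "a \<in> Obj X \<Longrightarrow> \<exists>b w. R0 a b w"
    and R1_Mor: "R1 w w' f g \<Longrightarrow> f \<in> Mor X \<and> g \<in> Mor Y \<and> PMor P f = PMor Q g \<and>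
      R0 (Dom X f) (Dom Y g) w \<and> R0 (Cod X f) (Cod Y g) w'"
    and R1_ex: "\<lbrakk>f \<in> Mor X; R0 (Dom X f) b w; R0 (Cod X f) b' w'\<rbrakk> \<Longrightarrow>
      \<exists>g. R1 w w' f g \<and> Dom Y g = b \<and> Cod Y g = b'"
    and R1_Id1: "R0 a b w \<Longrightarrow> R1 w w (Id1 X a) (Id1 Y b)"
    and R1_Comp: "\<lbrakk>R1 w w' f g; R1 w' w'' f' g'; Dom X f' = Cod X f; Dom Y g' = Cod Y g\<rbrakk> \<Longrightarrow>
      R1 w w'' (Comp X f' f) (Comp Y g' g)"
    and R1_cell: "\<lbrakk>R1 w w' f g; R1 w w' f1 g1; x \<in> cells X f f1; Dom Y g1 = Dom Y g; Cod Y g1 = Cod Y g\<rbrakk> \<Longrightarrow>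
      \<exists>y\<in>cells Y g g1. PCell Q y = PCell P x"
begin

definition "K0 a = (SOME b. \<exists>w. R0 a b w)"
text \<open>One datum is fixed for each object, because \<open>R1\<close> compares 1-cells only
  relative to given data at both ends.\<close>

definition "W a = (SOME w. R0 a (K0 a) w)"
text \<open>Identities are sent to identities by decree, which makes K normal; the choice alone
  would give a 1-cell merely isomorphic to an identity.\<close>

definition "K1 f = (if f = Id1 X (Dom X f) then Id1 Y (K0 (Dom X f)) else
  (SOME g. R1 (W (Dom X f)) (W (Cod X f)) f g \<and> Dom Y g = K0 (Dom X f) \<and> Cod Y g = K0 (Cod X f)))"
text \<open>The choice is harmless: by faithfulness of Q there is at most one such 2-cell.\<close>

definition "lift g g' l = (SOME y. y \<in> cells Y g g' \<and> PCell Q y = l)"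
definition "K = \<lparr>PObj = K0, PMor = K1, PCell = (\<lambda>x. lift (K1 (Src X x)) (K1 (Trg X x)) (PCell P x)),
  PComp = (\<lambda>g f. lift (Comp Y (K1 g) (K1 f)) (K1 (Comp X g f)) (Id2 L (PMor P (Comp X g f)))),
  PUnit = (\<lambda>a. Id2 Y (Id1 Y (K0 a)))\<rparr>"

lemma R0_W: "a \<in> Obj X \<Longrightarrow> R0 a (K0 a) (W a)"
  unfolding W_def K0_def using R0_total[of a] by (metis (mono_tags, lifting) someI_ex)

lemma K1: "f \<in> Mor X \<Longrightarrow> R1 (W (Dom X f)) (W (Cod X f)) f (K1 f) \<and> Dom Y (K1 f) = K0 (Dom X f) \<and> Cod Y (K1 f) = K0 (Cod X f)"
proof (cases "f = Id1 X (Dom X f)")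
  case True
  assume f: "f \<in> Mor X"
  then have o: "Dom X f \<in> Obj X" by simp
  then have c: "Cod X f = Dom X f" using True X.X.Id1_simps(3) by metis
  note r = R0_W[OF o]
  have k: "K1 f = Id1 Y (K0 (Dom X f))" using True by (simp add: K1_def)
  have "R1 (W (Dom X f)) (W (Dom X f)) f (Id1 Y (K0 (Dom X f)))" using R1_Id1[OF r] True by simp
  then show ?thesis using r R0_Obj by (simp add: k c)
next
  case False
  assume f: "f \<in> Mor X"
  have "\<exists>g. R1 (W (Dom X f)) (W (Cod X f)) f g \<and> Dom Y g = K0 (Dom X f) \<and> Cod Y g = K0 (Cod X f)"
    by (rule R1_ex[OF f R0_W R0_W]) (use f in simp_all)
  from someI_ex[OF this] show ?thesis using False by (simp add: K1_def)
qed

lemma lift_cell: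
  assumes "R1 w w' f g" "R1 w w' f' g'" "x \<in> cells X f f'" "Dom Y g' = Dom Y g" "Cod Y g' = Cod Y g"
  shows "lift g g' (PCell P x) \<in> cells Y g g'" "PCell Q (lift g g' (PCell P x)) = PCell P x"
  using someI_ex[of "\<lambda>y. y \<in> cells Y g g' \<and> PCell Q y = PCell P x"] R1_cell[OF assms]
  unfolding lift_def by auto

text \<open>The identity of f lifts in both directions, and faithfulness makes the two lifts
  inverse. All constraints and structure 2-cells below arise in this way.\<close>

lemma lift_Id2:
  assumes "R1 w w' f g" "R1 w w' f g'" "Dom Y g' = Dom Y g" "Cod Y g' = Cod Y g"
  shows "Y.X.invertible (lift g g' (Id2 L (PMor P f)))" "Src Y (lift g g' (Id2 L (PMor P f))) = g"
    "Trg Y (lift g g' (Id2 L (PMor P f))) = g'" "PCell Q (lift g g' (Id2 L (PMor P f))) = Id2 L (PMor P f)"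
proof -
  have f: "f \<in> Mor X" "PMor P f = PMor Q g" "PMor P f = PMor Q g'" using R1_Mor assms by blast+
  have i: "Id2 X f \<in> cells X f f" using f by (simp add: X.X.cells_iff)
  have e: "PCell P (Id2 X f) = Id2 L (PMor P f)" using f by simp
  note a = lift_cell[OF assms(1,2) i assms(3,4), unfolded e]
    and b = lift_cell[OF assms(2,1) i assms(3,4)[symmetric], unfolded e]
  show "Y.X.invertible (lift g g' (Id2 L (PMor P f)))"
    by (rule Y.invertible_over_Id2[OF a(1) b(1)]) (use a(2) b(2) f in simp_all)
  show "Src Y (lift g g' (Id2 L (PMor P f))) = g" "Trg Y (lift g g' (Id2 L (PMor P f))) = g'"
    using a(1) by (simp_all add: Y.X.cells_iff)
  show "PCell Q (lift g g' (Id2 L (PMor P f))) = Id2 L (PMor P f)" by (rule a(2))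
qed

lemma K_over: "pfun_over X Y L P Q K"
  unfolding pfun_over_def
proof (intro conjI ballI impI)
  fix A assume A: "A \<in> Obj X"
  note r = R0_Obj[OF R0_W[OF A]]
  have i: "K1 (Id1 X A) = Id1 Y (K0 A)" using A by (simp add: K1_def)
  show "PObj K A \<in> Obj Y" "PObj Q (PObj K A) = PObj P A" using r by (simp_all add: K_def)
  show "PUnit K A \<in> iso_cells Y (Id1 Y (PObj K A)) (PMor K (Id1 X A))"
    "PCell Q (PUnit K A) = Id2 L (Id1 L (PObj P A))" using r i by (simp_all add: K_def Y.X.iso_cells_iff)
next
  fix f assume f: "f \<in> Mor X"
  show "PMor K f \<in> hom Y (PObj K (Dom X f)) (PObj K (Cod X f))" "PMor Q (PMor K f) = PMor P f"
    using K1[OF f] R1_Mor by (auto simp: K_def Y.X.hom_iff)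
next
  fix x assume x: "x \<in> Cell X"
  note s = K1[of "Src X x"] K1[of "Trg X x"]
  have c: "x \<in> cells X (Src X x) (Trg X x)" using x by (simp add: X.X.cells_iff)
  have "R1 (W (Dom X (Src X x))) (W (Cod X (Src X x))) (Trg X x) (K1 (Trg X x))" using s x by simp
  note l = lift_cell[OF conjunct1[OF K1] this c]
  show "PCell K x \<in> cells Y (PMor K (Src X x)) (PMor K (Trg X x))" "PCell Q (PCell K x) = PCell P x"
    using l s x by (simp_all add: K_def)
next
  fix f g assume *: "f \<in> Mor X" "g \<in> Mor X" "Dom X g = Cod X f"
  note k = K1[OF *(1)] K1[OF *(2)]
  \<comment> \<open>The composite of the chosen 1-cells and the 1-cell chosen for the composite
    correspond to the same 1-cell of X; \<open>lift_Id2\<close> then gives the constraint.\<close>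
  have "R1 (W (Dom X f)) (W (Cod X g)) (Comp X g f) (Comp Y (K1 g) (K1 f))"
    by (rule R1_Comp[of _ "W (Cod X f)"]) (use k * in simp_all)
  moreover have "R1 (W (Dom X f)) (W (Cod X g)) (Comp X g f) (K1 (Comp X g f))"
    using K1[of "Comp X g f"] * by simp
  moreover have "K1 f \<in> Mor Y" "K1 g \<in> Mor Y" using k R1_Mor by blast+
  ultimately have "PComp K g f \<in> iso_cells Y (Comp Y (PMor K g) (PMor K f)) (PMor K (Comp X g f)) \<and>
    PCell Q (PComp K g f) = Id2 L (PMor P (Comp X g f))"
    using lift_Id2[of "W (Dom X f)" "W (Cod X g)" "Comp X g f" "Comp Y (K1 g) (K1 f)" "K1 (Comp X g f)"]
      k K1[of "Comp X g f"] * by (simp add: K_def Y.X.iso_cells_iff del: X.PMor_Comp)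
  then show "PComp K g f \<in> iso_cells Y (Comp Y (PMor K g) (PMor K f)) (PMor K (Comp X g f))"
    "PCell Q (PComp K g f) = Id2 L (PMor P (Comp X g f))" by blast+
qed

lemma K_normal: "normal X Y K"
  by (simp add: normal_def K_def K1_def)

text \<open>The identity of a has partners in both directions, and their composites are partners of
  the identity, hence isomorphic to identities over L.\<close>

lemma identity_lift:
  assumes "R0 a b w" "R0 a b' w'"
  obtains g where "R1 w w' (Id1 X a) g" "Dom Y g = b" "Cod Y g = b'" "equivalence Y g"
proof -
  have a: "a \<in> Obj X" "b \<in> Obj Y" "b' \<in> Obj Y" using R0_Obj assms by blast+
  then obtain g where g: "R1 w w' (Id1 X a) g" "Dom Y g = b" "Cod Y g = b'"
    using R1_ex[of "Id1 X a" b w b' w'] assms by auto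
  obtain h where h: "R1 w' w (Id1 X a) h" "Dom Y h = b'" "Cod Y h = b"
    using R1_ex[of "Id1 X a" b' w' b w] assms a by auto
  have m: "g \<in> Mor Y" "h \<in> Mor Y" using R1_Mor g h by blast+
  have "R1 w w (Id1 X a) (Comp Y h g)" using R1_Comp[OF g(1) h(1)] g h a by simp
  from lift_Id2[OF R1_Id1[OF assms(1)] this] have "iso_cells Y (Id1 Y b) (Comp Y h g) \<noteq> {}"
    using g h m a by (auto simp: Y.X.iso_cells_iff)
  moreover have "R1 w' w' (Id1 X a) (Comp Y g h)" using R1_Comp[OF h(1) g(1)] g h a by simp
  from lift_Id2[OF this R1_Id1[OF assms(2)]] have "iso_cells Y (Comp Y g h) (Id1 Y b') \<noteq> {}"
    using g h m a by (auto simp: Y.X.iso_cells_iff)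
  ultimately have "equivalence Y g" unfolding equivalence_def using m g h
    by (intro conjI bexI[of _ h]) (simp_all add: Y.X.hom_iff)
  then show ?thesis using that g by blast
qed

text \<open>F and G need only be partners of one common assignment \<open>ob\<close>,
  \<open>mo\<close>, by way of possibly different data U and V. The components are partners of
  identities that pass from U to V.\<close>

lemma pseudonatural_equivalence_of_matched:
  assumes F: "pfun_over Y Y L Q Q F" and G: "pfun_over Y Y L Q Q G"
    and C: "\<And>g. g \<in> Mor Y \<Longrightarrow> Dom X (mo g) = ob (Dom Y g) \<and> Cod X (mo g) = ob (Cod Y g)"
    and F0: "\<And>b. b \<in> Obj Y \<Longrightarrow> R0 (ob b) (PObj F b) (U b)" and G0: "\<And>b. b \<in> Obj Y \<Longrightarrow> R0 (ob b) (PObj G b) (V b)"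
    and F1: "\<And>g. g \<in> Mor Y \<Longrightarrow> R1 (U (Dom Y g)) (U (Cod Y g)) (mo g) (PMor F g)"
    and G1: "\<And>g. g \<in> Mor Y \<Longrightarrow> R1 (V (Dom Y g)) (V (Cod Y g)) (mo g) (PMor G g)"
  shows "\<exists>T. pseudonatural_equivalence Y Y F G T \<and> lies_over Y L Q T"
proof -
  interpret YY: faithful_over_pair Y Y L Q Q by unfold_locales
  note [simp] = YY.pfun_overD[OF F] YY.pfun_overD[OF G]
  have "\<forall>b. b \<in> Obj Y \<longrightarrow> (\<exists>t. R1 (U b) (V b) (Id1 X (ob b)) t \<and> Dom Y t = PObj F b \<and> Cod Y t = PObj G b \<and> equivalence Y t)"
    using identity_lift[OF F0 G0] by metis
  then obtain t where t: "\<And>b. b \<in> Obj Y \<Longrightarrow> R1 (U b) (V b) (Id1 X (ob b)) (t b) \<and> Dom Y (t b) = PObj F b \<and>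
      Cod Y (t b) = PObj G b \<and> equivalence Y (t b)" by metis
  have tm: "t b \<in> Mor Y" "PMor Q (t b) = Id1 L (PObj Q b)" if b: "b \<in> Obj Y" for b
  proof -
    show "t b \<in> Mor Y" using t[OF b] R1_Mor by blast
    have "PMor Q (t b) = PMor P (Id1 X (ob b))" using t[OF b] R1_Mor by metis
    then show "PMor Q (t b) = Id1 L (PObj Q b)" using R0_Obj[OF F0[OF b]] b by simp
  qed
  let ?T = "\<lparr>TComp = t, TCell = (\<lambda>g. lift (Comp Y (PMor G g) (t (Dom Y g))) (Comp Y (t (Cod Y g)) (PMor F g)) (Id2 L (PMor P (mo g))))\<rparr>"
  have c: "Y.X.invertible (TCell ?T g)" "Src Y (TCell ?T g) = Comp Y (PMor G g) (TComp ?T (Dom Y g))"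
      "Trg Y (TCell ?T g) = Comp Y (TComp ?T (Cod Y g)) (PMor F g)" "PCell Q (TCell ?T g) = Id2 L (PMor Q g)"
    if g: "g \<in> Mor Y" for g
  proof -
    have m: "mo g \<in> Mor X" "PMor P (mo g) = PMor Q g" using F1[OF g] R1_Mor[of _ _ "mo g"] g by auto
    note tt = t[OF Y.X.Obj_simps(1)[OF g]] t[OF Y.X.Obj_simps(2)[OF g]]
    note o = R0_Obj[OF F0[OF Y.X.Obj_simps(1)[OF g]]] R0_Obj[OF F0[OF Y.X.Obj_simps(2)[OF g]]]
    \<comment> \<open>The two sides of the naturality square are partners of \<open>mo g\<close>
      composed with an identity before or after it, with datum U at the source and V at the
      target.\<close>
    have 1: "R1 (U (Dom Y g)) (V (Cod Y g)) (mo g) (Comp Y (PMor G g) (t (Dom Y g)))"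
      using R1_Comp[OF conjunct1[OF tt(1)] G1[OF g]] C[OF g] m o tt g by simp
    have 2: "R1 (U (Dom Y g)) (V (Cod Y g)) (mo g) (Comp Y (t (Cod Y g)) (PMor F g))"
      using R1_Comp[OF F1[OF g] conjunct1[OF tt(2)]] C[OF g] m o tt g by simp
    note l = lift_Id2[OF 1 2]
    show "Y.X.invertible (TCell ?T g)" "Src Y (TCell ?T g) = Comp Y (PMor G g) (TComp ?T (Dom Y g))"
      "Trg Y (TCell ?T g) = Comp Y (TComp ?T (Cod Y g)) (PMor F g)" "PCell Q (TCell ?T g) = Id2 L (PMor Q g)"
      using l g tt tm m by simp_all
  qed
  have "pseudonatural Y Y F G ?T"
    by (rule YY.pseudonatural_over[OF F G]; (rule c)?; simp add: tm t)
  then have "pseudonatural_equivalence Y Y F G ?T" using t by (simp add: pseudonatural_equivalence_def)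
  moreover have "lies_over Y L Q ?T" using tm c by (simp add: lies_over_def)
  ultimately show ?thesis by blast
qed

end

locale bispan = XY: span X Y L P Q R0 R1 + YX: span Y X L Q P "\<lambda>b a. R0 a b" "\<lambda>w w' g f. R1 w w' f g"
  for X :: "('p, 'n, 'd) two_cat" and Y :: "('q, 'l, 'e) two_cat" and L :: "('o, 'm, 'c) two_cat"
    and P :: "('p, 'n, 'd, 'o, 'm, 'c) pfun" and Q :: "('q, 'l, 'e, 'o, 'm, 'c) pfun"
    and R0 :: "'p \<Rightarrow> 'q \<Rightarrow> 'w \<Rightarrow> bool" and R1 :: "'w \<Rightarrow> 'w \<Rightarrow> 'n \<Rightarrow> 'l \<Rightarrow> bool"
begin

lemma biequivalence: "biequivalence_over L X P Y Q XY.K YX.K"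
  unfolding biequivalence_over_def
proof (intro conjI)
  let ?K = XY.K and ?C = YX.K
  note Ko = XY.K_over and Co = YX.K_over
  note [simp] = XY.pfun_overD[OF Ko] YX.pfun_overD[OF Co]
  show "pseudofunctor X L P" by (rule XY.X.pseudofunctor)
  show "pseudofunctor Y L Q" by (rule XY.Y.pseudofunctor)
  show "pseudofunctor X Y ?K" by (rule XY.pfun_over_pseudofunctor[OF Ko])
  show "pseudofunctor Y X ?C" by (rule YX.pfun_over_pseudofunctor[OF Co])
  show "pfun_eq X (comp_pfun L Q ?K) P" by (rule XY.pfun_over_eq[OF Ko])
  show "pfun_eq Y (comp_pfun L P ?C) Q" by (rule YX.pfun_over_eq[OF Co])
  have K0: "XY.K0 = PObj ?K" "XY.K1 = PMor ?K" by (simp_all add: XY.K_def)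
  have C0: "YX.K0 = PObj ?C" "YX.K1 = PMor ?C" by (simp_all add: YX.K_def)
  note W = XY.R0_W[unfolded K0] YX.R0_W[unfolded C0]
  have R: "R1 (XY.W (Dom X f)) (XY.W (Cod X f)) f (PMor ?K f)"
    "R1 (YX.W (PObj ?K (Dom X f))) (YX.W (PObj ?K (Cod X f))) (PMor ?C (PMor ?K f)) (PMor ?K f)" if "f \<in> Mor X" for f
    using XY.K1[OF that] YX.K1[of "PMor ?K f"] that by (simp_all add: K0 C0)
  have R': "R1 (YX.W (Dom Y g)) (YX.W (Cod Y g)) (PMor ?C g) g"
    "R1 (XY.W (PObj ?C (Dom Y g))) (XY.W (PObj ?C (Cod Y g))) (PMor ?C g) (PMor ?K (PMor ?C g))" if "g \<in> Mor Y" for g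
    using YX.K1[OF that] XY.K1[of "PMor ?C g"] that by (simp_all add: K0 C0)
  have id: "pfun_over Y Y L Q Q (id_pfun Y)" "pfun_over X X L P P (id_pfun X)"
    by (rule pfun_over_id, unfold_locales)+
  have comp: "pfun_over Y Y L Q Q (comp_pfun Y ?K ?C)" "pfun_over X X L P P (comp_pfun X ?C ?K)"
    by (rule pfun_over_comp[OF _ _ Co Ko], unfold_locales) (rule pfun_over_comp[OF _ _ Ko Co], unfold_locales)
  \<comment> \<open>Both b and K C b are partners of C b, so \<open>PObj ?C\<close> serves as the
    common assignment. The other half uses \<open>PObj ?K\<close> in the same way.\<close>
  show "\<exists>\<eta>. pseudonatural_equivalence Y Y (id_pfun Y) (comp_pfun Y ?K ?C) \<eta> \<and> lies_over Y L Q \<eta>"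
    by (rule XY.pseudonatural_equivalence_of_matched[OF id(1) comp(1), where ob = "PObj ?C" and mo = "PMor ?C" and
      U = YX.W and V = "\<lambda>b. XY.W (PObj ?C b)"]) (simp_all add: id_pfun_def strict_pfun_def comp_pfun_def W R')
  show "\<exists>\<epsilon>. pseudonatural_equivalence X X (comp_pfun X ?C ?K) (id_pfun X) \<epsilon> \<and> lies_over X L P \<epsilon>"
    by (rule YX.pseudonatural_equivalence_of_matched[OF comp(2) id(2), where ob = "PObj ?K" and mo = "PMor ?K" and
      V = XY.W and U = "\<lambda>b. YX.W (PObj ?K b)"]) (simp_all add: id_pfun_def strict_pfun_def comp_pfun_def W R)
qed

end

section \<open>The factorization system and the biequivalence\<close>

context exact_ideal
begin

abbreviation "EE \<equiv> arrows_in L (cokernels L N)"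
abbreviation "MM \<equiv> arrows_in L (kernels L N)"

lemma arrows_in_simps [simp]:
  "Obj (arrows_in L S) = Mor L \<inter> S" "Mor (arrows_in L S) = {q \<in> Mor Ar. sq_dom q \<in> S \<and> sq_cod q \<in> S}"
  "Cell (arrows_in L S) = {x \<in> Cell Ar. sq_dom (sc_src x) \<in> S \<and> sq_cod (sc_src x) \<in> S}"
  "Dom (arrows_in L S) = sq_dom" "Cod (arrows_in L S) = sq_cod" "Src (arrows_in L S) = sc_src"
  "Trg (arrows_in L S) = sc_trg" "Id1 (arrows_in L S) = Id1 Ar" "Comp (arrows_in L S) = square_comp L"
  "Id2 (arrows_in L S) = Id2 Ar" "VComp (arrows_in L S) = VComp Ar" "HComp (arrows_in L S) = HComp Ar"
  by (simp_all add: arrows_in_def)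

lemma dom_simps [simp]:
  "PObj (dom_pfun L S) = Dom L" "PMor (dom_pfun L S) = sq_top" "PCell (dom_pfun L S) = sc_top"
  "PComp (dom_pfun L S) g f = Id2 L (sq_top (square_comp L g f))"
  "PUnit (dom_pfun L S) A = Id2 L (Id1 L (Dom L A))"
  by (simp_all add: dom_pfun_def strict_pfun_def)

lemma cod_simps [simp]:
  "PObj (cod_pfun L S) = Cod L" "PMor (cod_pfun L S) = sq_bot" "PCell (cod_pfun L S) = sc_bot"
  "PComp (cod_pfun L S) g f = Id2 L (sq_bot (square_comp L g f))"
  "PUnit (cod_pfun L S) A = Id2 L (Id1 L (Cod L A))"
  by (simp_all add: cod_pfun_def strict_pfun_def)

lemma two_category_arrows_in: "two_category (arrows_in L S)"
  unfolding arrows_in_def by (rule two_category.two_category_full_sub[OF two_category_pseudo_arrow])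

text \<open>Compatibility with the invertible fillings determines the bottom 2-cell whiskered with e
  from the top one, and a cokernel e is faithful on such 2-cells.\<close>

lemma over_dom: "faithful_over EE L (dom_pfun L (cokernels L N))"
proof -
  interpret X: two_category EE by (rule two_category_arrows_in)
  show ?thesis
  proof unfold_locales
    fix x y assume *: "x \<in> Cell EE" "y \<in> Cell EE" "Src EE x = Src EE y" "Trg EE x = Trg EE y"
      "PCell (dom_pfun L (cokernels L N)) x = PCell (dom_pfun L (cokernels L N)) y"
    then have c: "x \<in> Cell Ar" "y \<in> Cell Ar" and s: "sc_src x = sc_src y" "sc_trg x = sc_trg y" "sc_top x = sc_top y"
      and e: "sq_dom (sc_src y) \<in> cokernels L N" by simp_all
    obtain g p where k: "cokernel_of g (sq_dom (sc_src y)) p" using e cokernels_iff by blast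
    have "(sc_bot x \<lhd> sq_dom (sc_src y)) \<bullet> sq_fill (sc_src y) = (sc_bot y \<lhd> sq_dom (sc_src y)) \<bullet> sq_fill (sc_src y)"
      using Ar_Cell_compatible[OF c(1)] Ar_Cell_compatible[OF c(2)] s by simp
    then have "sc_bot x \<lhd> sq_dom (sc_src y) = sc_bot y \<lhd> sq_dom (sc_src y)"
      by (rule VComp_right_cancel[rotated 5]) (use c s Ar_CellD[OF c(1)] in simp_all)
    then have "sc_bot x = sc_bot y"
      by (rule cokernel_faithful[OF k, rotated 5]) (use c s Ar_CellD[OF c(1)] in simp_all)
    then show "x = y" using s by (intro square_cell.expand) simp
  qed (auto simp: hom_iff cells_iff)
qed

lemma over_cod: "faithful_over MM L (cod_pfun L (kernels L N))"
proof -
  interpret X: two_category MM by (rule two_category_arrows_in)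
  show ?thesis
  proof unfold_locales
    fix x y assume *: "x \<in> Cell MM" "y \<in> Cell MM" "Src MM x = Src MM y" "Trg MM x = Trg MM y"
      "PCell (cod_pfun L (kernels L N)) x = PCell (cod_pfun L (kernels L N)) y"
    then have c: "x \<in> Cell Ar" "y \<in> Cell Ar" and s: "sc_src x = sc_src y" "sc_trg x = sc_trg y" "sc_bot x = sc_bot y"
      and m: "sq_cod (sc_src y) \<in> kernels L N" by simp_all
    obtain f p where k: "kernel_of f (sq_cod (sc_src y)) p" using m kernels_iff by blast
    have "sq_fill (sc_trg y) \<bullet> (sq_cod (sc_src y) \<rhd> sc_top x) = sq_fill (sc_trg y) \<bullet> (sq_cod (sc_src y) \<rhd> sc_top y)"
      using Ar_Cell_compatible[OF c(1)] Ar_Cell_compatible[OF c(2)] s by simp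
    then have "sq_cod (sc_src y) \<rhd> sc_top x = sq_cod (sc_src y) \<rhd> sc_top y"
      by (rule VComp_left_cancel[rotated 5]) (use c s Ar_CellD[OF c(1)] in simp_all)
    then have "sc_top x = sc_top y"
      by (rule kernel_faithful[OF k, rotated 5]) (use c s Ar_CellD[OF c(1)] in simp_all)
    then show "x = y" using s by (intro square_cell.expand) simp
  qed (auto simp: hom_iff cells_iff)
qed

lemma bispan: "bispan EE MM L (dom_pfun L (cokernels L N)) (cod_pfun L (kernels L N)) exact_pair matched"
proof -
  interpret X: faithful_over EE L "dom_pfun L (cokernels L N)" by (rule over_dom)
  interpret Y: faithful_over MM L "cod_pfun L (kernels L N)" by (rule over_cod)
  have c: "f \<in> Mor EE \<and> g \<in> Mor MM \<and> sq_top f = sq_bot g \<and> exact_pair (sq_dom f) (sq_dom g) p \<and> exact_pair (sq_cod f) (sq_cod g) p'"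
    if "matched p p' f g" for p p' f g
    using that exact_pairD(4,5)[of "sq_dom f" "sq_dom g" p] exact_pairD(4,5)[of "sq_cod f" "sq_cod g" p']
    by (simp add: matched_def)
  have cells: "cells EE f f1 = cells Ar f f1" if "f \<in> Mor EE" for f f1 using that by (auto simp: cells_def)
  have cells': "cells MM g g1 = cells Ar g g1" if "g \<in> Mor MM" for g g1 using that by (auto simp: cells_def)
  show ?thesis
  \<comment> \<open>Cases 1 to 7 give the span from cokernels to kernels, cases 8 to 14 the same
    relations read from kernels to cokernels.\<close>
  proof (unfold_locales, unfold arrows_in_simps dom_simps cod_simps, goal_cases)
    case (1 a b w) then show ?case using exact_pairD[of a b w] by simp
  next
    case (2 a) then show ?case using exact_pair_of_cokernel[of a] by simp
  next
    case (3 w w' f g) then show ?case using c[of w w' f g] by simp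
  next
    case (4 f b w b' w') then show ?case using matched_ex_kernel_side[of f b w b' w'] by simp
  next
    case (5 a b w) then show ?case by (rule matched_Id1)
  next
    case 6 then show ?case by (rule matched_Comp)
  next
    case (7 w w' f g f1 g1 x) then show ?case using matched_cell_kernel_side[of w w' f g f1 g1 x] c[of w w' f g]
      by (simp only: cells cells')
  next
    case (8 a b w) then show ?case using exact_pairD[of b a w] by simp
  next
    case (9 a) then show ?case using exact_pair_of_kernel[of a] by simp
  next
    case (10 w w' f g) then show ?case using c[of w w' g f] by simp
  next
    case (11 f b w b' w') then show ?case using matched_ex_cokernel_side[of f b w b' w'] by simp
  next
    case (12 a b w) then show ?case by (rule matched_Id1)
  next
    case 13 then show ?case using matched_Comp by blast
  next
    case (14 w w' g f g1 f1 y) then show ?case using matched_cell_cokernel_side[of w w' f g f1 g1 y] c[of w w' f g]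
      by (simp only: cells cells')
  qed
qed

lemma normal_biequivalence: "normal_biequivalence_dom_cod L (cokernels L N) (kernels L N)"
proof -
  interpret bispan EE MM L "dom_pfun L (cokernels L N)" "cod_pfun L (kernels L N)" exact_pair matched
    by (rule bispan)
  show ?thesis unfolding normal_biequivalence_dom_cod_def
    using XY.K_normal YX.K_normal biequivalence by blast
qed

lemma rel_orthogonal:
  assumes fact: "\<forall>f \<in> Mor L. \<exists>e m. e \<in> cokernels L N \<and> m \<in> kernels L N \<and> Dom L m = Cod L e \<and>
        iso_cells L f (m \<odot> e) \<noteq> {}"
  shows "rel_orthogonal_ck_fs L N (cokernels L N) (kernels L N)"
  unfolding rel_orthogonal_ck_fs_def
proof (intro conjI)
  show "cokernels L N \<subseteq> cokernels L N" "kernels L N \<subseteq> kernels L N" by simp_all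
  show "\<forall>f\<in>Mor L. \<exists>e\<in>cokernels L N. \<exists>m\<in>kernels L N. Dom L m = Cod L e \<and> iso_cells L f (m \<odot> e) \<noteq> {}"
    using fact by blast
  show "\<forall>m\<in>kernels L N. \<forall>i. equivalence L i \<and> Cod L i = Dom L m \<longrightarrow> m \<odot> i \<in> kernels L N"
    using kernel_equivalence unfolding Ball_def kernels_iff by blast
  show "\<forall>e\<in>cokernels L N. \<forall>i. equivalence L i \<and> Dom L i = Cod L e \<longrightarrow> i \<odot> e \<in> cokernels L N"
    using cokernel_equivalence unfolding Ball_def cokernels_iff by blast
  show "\<forall>m\<in>kernels L N. \<forall>f. iso_cells L m f \<noteq> {} \<longrightarrow> f \<in> kernels L N"
    using kernel_iso unfolding Ball_def kernels_iff ex_in_conv[symmetric] iso_cells_iff by blast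
  show "\<forall>e\<in>cokernels L N. \<forall>f. iso_cells L e f \<noteq> {} \<longrightarrow> f \<in> cokernels L N"
    using cokernel_iso unfolding Ball_def cokernels_iff ex_in_conv[symmetric] iso_cells_iff by blast
  show "\<forall>e\<in>cokernels L N. \<forall>m\<in>kernels L N. \<forall>s t \<phi> f n\<^sub>m \<alpha> g n\<^sub>e \<beta>.
        is_square L e m s t \<phi> \<and> is_kernel L N f m n\<^sub>m \<alpha> \<and> is_cokernel L N g e n\<^sub>e \<beta> \<and>
        null_iso L N (nu_left L N (f \<odot> t) n\<^sub>e \<bullet> ((f \<odot> t) \<rhd> \<beta>) \<bullet> (f \<rhd> (\<phi> \<lhd> g))
          \<bullet> (cinv L \<alpha> \<lhd> (s \<odot> g)) \<bullet> cinv L (nu_right L N n\<^sub>m (s \<odot> g))) \<longrightarrow>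
        (\<exists>d \<sigma> \<rho>. fills L e m s t \<phi> d \<sigma> \<rho>)"
  proof (intro ballI allI impI, elim conjE)
    fix e m s t \<phi> f n\<^sub>m \<alpha> g n\<^sub>e \<beta>
    assume sq: "is_square L e m s t \<phi>" and k: "is_kernel L N f m n\<^sub>m \<alpha>" and c: "is_cokernel L N g e n\<^sub>e \<beta>"
      and n: "null_iso L N (nu_left L N (f \<odot> t) n\<^sub>e \<bullet> ((f \<odot> t) \<rhd> \<beta>) \<bullet> (f \<rhd> (\<phi> \<lhd> g))
          \<bullet> (cinv L \<alpha> \<lhd> (s \<odot> g)) \<bullet> cinv L (nu_right L N n\<^sub>m (s \<odot> g)))"
    have kk: "kernel_of f m \<alpha>" and cc: "cokernel_of g e \<beta>" using kernel_ofI[OF k] cokernel_ofI[OF c] .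
    note kd = kernelD[OF kk] and cd = cokernelD[OF cc]
    have nn: "n\<^sub>m = Trg L \<alpha>" "n\<^sub>e = Trg L \<beta>"
      using k c unfolding is_cokernel_def is_kernel_def op2_derived iso_cells_iff by blast+
    note sd = is_squareD[OF sq]
    \<comment> \<open>The long composite of the relative condition is the conjugate of
      \<open>f \<rhd> (\<phi> \<lhd> g)\<close> by two whiskered presentations, which turns the
      condition into \<open>riso\<close>.\<close>
    have "pres_left (f \<odot> t) \<beta> \<bullet> (f \<rhd> (\<phi> \<lhd> g)) \<bullet> cinv L (pres_right \<alpha> (s \<odot> g)) =
        lnu (f \<odot> t) n\<^sub>e \<bullet> ((f \<odot> t) \<rhd> \<beta>) \<bullet> (f \<rhd> (\<phi> \<lhd> g))
          \<bullet> (cinv L \<alpha> \<lhd> (s \<odot> g)) \<bullet> cinv L (rnu n\<^sub>m (s \<odot> g))"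
      unfolding nn using kd cd sd by (simp add: pres_left_def pres_right_def)
    then have "null_iso L N (pres_left (f \<odot> t) \<beta> \<bullet> (f \<rhd> (\<phi> \<lhd> g)) \<bullet> cinv L (pres_right \<alpha> (s \<odot> g)))"
      using n by (simp only: lnu_def rnu_def)
    then have r: "riso (pres_right \<alpha> (s \<odot> g)) (pres_left (f \<odot> t) \<beta>) (f \<rhd> (\<phi> \<lhd> g))"
      by (rule iffD2[OF riso_iff_null_iso, rotated 5]) (use kd cd sd in simp_all)
    show "\<exists>d \<sigma> \<rho>. fills L e m s t \<phi> d \<sigma> \<rho>" by (rule diagonal_exists[OF kk cc sq r])
  qed
  show "\<forall>e\<in>cokernels L N. \<forall>m\<in>kernels L N. \<forall>s t \<phi> d \<sigma> \<rho> s' t' \<phi>' d' \<sigma>' \<rho>' \<xi> \<mu>.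
        is_square L e m s t \<phi> \<and> fills L e m s t \<phi> d \<sigma> \<rho> \<and>
        is_square L e m s' t' \<phi>' \<and> fills L e m s' t' \<phi>' d' \<sigma>' \<rho>' \<and>
        \<xi> \<in> cells L s s' \<and> \<mu> \<in> cells L t t' \<and>
        \<phi>' \<bullet> (m \<rhd> \<xi>) = (\<mu> \<lhd> e) \<bullet> \<phi> \<longrightarrow>
        (\<exists>!\<iota>. \<iota> \<in> cells L d d' \<and> \<rho>' \<bullet> (m \<rhd> \<iota>) = \<mu> \<bullet> \<rho> \<and> (\<iota> \<lhd> e) \<bullet> \<sigma> = \<sigma>' \<bullet> \<xi>)"
  proof (intro ballI allI impI, elim conjE)
    fix e m s t \<phi> d \<sigma> \<rho> s' t' \<phi>' d' \<sigma>' \<rho>' \<xi> \<mu>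
    assume e: "e \<in> cokernels L N" and m: "m \<in> kernels L N"
      and sq: "is_square L e m s t \<phi>" "fills L e m s t \<phi> d \<sigma> \<rho>"
      and sq': "is_square L e m s' t' \<phi>'" "fills L e m s' t' \<phi>' d' \<sigma>' \<rho>'"
      and c: "\<xi> \<in> cells L s s'" "\<mu> \<in> cells L t t'" "\<phi>' \<bullet> (m \<rhd> \<xi>) = (\<mu> \<lhd> e) \<bullet> \<phi>"
    obtain g q where g: "cokernel_of g e q" using e cokernels_iff by blast
    obtain f p where f: "kernel_of f m p" using m kernels_iff by blast
    show "\<exists>!\<iota>. \<iota> \<in> cells L d d' \<and> \<rho>' \<bullet> (m \<rhd> \<iota>) = \<mu> \<bullet> \<rho> \<and> (\<iota> \<lhd> e) \<bullet> \<sigma> = \<sigma>' \<bullet> \<xi>"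
      by (rule diagonal_cell[OF f g sq sq' c])
  qed
qed

end

lemma exact_idealI:
  assumes "weakly_Grandis_2_exact L N"
  shows "exact_ideal L N"
proof -
  interpret two_category L using assms by (simp add: weakly_Grandis_2_exact_def)
  interpret two_ideal_context L N by unfold_locales (use assms in \<open>simp add: weakly_Grandis_2_exact_def\<close>)
  interpret null_ideal L N by (rule null_ideal)
  show ?thesis
    by unfold_locales (use assms in \<open>simp_all add: weakly_Grandis_2_exact_def weakly_closed_def\<close>)
qed

theorem theorem4p17:
  fixes L :: "('o, 'm, 'c) two_cat" and N :: "('o, 'm, 'c) ideal" and Z :: 'o
  shows "(weakly_Grandis_2_exact L N \<longrightarrow>
            rel_orthogonal_ck_fs L N (cokernels L N) (kernels L N) \<and>
            normal_biequivalence_dom_cod L (cokernels L N) (kernels L N)) \<and>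
         (weakly_Puppe_2_exact L Z \<longrightarrow>
            rel_orthogonal_ck_fs L (zero_ideal L Z)
              (cokernels L (zero_ideal L Z)) (kernels L (zero_ideal L Z)) \<and>
            normal_biequivalence_dom_cod L
              (cokernels L (zero_ideal L Z)) (kernels L (zero_ideal L Z)))"
proof -
  \<comment> \<open>Proved for an arbitrary ideal, so that it also applies to
    \<open>zero_ideal L Z\<close>.\<close>
  have Grandis: "rel_orthogonal_ck_fs L N (cokernels L N) (kernels L N) \<and>
      normal_biequivalence_dom_cod L (cokernels L N) (kernels L N)"
    if "weakly_Grandis_2_exact L N" for N
    using exact_ideal.rel_orthogonal[OF exact_idealI[OF that]] exact_ideal.normal_biequivalence[OF exact_idealI[OF that]] that
    by (simp add: weakly_Grandis_2_exact_def)
  then show ?thesis by (simp add: weakly_Puppe_2_exact_def)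
qed

end
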